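(* Let $(P_1,\dots,P_d)\sim\text{Vec-FDP}(\Lambda,\boldsymbol\gamma,P_0)$, obtained by normalization $P_j=\mu_j/\mu_j(\Theta)$ of the vector of random measures $(\mu_1,\dots,\mu_d)$, and let $(\boldsymbol\theta_1,\dots,\boldsymbol\theta_d)$, $\boldsymbol\theta_j=(\theta_{j,1},\dots,\theta_{j,n_j})$, $n_j\ge1$, be such that conditionally on $(\mu_1,\dots,\mu_d)$ the $\theta_{j,i}$ are independent with $\theta_{j,i}\sim P_j$. Let $\boldsymbol U_n=(U_1,\dots,U_d)$ be the auxiliary variables defined in the context. Let $\theta^{**}_1,\dots,\theta^{**}_K$ be the distinct values in $(\boldsymbol\theta_1,\dots,\boldsymbol\theta_d)$ and $n_{j,k}=\#\{i:\theta_{j,i}=\theta^{**}_k\}$. Then, conditionally on $(\boldsymbol\theta_1,\dots,\boldsymbol\theta_d)$ and $\boldsymbol U_n=\boldsymbol u=(u_1,\dots,u_d)$, the vector $(\mu_1,\dots,\mu_d)$ is equal in distribution to $(\mu_1^{(a)},\dots,\mu_d^{(a)})+(\mu_1^{(na)},\dots,\mu_d^{(na)})$, where the two summands are independent, $$\mu_j^{(a)}=\sum_{k=1}^KS^{(a)}_{j,k}\delta_{\theta^{**}_k},\qquad \mu_j^{(na)}=\sum_{m=1}^{M^*}S^{(na)}_{j,m}\delta_{\tau^*_m},$$ with $M^*\sim q^*_M$ and, conditionally on $M^*$, $\tau_1^*,\dots,\tau^*_{M^*}$ i.i.d. from $P_0$ independent of the $S^{(na)}_{j,m}$, and the following specifications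 hold: (i) $S^{(a)}_{j,k}\sim\text{Gamma}(n_{j,k}+\gamma_j,u_j+1)$, independently for $j\in\{1,\dots,d\}$ and $k\in\{1,\dots,K\}$; (ii) conditionally on $M^*$, $S^{(na)}_{j,1},\dots,S^{(na)}_{j,M^*}$ are i.i.d. $\text{Gamma}(\gamma_j,u_j+1)$, independently for $j\in\{1,\dots,d\}$; (iii) $q_M^*$ is the distribution on $\{0,1,2,\dots\}$ given by the mixture $$q_M^*=(1-w_K(\boldsymbol u))\,\text{Pois}_1\Big(\Lambda\prod_{j=1}^d\psi_j(u_j)\Big)+w_K(\boldsymbol u)\,\text{Pois}\Big(\Lambda\prod_{j=1}^d\psi_j(u_j)\Big),$$ where $w_K(\boldsymbol u)=K/\big(\Lambda\prod_{j=1}^d\psi_j(u_j)+K\big)$ and $\psi_j(u_j)=(1+u_j)^{-\gamma_j}$.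
   Context: All Gamma distributions use the shape-rate parametrization. $\text{Pois}(\lambda)$ is the Poisson distribution and $\text{Pois}_1(\lambda)$ is the 1-shifted Poisson distribution, i.e. the law of $1+N$ with $N\sim\text{Pois}(\lambda)$. Vec-FDP. Let $d\ge1$, $\Lambda>0$, $\boldsymbol\gamma=(\gamma_1,\dots,\gamma_d)$ with $\gamma_j>0$, and $P_0$ a diffuse (non-atomic) probability measure on $\Theta\subset\mathbb R^s$. Let $M\sim\text{Pois}_1(\Lambda)$. Conditionally on $M$, let $\tau_1,\dots,\tau_M$ be i.i.d. from $P_0$ and, independently, let $S_{j,m}\sim\text{Gamma}(\gamma_j,1)$ be independent for $1\le j\le d$, $1\le m\le M$. Put $\mu_j=\sum_{m=1}^MS_{j,m}\delta_{\tau_m}$ and $P_j=\mu_j/\mu_j(\Theta)$. The law of $(P_1,\dots,P_d)$ is denoted $\text{Vec-FDP}(\Lambda,\boldsymbol\gamma,P_0)$. Auxiliary variables. Put $T_j=\mu_j(\Theta)$. Conditionally on $(\mu_1,\dots,\mu_d)$, the variables $U_1,\dots,U_d$ are independent of each other and of all the $\theta_{j,i}$, with $U_j\sim\text{Gamma}(n_j,T_j)$. *)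

theory Defs
  imports "HOL-Probability.Probability"
begin

section \<open>Gamma and Poisson-type distributions\<close>

definition gamma_density :: "real \<Rightarrow> real \<Rightarrow> real \<Rightarrow> real" where
  "gamma_density a b x =
     (if x > 0 then b powr a / Gamma a * x powr (a - 1) * exp (- (b * x)) else 0)"

text \<open>
  Shape \<open>a\<close>, rate \<open>b\<close>.  The point mass outside the parameter range \<open>a, b > 0\<close> is an
  arbitrary convention that only serves to have a probability measure for all arguments.
\<close>

definition gamma_law :: "real \<Rightarrow> real \<Rightarrow> real measure" where
  "gamma_law a b =
     (if a > 0 \<and> b > 0 then density lborel (\<lambda>x. ennreal (gamma_density a b x))
      else return borel 0)"

definition pois1_pmf :: "real \<Rightarrow> nat pmf" where
  "pois1_pmf l = map_pmf Suc (poisson_pmf l)"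

definition mixture_pmf :: "real \<Rightarrow> 'a pmf \<Rightarrow> 'a pmf \<Rightarrow> 'a pmf" where
  "mixture_pmf w p q = bind_pmf (bernoulli_pmf w) (\<lambda>b. if b then q else p)"

lemma pmf_mixture_pmf:
  assumes "0 \<le> w" "w \<le> 1"
  shows "pmf (mixture_pmf w p q) x = (1 - w) * pmf p x + w * pmf q x"
  using assms by (simp add: mixture_pmf_def pmf_bind)

definition psi :: "real \<Rightarrow> real \<Rightarrow> real" where
  "psi g u = (1 + u) powr (- g)"

text \<open>The law \<open>q\<^sub>M\<^sup>*\<close>, for \<open>l = \<Lambda> \<Prod>\<^sub>j \<psi>\<^sub>j(u\<^sub>j)\<close> and \<open>K\<close> distinct values.\<close>

definition q_star :: "real \<Rightarrow> nat \<Rightarrow> nat pmf" where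
  "q_star l K = mixture_pmf (real K / (l + real K)) (pois1_pmf l) (poisson_pmf l)"


section \<open>Random finite measures\<close>

text \<open>
  The space of finite measures on \<open>B\<close>, with the sigma-algebra generated by the evaluations
  \<open>m \<mapsto> m(A)\<close>; the same construction as \<^const>\<open>subprob_algebra\<close>.
\<close>

definition finite_measure_algebra :: "'a measure \<Rightarrow> 'a measure measure" where
  "finite_measure_algebra B =
     (SUP A \<in> sets B. vimage_algebra {M. finite_measure M \<and> sets M = sets B} (\<lambda>M. emeasure M A) borel)"

abbreviation measure_vectors :: "nat \<Rightarrow> 'a measure \<Rightarrow> (nat \<Rightarrow> 'a measure) measure" where
  "measure_vectors d B \<equiv> PiM {1..d} (\<lambda>_. finite_measure_algebra B)"

text \<open>\<open>weighted_diracs B m s x\<close> is the measure \<open>\<Sum>\<^sub>k\<^sub>=\<^sub>1\<^sup>m s\<^sub>k \<delta>(x\<^sub>k)\<close> on \<open>B\<close>.\<close>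

definition weighted_diracs :: "'a measure \<Rightarrow> nat \<Rightarrow> (nat \<Rightarrow> real) \<Rightarrow> (nat \<Rightarrow> 'a) \<Rightarrow> 'a measure" where
  "weighted_diracs B m s x =
     measure_of (space B) (sets B) (\<lambda>A. \<Sum>k\<in>{1..m}. ennreal (s k) * indicator A (x k))"

definition add_measure :: "'a measure \<Rightarrow> 'a measure \<Rightarrow> 'a measure" where
  "add_measure M N = measure_of (space M) (sets M) (\<lambda>A. emeasure M A + emeasure N A)"

text \<open>For the zero measure the result is the zero measure.\<close>

definition normalize_measure :: "'a measure \<Rightarrow> 'a measure" where
  "normalize_measure M = scale_measure (inverse (emeasure M (space M))) M"

definition indep_gammas ::
  "nat \<Rightarrow> nat \<Rightarrow> (nat \<Rightarrow> nat \<Rightarrow> real) \<Rightarrow> (nat \<Rightarrow> real) \<Rightarrow> (nat \<Rightarrow> nat \<Rightarrow> real) measure" where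
  "indep_gammas d m a b = PiM {1..d} (\<lambda>j. PiM {1..m} (\<lambda>k. gamma_law (a j k) (b j)))"

text \<open>
  Law of \<open>(\<Sum>\<^sub>k\<^sub>\<le>\<^sub>m S\<^sub>j\<^sub>k \<delta>(x\<^sub>k))\<^sub>j\<close> with deterministic \<open>m\<close> and \<open>x\<close> and
  independent \<open>S\<^sub>j\<^sub>k \<sim> Gamma(a\<^sub>j\<^sub>k, b\<^sub>j)\<close>.
\<close>

definition fixed_atoms_law ::
  "'a measure \<Rightarrow> nat \<Rightarrow> nat \<Rightarrow> (nat \<Rightarrow> 'a) \<Rightarrow> (nat \<Rightarrow> nat \<Rightarrow> real) \<Rightarrow> (nat \<Rightarrow> real) \<Rightarrow>
   (nat \<Rightarrow> 'a measure) measure" where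
  "fixed_atoms_law B d m x a b =
     distr (indep_gammas d m a b) (measure_vectors d B)
       (\<lambda>S. \<lambda>j\<in>{1..d}. weighted_diracs B m (S j) x)"

text \<open>
  Law of \<open>(\<Sum>\<^sub>k\<^sub>\<le>\<^sub>M S\<^sub>j\<^sub>k \<delta>(\<tau>\<^sub>k))\<^sub>j\<close> with \<open>M \<sim> q\<close> and, given \<open>M\<close>, i.i.d. \<open>\<tau>\<^sub>k \<sim> P0\<close>
  and, independently, independent \<open>S\<^sub>j\<^sub>k \<sim> Gamma(a\<^sub>j, b\<^sub>j)\<close>.
\<close>

definition random_atoms_law ::
  "nat pmf \<Rightarrow> nat \<Rightarrow> 'a measure \<Rightarrow> (nat \<Rightarrow> real) \<Rightarrow> (nat \<Rightarrow> real) \<Rightarrow> (nat \<Rightarrow> 'a measure) measure" where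
  "random_atoms_law q d P0 a b =
     measure_pmf q \<bind> (\<lambda>m.
       distr (PiM {1..m} (\<lambda>_. P0) \<Otimes>\<^sub>M indep_gammas d m (\<lambda>j k. a j) b) (measure_vectors d P0)
         (\<lambda>(\<tau>, S). \<lambda>j\<in>{1..d}. weighted_diracs P0 m (S j) \<tau>))"

text \<open>
  The law of the unnormalized vector \<open>(\<mu>\<^sub>1, \<dots>, \<mu>\<^sub>d)\<close>, and the law of its coordinatewise
  normalization, the Vec-FDP itself.
\<close>

definition vec_fdp_unnormalized ::
  "nat \<Rightarrow> real \<Rightarrow> (nat \<Rightarrow> real) \<Rightarrow> 'a measure \<Rightarrow> (nat \<Rightarrow> 'a measure) measure" where
  "vec_fdp_unnormalized d \<Lambda> \<gamma> P0 = random_atoms_law (pois1_pmf \<Lambda>) d P0 \<gamma> (\<lambda>_. 1)"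

definition vec_fdp ::
  "nat \<Rightarrow> real \<Rightarrow> (nat \<Rightarrow> real) \<Rightarrow> 'a measure \<Rightarrow> (nat \<Rightarrow> 'a measure) measure" where
  "vec_fdp d \<Lambda> \<gamma> P0 =
     distr (vec_fdp_unnormalized d \<Lambda> \<gamma> P0) (PiM {1..d} (\<lambda>_. subprob_algebra P0))
       (\<lambda>\<mu>. \<lambda>j\<in>{1..d}. normalize_measure (\<mu> j))"


section \<open>Conditional laws and samples\<close>

text \<open>
  \<open>\<kappa>\<close> is a regular version of the conditional law of \<open>X\<close> given \<open>Y\<close>.  Taking \<open>A\<close> to be the
  whole space shows that \<open>\<kappa> y\<close> is a probability measure for almost every \<open>y\<close>; subprobability
  kernels leave room for null sets of \<open>y\<close> (such as zero measures, which have no normalization).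
\<close>

definition has_cond_law ::
  "'w measure \<Rightarrow> 'x measure \<Rightarrow> ('w \<Rightarrow> 'x) \<Rightarrow> 'y measure \<Rightarrow> ('w \<Rightarrow> 'y) \<Rightarrow> ('y \<Rightarrow> 'x measure) \<Rightarrow> bool" where
  "has_cond_law \<Omega> \<X> X \<Y> Y \<kappa> \<longleftrightarrow>
     X \<in> \<Omega> \<rightarrow>\<^sub>M \<X> \<and> Y \<in> \<Omega> \<rightarrow>\<^sub>M \<Y> \<and> \<kappa> \<in> \<Y> \<rightarrow>\<^sub>M subprob_algebra \<X> \<and>
     (\<forall>A\<in>sets \<X>. \<forall>B\<in>sets \<Y>.
        emeasure \<Omega> {\<omega>\<in>space \<Omega>. X \<omega> \<in> A \<and> Y \<omega> \<in> B} =
        (\<integral>\<^sup>+ y\<in>B. emeasure (\<kappa> y) A \<partial>distr \<Omega> \<Y> Y))"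

abbreviation samples_space :: "nat \<Rightarrow> (nat \<Rightarrow> nat) \<Rightarrow> 'a measure \<Rightarrow> (nat \<Rightarrow> nat \<Rightarrow> 'a) measure" where
  "samples_space d n B \<equiv> PiM {1..d} (\<lambda>j. PiM {1..n j} (\<lambda>_. B))"

definition distinct_values :: "nat \<Rightarrow> (nat \<Rightarrow> nat) \<Rightarrow> (nat \<Rightarrow> nat \<Rightarrow> 'a) \<Rightarrow> 'a set" where
  "distinct_values d n t = {t j i | j i. j \<in> {1..d} \<and> i \<in> {1..n j}}"

definition multiplicity_of :: "(nat \<Rightarrow> nat) \<Rightarrow> (nat \<Rightarrow> nat \<Rightarrow> 'a) \<Rightarrow> nat \<Rightarrow> 'a \<Rightarrow> nat" where
  "multiplicity_of n t j x = card {i\<in>{1..n j}. t j i = x}"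

end

theory Submission
  imports Defs
begin

text \<open>
  Write the sampled values as the atoms picked by a random allocation.  For fixed allocation and
  fixed \<open>u\<close>, multiplying by the density of the \<open>U\<^sub>j\<close> cancels the normalizations \<open>T\<^sub>j\<close> and tilts
  every Gamma jump into another Gamma jump.  The diffuse atoms are almost surely distinct, so the
  allocated atoms can be read off the sample, while the others stay independent of it.  Grouping
  the allocations by the set of allocated atoms produces a factor \<open>M choose K\<close>, which turns the
  law of the number of the remaining atoms into the mixture \<open>q\<^sup>*\<close>.
\<close>

section \<open>Products of measures\<close>

text \<open>The data are described given the random measures, but the allocation is determined by
  neither: it refers to the labels of the atoms, which exist only in the construction of the prior.
  It is therefore never a random variable here. The joint mass of an event about (\<theta>, U) and
  an event about \<mu> is pulled back to locations and jumps, and there the discrete sample law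
  expands into a sum over \<open>allocations\<close>.

  The second obstacle is that the answer has to be a measurable kernel in the data, although the
  number of atoms in it depends on the sample and the enumeration \<open>\<theta>s\<close> is
  arbitrary. Labelling the atoms of \<open>posterior\<close> by the distinct values themselves
  removes the enumeration. Measurability follows because finitely many patterns of ties cover the
  samples and the index set is constant on each. For this reason the laws of atomic measures carry
  an arbitrary finite index set and come with reindexing lemmas.\<close>

lemma product_sigma_finite_ext:
  assumes "\<And>i. i \<in> I \<Longrightarrow> sigma_finite_measure (M i)"
  shows "product_sigma_finite (\<lambda>i. if i \<in> I then M i else count_space {})"
  using assms by (auto simp: product_sigma_finite_def intro: sigma_finite_measure_count_space_finite)

lemma PiM_ext: "PiM I (\<lambda>i. if i \<in> I then M i else N i) = PiM I M"
  by (rule PiM_cong) auto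

text \<open>\<open>product_sigma_finite\<close> asks for sigma-finite factors at every index, while
  the factors here are controlled on \<open>I\<close> only. Padding with the null measure
  \<open>count_space {}\<close> outside \<open>I\<close> leaves \<open>PiM I M\<close> unchanged.
  The next lemmas use the same device.\<close>

lemma PiM_eqI':
  assumes "finite I" "\<And>i. i \<in> I \<Longrightarrow> sigma_finite_measure (M i)" "sets P = sets (PiM I M)"
    and "\<And>A. (\<And>i. i \<in> I \<Longrightarrow> A i \<in> sets (M i)) \<Longrightarrow>
      emeasure P (Pi\<^sub>E I A) = (\<Prod>i\<in>I. emeasure (M i) (A i))"
  shows "P = PiM I M"
proof -
  interpret product_sigma_finite "\<lambda>i. if i \<in> I then M i else count_space {}"
    by (rule product_sigma_finite_ext) (rule assms)
  have "P = PiM I (\<lambda>i. if i \<in> I then M i else count_space {})"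
    by (rule PiM_eqI) (use assms in \<open>auto simp: PiM_ext intro!: prod.cong\<close>)
  then show ?thesis by (simp add: PiM_ext)
qed

lemma emeasure_PiM':
  assumes "finite I" "\<And>i. i \<in> I \<Longrightarrow> sigma_finite_measure (M i)" "\<And>i. i \<in> I \<Longrightarrow> A i \<in> sets (M i)"
  shows "emeasure (PiM I M) (Pi\<^sub>E I A) = (\<Prod>i\<in>I. emeasure (M i) (A i))"
proof -
  interpret product_sigma_finite "\<lambda>i. if i \<in> I then M i else count_space {}"
    by (rule product_sigma_finite_ext) (rule assms)
  show ?thesis
    using emeasure_PiM[of I A] assms by (simp add: PiM_ext)
qed

lemma nn_integral_PiM_prod:
  assumes "finite I" "\<And>i. i \<in> I \<Longrightarrow> sigma_finite_measure (M i)"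
    and "\<And>i. i \<in> I \<Longrightarrow> f i \<in> borel_measurable (M i)"
  shows "(\<integral>\<^sup>+x. (\<Prod>i\<in>I. f i (x i)) \<partial>PiM I M) = (\<Prod>i\<in>I. integral\<^sup>N (M i) (f i))"
proof -
  interpret product_sigma_finite "\<lambda>i. if i \<in> I then M i else count_space {}"
    by (rule product_sigma_finite_ext) (rule assms)
  show ?thesis
    using product_nn_integral_prod[of I f] assms by (simp add: PiM_ext)
qed

lemma sigma_finite_PiM:
  assumes "finite I" "\<And>i. i \<in> I \<Longrightarrow> sigma_finite_measure (M i)"
  shows "sigma_finite_measure (PiM I M)"
proof -
  interpret product_sigma_finite "\<lambda>i. if i \<in> I then M i else count_space {}"
    by (rule product_sigma_finite_ext) (rule assms)
  show ?thesis
    using sigma_finite[of I] assms by (simp add: PiM_ext)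
qed

lemma indicator_PiE_prod:
  assumes "finite I" "x \<in> extensional I"
  shows "indicator (Pi\<^sub>E I A) x = (\<Prod>i\<in>I. indicator (A i) (x i) :: ennreal)"
proof (cases "x \<in> Pi\<^sub>E I A")
  case False
  then obtain i where "i \<in> I" "x i \<notin> A i" using assms by (auto simp: PiE_iff)
  then have "(\<Prod>i\<in>I. indicator (A i) (x i) :: ennreal) = 0"
    using assms by (intro prod_zero) (auto intro!: bexI[of _ i])
  then show ?thesis using False by simp
qed (simp add: PiE_iff)

text \<open>On a box the density and the indicator both split over the coordinates, and
  sigma-finiteness of the factors makes the masses of boxes decisive. Used for the tilted jumps and
  for the law of U.\<close>

lemma PiM_density:
  assumes I: "finite I" and M: "\<And>i. i \<in> I \<Longrightarrow> sigma_finite_measure (M i)"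
    and f[measurable]: "\<And>i. i \<in> I \<Longrightarrow> f i \<in> borel_measurable (M i)"
    and D: "\<And>i. i \<in> I \<Longrightarrow> sigma_finite_measure (density (M i) (f i))"
  shows "PiM I (\<lambda>i. density (M i) (f i)) = density (PiM I M) (\<lambda>x. \<Prod>i\<in>I. f i (x i))"
proof (rule PiM_eqI'[symmetric, OF I D])
  show "sets (density (PiM I M) (\<lambda>x. \<Prod>i\<in>I. f i (x i))) = sets (PiM I (\<lambda>i. density (M i) (f i)))"
    by (simp cong: sets_PiM_cong)
  fix A assume "\<And>i. i \<in> I \<Longrightarrow> A i \<in> sets (density (M i) (f i))"
  then have A[measurable]: "\<And>i. i \<in> I \<Longrightarrow> A i \<in> sets (M i)" by simp
  have "emeasure (density (PiM I M) (\<lambda>x. \<Prod>i\<in>I. f i (x i))) (Pi\<^sub>E I A) =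
      (\<integral>\<^sup>+x. (\<Prod>i\<in>I. f i (x i)) * indicator (Pi\<^sub>E I A) x \<partial>PiM I M)"
    using I A by (subst emeasure_density) (auto intro!: sets_PiM_I_finite)
  also have "\<dots> = (\<integral>\<^sup>+x. (\<Prod>i\<in>I. f i (x i) * indicator (A i) (x i)) \<partial>PiM I M)"
    by (rule nn_integral_cong) (simp add: prod.distrib indicator_PiE_prod[OF I] space_PiM PiE_iff)
  also have "\<dots> = (\<Prod>i\<in>I. \<integral>\<^sup>+x. f i x * indicator (A i) x \<partial>M i)"
    by (rule nn_integral_PiM_prod) (use I M in auto)
  also have "\<dots> = (\<Prod>i\<in>I. emeasure (density (M i) (f i)) (A i))"
    by (intro prod.cong refl) (simp add: emeasure_density)
  finally show "emeasure (density (PiM I M) (\<lambda>x. \<Prod>i\<in>I. f i (x i))) (Pi\<^sub>E I A) = \<dots>" .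
qed

lemma distr_PiM:
  assumes I: "finite I" and M: "\<And>i. i \<in> I \<Longrightarrow> prob_space (M i)"
    and f[measurable]: "\<And>i. i \<in> I \<Longrightarrow> f i \<in> M i \<rightarrow>\<^sub>M N i"
  shows "distr (PiM I M) (PiM I N) (\<lambda>x. \<lambda>i\<in>I. f i (x i)) = PiM I (\<lambda>i. distr (M i) (N i) (f i))"
proof (rule PiM_eqI'[OF I])
  fix i assume "i \<in> I"
  then show "sigma_finite_measure (distr (M i) (N i) (f i))"
    by (intro prob_space_imp_sigma_finite prob_space.prob_space_distr M f)
next
  show "sets (distr (PiM I M) (PiM I N) (\<lambda>x. \<lambda>i\<in>I. f i (x i))) =
      sets (PiM I (\<lambda>i. distr (M i) (N i) (f i)))"
    by (simp cong: sets_PiM_cong)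
  fix A assume "\<And>i. i \<in> I \<Longrightarrow> A i \<in> sets (distr (M i) (N i) (f i))"
  then have A[measurable]: "\<And>i. i \<in> I \<Longrightarrow> A i \<in> sets (N i)" by simp
  have "emeasure (distr (PiM I M) (PiM I N) (\<lambda>x. \<lambda>i\<in>I. f i (x i))) (Pi\<^sub>E I A) =
     emeasure (PiM I M) ((\<lambda>x. \<lambda>i\<in>I. f i (x i)) -` Pi\<^sub>E I A \<inter> space (PiM I M))"
    using A I by (subst emeasure_distr) (auto intro!: sets_PiM_I_finite)
  also have "(\<lambda>x. \<lambda>i\<in>I. f i (x i)) -` Pi\<^sub>E I A \<inter> space (PiM I M) = (\<Pi>\<^sub>E i\<in>I. f i -` A i \<inter> space (M i))"
    by (auto simp: space_PiM PiE_iff)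
  also have "emeasure (PiM I M) \<dots> = (\<Prod>i\<in>I. emeasure (distr (M i) (N i) (f i)) (A i))"
    using I M by (subst emeasure_PiM') (auto simp: emeasure_distr prob_space_imp_sigma_finite intro!: prod.cong)
  finally show "emeasure (distr (PiM I M) (PiM I N) (\<lambda>x. \<lambda>i\<in>I. f i (x i))) (Pi\<^sub>E I A) = \<dots>" .
qed

text \<open>Two independent product vectors form a product of independent pairs. Coordinatewise sums
  of independent vectors of random measures can thus be handled one coordinate at a time.\<close>

lemma distr_pair_PiM:
  assumes I: "finite I" and M: "\<And>i. i \<in> I \<Longrightarrow> prob_space (M i)" and M': "\<And>i. i \<in> I \<Longrightarrow> prob_space (M' i)"
    and f[measurable]: "\<And>i. i \<in> I \<Longrightarrow> f i \<in> M i \<Otimes>\<^sub>M M' i \<rightarrow>\<^sub>M N i"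
  shows "distr (PiM I M \<Otimes>\<^sub>M PiM I M') (PiM I N) (\<lambda>(x, y). \<lambda>i\<in>I. f i (x i, y i)) =
    PiM I (\<lambda>i. distr (M i \<Otimes>\<^sub>M M' i) (N i) (f i))"
proof (rule PiM_eqI'[OF I])
  fix i assume "i \<in> I"
  then show "sigma_finite_measure (distr (M i \<Otimes>\<^sub>M M' i) (N i) (f i))"
    by (intro prob_space_imp_sigma_finite prob_space.prob_space_distr prob_space_pair M M' f)
next
  let ?F = "\<lambda>(x, y). \<lambda>i\<in>I. f i (x i, y i)"
  show "sets (distr (PiM I M \<Otimes>\<^sub>M PiM I M') (PiM I N) ?F) =
      sets (PiM I (\<lambda>i. distr (M i \<Otimes>\<^sub>M M' i) (N i) (f i)))"
    by (simp cong: sets_PiM_cong)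
  fix A assume "\<And>i. i \<in> I \<Longrightarrow> A i \<in> sets (distr (M i \<Otimes>\<^sub>M M' i) (N i) (f i))"
  then have A[measurable]: "\<And>i. i \<in> I \<Longrightarrow> A i \<in> sets (N i)" by simp
  have PA[measurable]: "Pi\<^sub>E I A \<in> sets (PiM I N)" using I A by (auto intro!: sets_PiM_I_finite)
  have F[measurable]: "?F \<in> PiM I M \<Otimes>\<^sub>M PiM I M' \<rightarrow>\<^sub>M PiM I N" by measurable
  interpret Q: sigma_finite_measure "PiM I M'"
    using I M' by (intro sigma_finite_PiM) (auto simp: prob_space_imp_sigma_finite)
  have "emeasure (distr (PiM I M \<Otimes>\<^sub>M PiM I M') (PiM I N) ?F) (Pi\<^sub>E I A) =
      (\<integral>\<^sup>+z. indicator (Pi\<^sub>E I A) (?F z) \<partial>(PiM I M \<Otimes>\<^sub>M PiM I M'))"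
    by (subst nn_integral_indicator[symmetric], simp, subst nn_integral_distr, auto)
  also have "\<dots> = (\<integral>\<^sup>+x. \<integral>\<^sup>+y. indicator (Pi\<^sub>E I A) (?F (x, y)) \<partial>PiM I M' \<partial>PiM I M)"
    by (subst Q.nn_integral_fst[symmetric]) auto
  also have "\<dots> = (\<integral>\<^sup>+x. \<integral>\<^sup>+y. (\<Prod>i\<in>I. indicator (A i) (f i (x i, y i))) \<partial>PiM I M' \<partial>PiM I M)"
    by (intro nn_integral_cong) (simp add: indicator_PiE_prod I cong: prod.cong)
  also have "\<dots> = (\<integral>\<^sup>+x. (\<Prod>i\<in>I. \<integral>\<^sup>+y. indicator (A i) (f i (x i, y)) \<partial>M' i) \<partial>PiM I M)"
    using I M' by (intro nn_integral_cong nn_integral_PiM_prod)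
      (auto simp: prob_space_imp_sigma_finite space_PiM PiE_iff intro!: measurable_compose[OF measurable_Pair1'])
  also have "\<dots> = (\<Prod>i\<in>I. \<integral>\<^sup>+x. \<integral>\<^sup>+y. indicator (A i) (f i (x, y)) \<partial>M' i \<partial>M i)"
    using I M M' by (intro nn_integral_PiM_prod sigma_finite_measure.borel_measurable_nn_integral_fst
      prob_space_imp_sigma_finite) auto
  also have "\<dots> = (\<Prod>i\<in>I. emeasure (distr (M i \<Otimes>\<^sub>M M' i) (N i) (f i)) (A i))"
  proof (intro prod.cong refl)
    fix i assume i: "i \<in> I"
    note f[OF i, measurable] A[OF i, measurable]
    interpret Q: sigma_finite_measure "M' i" using M'[OF i] by (rule prob_space_imp_sigma_finite)
    show "(\<integral>\<^sup>+x. \<integral>\<^sup>+y. indicator (A i) (f i (x, y)) \<partial>M' i \<partial>M i) = emeasure (distr (M i \<Otimes>\<^sub>M M' i) (N i) (f i)) (A i)"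
      by (subst nn_integral_indicator[symmetric], simp, subst nn_integral_distr, simp, simp,
          subst Q.nn_integral_fst[symmetric], auto)
  qed
  finally show "emeasure (distr (PiM I M \<Otimes>\<^sub>M PiM I M') (PiM I N) ?F) (Pi\<^sub>E I A) = \<dots>" .
qed

text \<open>Boxes form an intersection-stable generator, and the mass of a box is a finite product
  of the measurable masses of its sides.\<close>

lemma measurable_PiM_kernel:
  assumes I: "finite I" and K: "\<And>i. i \<in> I \<Longrightarrow> K i \<in> L \<rightarrow>\<^sub>M prob_algebra (N i)"
  shows "(\<lambda>x. PiM I (\<lambda>i. K i x)) \<in> L \<rightarrow>\<^sub>M prob_algebra (PiM I N)"
proof (rule measurable_prob_algebra_generated[OF sets_PiM Int_stable_prod_algebra prod_algebra_sets_into_space])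
  have *: "prob_space (K i a)" "sets (K i a) = sets (N i)" if "i \<in> I" "a \<in> space L" for i a
    using measurable_space[OF K[OF that(1)] that(2)] by (auto simp: space_prob_algebra)
  fix a assume "a \<in> space L"
  then show "prob_space (PiM I (\<lambda>i. K i a))" "sets (PiM I (\<lambda>i. K i a)) = sets (PiM I N)"
    using * by (auto intro!: prob_space_PiM sets_PiM_cong)
next
  have *: "prob_space (K i a)" "sets (K i a) = sets (N i)" if "i \<in> I" "a \<in> space L" for i a
    using measurable_space[OF K[OF that(1)] that(2)] by (auto simp: space_prob_algebra)
  fix A assume "A \<in> prod_algebra I N"
  then obtain X where A: "A = Pi\<^sub>E I X" and X: "\<And>i. i \<in> I \<Longrightarrow> X i \<in> sets (N i)"
    unfolding prod_algebra_eq_finite[OF I] by auto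
  have "(\<lambda>a. \<Prod>i\<in>I. emeasure (K i a) (X i)) \<in> borel_measurable L"
    using X by (intro borel_measurable_prod_ennreal measurable_compose[OF measurable_prob_algebraD[OF K]
        measurable_emeasure_subprob_algebra])
  also have "?this \<longleftrightarrow> (\<lambda>a. emeasure (PiM I (\<lambda>i. K i a)) A) \<in> borel_measurable L"
    using * X I unfolding A
    by (intro measurable_cong emeasure_PiM'[symmetric]) (auto simp: prob_space_imp_sigma_finite)
  finally show "(\<lambda>a. emeasure (PiM I (\<lambda>i. K i a)) A) \<in> borel_measurable L" .
qed

text \<open>The law of the data will be known only set by set, as a finite sum of measures;
  induction on the integrand passes this to integrals.\<close>

lemma nn_integral_sum_measures:
  assumes Z: "finite Z" and s: "\<And>z. z \<in> Z \<Longrightarrow> sets (N z) = sets M"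
    and M: "\<And>A. A \<in> sets M \<Longrightarrow> emeasure M A = (\<Sum>z\<in>Z. emeasure (N z) A)"
    and f: "f \<in> borel_measurable M"
  shows "(\<integral>\<^sup>+x. f x \<partial>M) = (\<Sum>z\<in>Z. \<integral>\<^sup>+x. f x \<partial>N z)"
proof -
  have B: "borel_measurable (N z) = borel_measurable M" if "z \<in> Z" for z
    using s[OF that] by (intro measurable_cong_sets) auto
  show ?thesis
    using f
  proof (induction rule: borel_measurable_induct)
    case (cong f g)
    moreover have "(\<integral>\<^sup>+x. f x \<partial>N z) = (\<integral>\<^sup>+x. g x \<partial>N z)" if "z \<in> Z" for z
      using cong(3) sets_eq_imp_space_eq[OF s[OF that]] by (intro nn_integral_cong) auto
    moreover have "(\<integral>\<^sup>+x. f x \<partial>M) = (\<integral>\<^sup>+x. g x \<partial>M)"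
      using cong(3) by (intro nn_integral_cong) auto
    ultimately show ?case by simp
  next
    case (set A)
    then show ?case using s by (simp add: M)
  next
    case (mult u c)
    then show ?case
      by (simp add: nn_integral_cmult sum_distrib_left B)
  next
    case (add u v)
    then show ?case
      by (simp add: nn_integral_add sum.distrib B)
  next
    case (seq U)
    have "(\<integral>\<^sup>+x. (SUP i. U i) x \<partial>N z) = (SUP i. \<integral>\<^sup>+x. U i x \<partial>N z)" if "z \<in> Z" for z
      using seq unfolding SUP_apply
      by (intro nn_integral_monotone_convergence_SUP) (auto simp: B that)
    moreover have "(\<integral>\<^sup>+x. (SUP i. U i) x \<partial>M) = (SUP i. \<integral>\<^sup>+x. U i x \<partial>M)"
      using seq unfolding SUP_apply by (intro nn_integral_monotone_convergence_SUP) auto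
    moreover have "(SUP i. \<Sum>z\<in>Z. \<integral>\<^sup>+x. U i x \<partial>N z) = (\<Sum>z\<in>Z. SUP i. \<integral>\<^sup>+x. U i x \<partial>N z)"
      using seq(3) by (intro ennreal_SUP_sum) (auto simp: incseq_def le_fun_def intro!: nn_integral_mono)
    ultimately show ?case using seq by simp
  qed
qed

section \<open>Finite measures\<close>

lemma space_finite_measure_algebra:
  "space (finite_measure_algebra B) = {M. finite_measure M \<and> sets M = sets B}"
  by (auto simp: finite_measure_algebra_def space_Sup_eq_UN)

lemma measurable_finite_measure_algebra:
  assumes "\<And>w. w \<in> space L \<Longrightarrow> finite_measure (K w)" "\<And>w. w \<in> space L \<Longrightarrow> sets (K w) = sets B"
    and "\<And>A. A \<in> sets B \<Longrightarrow> (\<lambda>w. emeasure (K w) A) \<in> borel_measurable L"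
  shows "K \<in> L \<rightarrow>\<^sub>M finite_measure_algebra B"
  unfolding finite_measure_algebra_def using assms
  by (intro measurable_SUP2 measurable_vimage_algebra2) auto

lemma measurable_emeasure_finite_measure_algebra:
  assumes "A \<in> sets B"
  shows "(\<lambda>M. emeasure M A) \<in> borel_measurable (finite_measure_algebra B)"
  unfolding finite_measure_algebra_def
  by (rule measurable_Sup1[OF imageI[OF assms]]) (auto intro!: measurable_vimage_algebra1)

lemma finite_measure_algebra_cong:
  "sets M = sets N \<Longrightarrow> finite_measure_algebra M = finite_measure_algebra N"
  by (simp add: finite_measure_algebra_def)

text \<open>\<open>weighted_diracs\<close> with the labels \<open>{1..m}\<close> replaced by any
  index set: a subset of the labels, or the set of atoms itself with \<open>x\<close> the
  identity.\<close>

definition atomic_measure :: "'a measure \<Rightarrow> 'k set \<Rightarrow> ('k \<Rightarrow> real) \<Rightarrow> ('k \<Rightarrow> 'a) \<Rightarrow> 'a measure" where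
  "atomic_measure B R s x =
     measure_of (space B) (sets B) (\<lambda>A. \<Sum>k\<in>R. ennreal (s k) * indicator A (x k))"

lemma weighted_diracs_eq: "weighted_diracs B m s x = atomic_measure B {1..m} s x"
  by (simp add: weighted_diracs_def atomic_measure_def)

lemma sets_atomic_measure[simp]: "sets (atomic_measure B R s x) = sets B"
  and space_atomic_measure[simp]: "space (atomic_measure B R s x) = space B"
  by (simp_all add: atomic_measure_def sets.sigma_sets_eq space_measure_of_conv)

lemma emeasure_atomic_measure:
  assumes "A \<in> sets B"
  shows "emeasure (atomic_measure B R s x) A = (\<Sum>k\<in>R. ennreal (s k) * indicator A (x k))"
proof (rule emeasure_measure_of[OF atomic_measure_def])
  show "positive (sets (atomic_measure B R s x)) (\<lambda>A. \<Sum>k\<in>R. ennreal (s k) * indicator A (x k))"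
    by (auto simp: positive_def)
  show "countably_additive (sets (atomic_measure B R s x)) (\<lambda>A. \<Sum>k\<in>R. ennreal (s k) * indicator A (x k))"
  proof (rule countably_additiveI)
    fix F :: "nat \<Rightarrow> 'a set" assume "disjoint_family F"
    then show "(\<Sum>i. \<Sum>k\<in>R. ennreal (s k) * indicator (F i) (x k)) =
        (\<Sum>k\<in>R. ennreal (s k) * indicator (\<Union>i. F i) (x k))"
      by (subst suminf_sum) (auto simp: suminf_indicator)
  qed
qed (use assms sets.sets_into_space in auto)

lemma measurable_atomic_measure:
  assumes R: "finite R" and s: "\<And>k. k \<in> R \<Longrightarrow> (\<lambda>w. s w k) \<in> borel_measurable L"
    and x: "\<And>k. k \<in> R \<Longrightarrow> (\<lambda>w. x w k) \<in> L \<rightarrow>\<^sub>M B"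
  shows "(\<lambda>w. atomic_measure B R (s w) (x w)) \<in> L \<rightarrow>\<^sub>M finite_measure_algebra B"
proof (rule measurable_finite_measure_algebra)
  fix w
  have "emeasure (atomic_measure B R (s w) (x w)) (space B) < top"
    by (simp add: emeasure_atomic_measure ennreal_mult_less_top indicator_def R)
  then show "finite_measure (atomic_measure B R (s w) (x w))"
    by (intro finite_measureI) simp
next
  fix A assume [measurable]: "A \<in> sets B"
  note s[measurable] x[measurable]
  show "(\<lambda>w. emeasure (atomic_measure B R (s w) (x w)) A) \<in> borel_measurable L"
    by (subst emeasure_atomic_measure) simp_all
qed simp

lemma atomic_measure_reindex:
  assumes "bij_betw \<sigma> R R'"
  shows "atomic_measure B R (\<lambda>k. s (\<sigma> k)) (\<lambda>k. x (\<sigma> k)) = atomic_measure B R' s x"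
  using sum.reindex_bij_betw[OF assms, of "\<lambda>k. ennreal (s k) * indicator A (x k)" for A]
  by (simp add: atomic_measure_def)

lemma atomic_measure_cong:
  assumes "\<And>k. k \<in> R \<Longrightarrow> s k = s' k" "\<And>k. k \<in> R \<Longrightarrow> x k = x' k"
  shows "atomic_measure B R s x = atomic_measure B R s' x'"
proof -
  have "(\<lambda>A. \<Sum>k\<in>R. ennreal (s k) * indicator A (x k)) = (\<lambda>A. \<Sum>k\<in>R. ennreal (s' k) * indicator A (x' k))"
    using assms by (auto intro!: sum.cong)
  then show ?thesis by (simp add: atomic_measure_def)
qed

lemma sets_add_measure[simp]: "sets (add_measure M N) = sets M"
  and space_add_measure[simp]: "space (add_measure M N) = space M"
  by (simp_all add: add_measure_def sets.sigma_sets_eq space_measure_of_conv)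

lemma emeasure_add_measure:
  assumes "sets N = sets M" "A \<in> sets M"
  shows "emeasure (add_measure M N) A = emeasure M A + emeasure N A"
proof (rule emeasure_measure_of[OF add_measure_def])
  show "positive (sets (add_measure M N)) (\<lambda>A. emeasure M A + emeasure N A)"
    by (auto simp: positive_def)
  show "countably_additive (sets (add_measure M N)) (\<lambda>A. emeasure M A + emeasure N A)"
  proof (rule countably_additiveI)
    fix F :: "nat \<Rightarrow> 'a set"
    assume "range F \<subseteq> sets (add_measure M N)" "disjoint_family F"
    then show "(\<Sum>i. emeasure M (F i) + emeasure N (F i)) = emeasure M (\<Union>i. F i) + emeasure N (\<Union>i. F i)"
      using assms by (subst suminf_add[symmetric]) (auto simp: suminf_emeasure)
  qed
qed (use assms sets.sets_into_space in auto)

lemma measurable_add_measure: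
  assumes f: "f \<in> L \<rightarrow>\<^sub>M finite_measure_algebra B" and g: "g \<in> L \<rightarrow>\<^sub>M finite_measure_algebra B"
  shows "(\<lambda>w. add_measure (f w) (g w)) \<in> L \<rightarrow>\<^sub>M finite_measure_algebra B"
proof -
  have fg: "finite_measure (f w)" "sets (f w) = sets B" "finite_measure (g w)" "sets (g w) = sets B"
    if "w \<in> space L" for w
    using measurable_space[OF f that] measurable_space[OF g that] by (auto simp: space_finite_measure_algebra)
  show ?thesis
  proof (rule measurable_finite_measure_algebra)
    fix w assume w: "w \<in> space L"
    then interpret f: finite_measure "f w" using fg by blast
    interpret g: finite_measure "g w" using fg w by blast
    show "finite_measure (add_measure (f w) (g w))"
      using fg[OF w] sets.top[of "f w"] by (intro finite_measureI) (simp add: emeasure_add_measure)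
  next
    fix A assume A: "A \<in> sets B"
    have "(\<lambda>w. emeasure (f w) A + emeasure (g w) A) \<in> borel_measurable L"
      by (intro borel_measurable_add measurable_compose[OF f measurable_emeasure_finite_measure_algebra]
          measurable_compose[OF g measurable_emeasure_finite_measure_algebra] A)
    also have "?this \<longleftrightarrow> (\<lambda>w. emeasure (add_measure (f w) (g w)) A) \<in> borel_measurable L"
      using fg A by (intro measurable_cong emeasure_add_measure[symmetric]) auto
    finally show "(\<lambda>w. emeasure (add_measure (f w) (g w)) A) \<in> borel_measurable L" .
  qed (use fg in auto)
qed

lemma atomic_measure_Un:
  assumes "finite R" "finite R'" "R \<inter> R' = {}"
  shows "atomic_measure B (R \<union> R') s x = add_measure (atomic_measure B R s x) (atomic_measure B R' s x)"
proof (rule measure_eqI)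
  fix A assume "A \<in> sets (atomic_measure B (R \<union> R') s x)"
  then have "A \<in> sets B" by simp
  then show "emeasure (atomic_measure B (R \<union> R') s x) A =
      emeasure (add_measure (atomic_measure B R s x) (atomic_measure B R' s x)) A"
    by (subst emeasure_add_measure, simp, simp)
       (simp only: emeasure_atomic_measure sum.union_disjoint[OF assms])
qed simp

section \<open>Gamma laws\<close>

lemma measurable_gamma_density[measurable]:
  assumes [measurable]: "f \<in> borel_measurable L" "g \<in> borel_measurable L"
  shows "(\<lambda>w. gamma_density a (f w) (g w)) \<in> borel_measurable L"
  unfolding gamma_density_def by measurable

lemma gamma_density_nonneg: "a > 0 \<Longrightarrow> 0 \<le> gamma_density a b x"
  by (auto simp: gamma_density_def intro!: mult_nonneg_nonneg divide_nonneg_nonneg Gamma_real_nonneg)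

lemma nn_integral_gamma_density:
  assumes a: "a > 0" and b: "b > 0"
  shows "(\<integral>\<^sup>+x. ennreal (gamma_density a b x) \<partial>lborel) = 1"
proof -
  have "((\<lambda>t. t powr (a - 1) / exp t / Gamma a) has_integral Gamma a / Gamma a) {0..}"
    by (intro has_integral_divide Gamma_integral_real a)
  also have "Gamma a / Gamma a = 1" using Gamma_real_pos[OF a] by simp
  finally have "(gamma_density a 1 has_integral 1) {0..}"
    by (rule has_integral_spike[where S = "{0}", rotated 2])
       (auto simp: gamma_density_def exp_minus field_simps)
  then have I: "(gamma_density a 1 has_integral 1) UNIV"
    by (rule has_integral_on_superset) (auto simp: gamma_density_def)
  \<comment> \<open>Rate \<open>b\<close> is reduced to rate 1 by the substitution from
    \<open>x\<close> to \<open>b * x\<close>, whose Jacobian is \<open>b\<close>.\<close>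
  have scale: "b * gamma_density a 1 (b * x) = gamma_density a b x" for x
  proof (cases "x > 0")
    case True
    have "b * b powr (a - 1) = b powr a" using b by (simp add: powr_diff)
    moreover have "b * (b * x) powr (a - 1) = (b * b powr (a - 1)) * x powr (a - 1)"
      using b True by (simp add: powr_mult)
    ultimately show ?thesis using b True
      by (simp add: gamma_density_def mult_pos_pos) 
  qed (use b in \<open>auto simp: gamma_density_def zero_less_mult_iff\<close>)
  have "1 = (\<integral>\<^sup>+x. ennreal (gamma_density a 1 x) \<partial>lborel)"
    using gamma_density_nonneg[OF a] I
    by (subst nn_integral_has_integral_lborel) auto
  also have "\<dots> = ennreal \<bar>b\<bar> * (\<integral>\<^sup>+x. ennreal (gamma_density a 1 (0 + b * x)) \<partial>lborel)"
    using b by (intro nn_integral_real_affine) auto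
  also have "\<dots> = (\<integral>\<^sup>+x. ennreal (b * gamma_density a 1 (b * x)) \<partial>lborel)"
    using b by (subst nn_integral_cmult[symmetric]) (auto simp: ennreal_mult')
  also have "\<dots> = (\<integral>\<^sup>+x. ennreal (gamma_density a b x) \<partial>lborel)"
    by (simp only: scale)
  finally show ?thesis by simp
qed

lemma sets_gamma_law[simp, measurable_cong]: "sets (gamma_law a b) = sets borel"
  by (simp add: gamma_law_def)

lemma prob_space_gamma_law: "prob_space (gamma_law a b)"
  by (cases "a > 0 \<and> b > 0")
     (auto simp: gamma_law_def emeasure_density nn_integral_gamma_density prob_space_return intro!: prob_spaceI)

lemma AE_gamma_law_pos:
  assumes "a > 0" "b > 0"
  shows "AE x in gamma_law a b. x > 0"
proof -
  have "AE x in density lborel (\<lambda>x. ennreal (gamma_density a b x)). x > 0"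
    by (subst AE_density) (auto simp: gamma_density_def)
  also have "density lborel (\<lambda>x. ennreal (gamma_density a b x)) = gamma_law a b"
    using assms by (simp add: gamma_law_def)
  finally show ?thesis .
qed

lemma measurable_gamma_law:
  assumes f[measurable]: "f \<in> borel_measurable L"
  shows "(\<lambda>w. gamma_law a (f w)) \<in> L \<rightarrow>\<^sub>M prob_algebra borel"
proof (rule measurable_prob_algebraI[OF prob_space_gamma_law], rule measurable_subprob_algebra)
  fix A :: "real set" assume [measurable]: "A \<in> sets borel"
  have "(\<lambda>w. if a > 0 \<and> f w > 0 then \<integral>\<^sup>+x. ennreal (gamma_density a (f w) x) * indicator A x \<partial>lborel
      else indicator A 0) \<in> borel_measurable L"
    by measurable
  also have "(\<lambda>w. if a > 0 \<and> f w > 0 then \<integral>\<^sup>+x. ennreal (gamma_density a (f w) x) * indicator A x \<partial>lborel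
      else indicator A 0) = (\<lambda>w. emeasure (gamma_law a (f w)) A)"
    by (auto simp: gamma_law_def emeasure_density)
  finally show "(\<lambda>w. emeasure (gamma_law a (f w)) A) \<in> borel_measurable L" .
qed (auto intro: prob_space_imp_subprob_space prob_space_gamma_law)

text \<open>Gamma conjugacy: the power raises the shape, the exponential raises the rate, and the
  constant is the quotient of the two normalizations. Keeping it as a constant density leaves a
  probability law underneath, so that products over many jumps can be formed.\<close>

lemma density_gamma_law_tilt:
  assumes a: "a > 0" and b: "b > 0" "b + u > 0"
  shows "density (gamma_law a b) (\<lambda>x. ennreal (x ^ n * exp (- (u * x)))) =
    density (gamma_law (a + real n) (b + u))
      (\<lambda>_. ennreal (b powr a / Gamma a * (Gamma (a + real n) / (b + u) powr (a + real n))))"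
proof -
  have "a + real n > 0" using a by simp
  note G = Gamma_real_pos[OF a] Gamma_real_pos[OF this]
  have eq: "gamma_density a b x * (x ^ n * exp (- (u * x))) =
    gamma_density (a + real n) (b + u) x * (b powr a / Gamma a * (Gamma (a + real n) / (b + u) powr (a + real n)))" for x
  proof (cases "x > 0")
    case True
    have "x powr (a + real n - 1) = x powr (a - 1) * x ^ n"
      using True by (simp add: powr_realpow[symmetric] powr_add[symmetric] algebra_simps)
    moreover have "exp (- ((b + u) * x)) = exp (- (b * x)) * exp (- (u * x))"
      by (simp add: exp_add[symmetric] algebra_simps)
    ultimately show ?thesis using True G b by (simp add: gamma_density_def field_simps)
  qed (auto simp: gamma_density_def)
  have "ennreal (gamma_density a b x) * ennreal (x ^ n * exp (- (u * x))) = 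
    ennreal (gamma_density (a + real n) (b + u) x) * ennreal (b powr a / Gamma a * (Gamma (a + real n) / (b + u) powr (a + real n)))" for x
  proof (cases "x > 0")
    case True
    with a G show ?thesis by (subst (1 2) ennreal_mult[symmetric]) (auto simp: eq gamma_density_nonneg)
  qed (auto simp: gamma_density_def)
  then show ?thesis
    using a b by (simp add: gamma_law_def density_density_eq)
qed

declare One_nat_def [simp del]

section \<open>Laws of random atomic measures\<close>

definition gamma_atoms_law ::
  "'a measure \<Rightarrow> nat \<Rightarrow> 'k set \<Rightarrow> ('k \<Rightarrow> 'a) \<Rightarrow> (nat \<Rightarrow> 'k \<Rightarrow> real) \<Rightarrow> (nat \<Rightarrow> real) \<Rightarrow>
   (nat \<Rightarrow> 'a measure) measure" where
  "gamma_atoms_law B d R x a b =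
     distr (PiM {1..d} (\<lambda>j. PiM R (\<lambda>k. gamma_law (a j k) (b j)))) (measure_vectors d B)
       (\<lambda>S. \<lambda>j\<in>{1..d}. atomic_measure B R (S j) x)"

definition iid_atoms_law ::
  "'a measure \<Rightarrow> nat \<Rightarrow> 'k set \<Rightarrow> (nat \<Rightarrow> real) \<Rightarrow> (nat \<Rightarrow> real) \<Rightarrow> (nat \<Rightarrow> 'a measure) measure" where
  "iid_atoms_law P0 d R a b =
     distr (PiM R (\<lambda>_. P0) \<Otimes>\<^sub>M PiM {1..d} (\<lambda>j. PiM R (\<lambda>k. gamma_law (a j) (b j)))) (measure_vectors d P0)
       (\<lambda>(\<tau>, S). \<lambda>j\<in>{1..d}. atomic_measure P0 R (S j) \<tau>)"

definition add_law ::
  "'a measure \<Rightarrow> nat \<Rightarrow> (nat \<Rightarrow> 'a measure) measure \<Rightarrow> (nat \<Rightarrow> 'a measure) measure \<Rightarrow>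
   (nat \<Rightarrow> 'a measure) measure" where
  "add_law B d X Y =
     distr (X \<Otimes>\<^sub>M Y) (measure_vectors d B) (\<lambda>(a, na). \<lambda>j\<in>{1..d}. add_measure (a j) (na j))"

lemma fixed_atoms_law_eq: "fixed_atoms_law B d m x a b = gamma_atoms_law B d {1..m} x a b"
  by (simp add: fixed_atoms_law_def gamma_atoms_law_def indep_gammas_def weighted_diracs_eq)

lemma random_atoms_law_eq:
  "random_atoms_law q d P0 a b = measure_pmf q \<bind> (\<lambda>m. iid_atoms_law P0 d {1..m} a b)"
  by (simp add: random_atoms_law_def iid_atoms_law_def indep_gammas_def weighted_diracs_eq)

lemma gamma_atoms_law_cong_sets:
  assumes "sets B = sets B'"
  shows "gamma_atoms_law B = gamma_atoms_law B'"
  using finite_measure_algebra_cong[OF assms] sets_eq_imp_space_eq[OF assms] assms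
  by (intro ext) (simp add: gamma_atoms_law_def atomic_measure_def)

lemma gamma_atoms_law_cong:
  assumes "\<And>k. k \<in> R \<Longrightarrow> x k = x' k" "\<And>j k. j \<in> {1..d} \<Longrightarrow> k \<in> R \<Longrightarrow> a j k = a' j k"
  shows "gamma_atoms_law B d R x a b = gamma_atoms_law B d R x' a' b"
proof -
  have "(\<lambda>S. \<lambda>j\<in>{1..d}. atomic_measure B R (S j) x) = (\<lambda>S. \<lambda>j\<in>{1..d}. atomic_measure B R (S j) x')"
    using assms by (intro ext restrict_ext atomic_measure_cong) auto
  moreover have "PiM {1..d} (\<lambda>j. PiM R (\<lambda>k. gamma_law (a j k) (b j))) =
      PiM {1..d} (\<lambda>j. PiM R (\<lambda>k. gamma_law (a' j k) (b j)))"
    using assms by (intro PiM_cong) auto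
  ultimately show ?thesis by (simp add: gamma_atoms_law_def)
qed

lemma sets_gamma_atoms_law[simp, measurable_cong]:
  "sets (gamma_atoms_law B d R x a b) = sets (measure_vectors d B)"
  by (simp add: gamma_atoms_law_def)

lemma sets_iid_atoms_law[simp, measurable_cong]:
  "sets (iid_atoms_law B d R a b) = sets (measure_vectors d B)"
  by (simp add: iid_atoms_law_def)

lemma prob_space_gamma_PiM: "prob_space (PiM R (\<lambda>k. gamma_law (a k) b))"
  by (intro prob_space_PiM prob_space_gamma_law)

lemma measurable_gamma_PiM:
  fixes d :: nat
  assumes "finite R" "\<And>j. j \<in> {1..d} \<Longrightarrow> (\<lambda>w. b w j) \<in> borel_measurable L"
  shows "(\<lambda>w. PiM {1..d} (\<lambda>j. PiM R (\<lambda>k. gamma_law (a j k) (b w j)))) \<in>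
    L \<rightarrow>\<^sub>M prob_algebra (PiM {1..d} (\<lambda>j. PiM R (\<lambda>k. borel)))"
  using assms by (intro measurable_PiM_kernel measurable_gamma_law) auto

lemma measurable_atomic_vectors:
  assumes "finite R" "\<And>k. k \<in> R \<Longrightarrow> (\<lambda>w. x w k) \<in> L \<rightarrow>\<^sub>M B"
    and [measurable]: "S \<in> L \<rightarrow>\<^sub>M PiM {1..d} (\<lambda>j. PiM R (\<lambda>k. borel))"
  shows "(\<lambda>w. \<lambda>j\<in>{1..d}. atomic_measure B R (S w j) (x w)) \<in> L \<rightarrow>\<^sub>M measure_vectors d B"
  using assms(1,2) by (intro measurable_restrict measurable_atomic_measure) measurable

lemma measurable_gamma_atoms_law:
  assumes R: "finite R" and x: "\<And>k. k \<in> R \<Longrightarrow> (\<lambda>w. x w k) \<in> L \<rightarrow>\<^sub>M B"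
    and b: "\<And>j. j \<in> {1..d} \<Longrightarrow> (\<lambda>w. b w j) \<in> borel_measurable L"
  shows "(\<lambda>w. gamma_atoms_law B d R (x w) a (b w)) \<in> L \<rightarrow>\<^sub>M prob_algebra (measure_vectors d B)"
  unfolding gamma_atoms_law_def
proof (rule measurable_distr_prob_space2[OF measurable_gamma_PiM[OF R b]])
  note x[measurable]
  show "(\<lambda>(w, S). \<lambda>j\<in>{1..d}. atomic_measure B R (S j) (x w)) \<in>
      L \<Otimes>\<^sub>M PiM {1..d} (\<lambda>j. PiM R (\<lambda>k. borel)) \<rightarrow>\<^sub>M measure_vectors d B"
    unfolding split_beta' by (rule measurable_atomic_vectors[OF R]) measurable
qed

lemma prob_space_gamma_atoms_law:
  assumes "finite R" "\<And>k. k \<in> R \<Longrightarrow> x k \<in> space B"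
  shows "prob_space (gamma_atoms_law B d R x a b)"
  using measurable_space[OF measurable_gamma_atoms_law[of R "\<lambda>_. x" "count_space UNIV" B d "\<lambda>_. b" a], of undefined] assms
  by (simp add: space_prob_algebra)

lemma measurable_iid_atoms_law:
  assumes R: "finite R" and P0: "prob_space P0"
    and b: "\<And>j. j \<in> {1..d} \<Longrightarrow> (\<lambda>w. b w j) \<in> borel_measurable L"
  shows "(\<lambda>w. iid_atoms_law P0 d R a (b w)) \<in> L \<rightarrow>\<^sub>M prob_algebra (measure_vectors d P0)"
  unfolding iid_atoms_law_def
proof (rule measurable_distr_prob_space2)
  have [measurable]: "(\<lambda>w. PiM R (\<lambda>_. P0)) \<in> L \<rightarrow>\<^sub>M prob_algebra (PiM R (\<lambda>_. P0))"
    using P0 by (intro measurable_const) (auto simp: space_prob_algebra intro!: prob_space_PiM)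
  note measurable_gamma_PiM[OF R b, measurable]
  show "(\<lambda>w. PiM R (\<lambda>_. P0) \<Otimes>\<^sub>M PiM {1..d} (\<lambda>j. PiM R (\<lambda>k. gamma_law (a j) (b w j)))) \<in>
      L \<rightarrow>\<^sub>M prob_algebra (PiM R (\<lambda>_. P0) \<Otimes>\<^sub>M PiM {1..d} (\<lambda>j. PiM R (\<lambda>k. borel)))"
    by measurable
  show "(\<lambda>(w, \<tau>, S). \<lambda>j\<in>{1..d}. atomic_measure P0 R (S j) \<tau>) \<in>
      L \<Otimes>\<^sub>M (PiM R (\<lambda>_. P0) \<Otimes>\<^sub>M PiM {1..d} (\<lambda>j. PiM R (\<lambda>k. borel))) \<rightarrow>\<^sub>M measure_vectors d P0"
    unfolding split_beta' by (rule measurable_atomic_vectors[OF R]) measurable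
qed

lemma prob_space_iid_atoms_law:
  assumes "finite R" "prob_space P0"
  shows "prob_space (iid_atoms_law P0 d R a b)"
  using measurable_space[OF measurable_iid_atoms_law[of R P0 d "\<lambda>_. b" "count_space UNIV" a], of undefined] assms
  by (simp add: space_prob_algebra)

text \<open>Given the locations, the components are independent over \<open>j\<close>; the
  reindexing and splitting lemmas below can then argue for a single \<open>j\<close>.\<close>

lemma gamma_atoms_law_eq_PiM:
  assumes "finite R" "\<And>k. k \<in> R \<Longrightarrow> x k \<in> space B"
  shows "gamma_atoms_law B d R x a b =
    PiM {1..d} (\<lambda>j. distr (PiM R (\<lambda>k. gamma_law (a j k) (b j))) (finite_measure_algebra B)
      (\<lambda>s. atomic_measure B R s x))"
  unfolding gamma_atoms_law_def using assms
  by (intro distr_PiM prob_space_gamma_PiM measurable_atomic_measure) auto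

text \<open>Independent jumps may be renamed along a bijection that carries shapes and locations
  with it. Through this lemma the posterior does not depend on how the distinct values are
  enumerated.\<close>

lemma gamma_atoms_law_reindex:
  assumes R: "finite R'" "bij_betw \<sigma> R R'" and x: "\<And>k. k \<in> R' \<Longrightarrow> x k \<in> space B"
  shows "gamma_atoms_law B d R (\<lambda>k. x (\<sigma> k)) (\<lambda>j k. a j (\<sigma> k)) b = gamma_atoms_law B d R' x a b"
proof -
  have R': "finite R" using R bij_betw_finite by blast
  have \<sigma>: "\<sigma> k \<in> R'" if "k \<in> R" for k using R that by (auto simp: bij_betw_def)
  have "distr (PiM R (\<lambda>k. gamma_law (a j (\<sigma> k)) (b j))) (finite_measure_algebra B) (\<lambda>s. atomic_measure B R s (\<lambda>k. x (\<sigma> k))) =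
    distr (PiM R' (\<lambda>k. gamma_law (a j k) (b j))) (finite_measure_algebra B) (\<lambda>s. atomic_measure B R' s x)" for j
  proof -
    have "PiM R (\<lambda>k. gamma_law (a j (\<sigma> k)) (b j)) =
        distr (PiM R' (\<lambda>k. gamma_law (a j k) (b j))) (PiM R (\<lambda>k. gamma_law (a j (\<sigma> k)) (b j))) (\<lambda>w. \<lambda>n\<in>R. w (\<sigma> n))"
      using R \<sigma> by (intro distr_PiM_reindex[symmetric] prob_space_gamma_law) (auto simp: bij_betw_def)
    then have "distr (PiM R (\<lambda>k. gamma_law (a j (\<sigma> k)) (b j))) (finite_measure_algebra B) (\<lambda>s. atomic_measure B R s (\<lambda>k. x (\<sigma> k))) =
        distr (distr (PiM R' (\<lambda>k. gamma_law (a j k) (b j))) (PiM R (\<lambda>k. gamma_law (a j (\<sigma> k)) (b j))) (\<lambda>w. \<lambda>n\<in>R. w (\<sigma> n)))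
          (finite_measure_algebra B) (\<lambda>s. atomic_measure B R s (\<lambda>k. x (\<sigma> k)))"
      by simp
    also have "\<dots> = distr (PiM R' (\<lambda>k. gamma_law (a j k) (b j))) (finite_measure_algebra B)
        ((\<lambda>s. atomic_measure B R s (\<lambda>k. x (\<sigma> k))) \<circ> (\<lambda>w. \<lambda>n\<in>R. w (\<sigma> n)))"
      using R' \<sigma> x by (intro distr_distr measurable_atomic_measure measurable_restrict measurable_const) auto
    also have "(\<lambda>s. atomic_measure B R s (\<lambda>k. x (\<sigma> k))) \<circ> (\<lambda>w. \<lambda>n\<in>R. w (\<sigma> n)) = (\<lambda>s. atomic_measure B R' s x)"
      unfolding atomic_measure_reindex[OF R(2), symmetric] comp_def
      by (intro ext atomic_measure_cong) auto
    finally show ?thesis .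
  qed
  with R R' \<sigma> x show ?thesis by (simp add: gamma_atoms_law_eq_PiM)
qed

lemma measurable_add_vectors[measurable]:
  "(\<lambda>(a, na). \<lambda>j\<in>{1..d}. add_measure (a j) (na j)) \<in> measure_vectors d B \<Otimes>\<^sub>M measure_vectors d B \<rightarrow>\<^sub>M measure_vectors d B"
  unfolding split_beta' by (intro measurable_restrict measurable_add_measure) measurable

lemma measurable_add_law:
  assumes [measurable]: "X \<in> L \<rightarrow>\<^sub>M prob_algebra (measure_vectors d B)" "Y \<in> L \<rightarrow>\<^sub>M prob_algebra (measure_vectors d B)"
  shows "(\<lambda>w. add_law B d (X w) (Y w)) \<in> L \<rightarrow>\<^sub>M prob_algebra (measure_vectors d B)"
  unfolding add_law_def by measurable

text \<open>Jumps over disjoint label sets are independent, and \<open>merge\<close> glues the two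
  families. Disjointness concerns labels: locations may still coincide.\<close>

lemma gamma_atoms_law_Un:
  assumes fin: "finite R" "finite R'" and disj: "R \<inter> R' = {}" and x: "\<And>k. k \<in> R \<union> R' \<Longrightarrow> x k \<in> space B"
  shows "gamma_atoms_law B d (R \<union> R') x a b =
    add_law B d (gamma_atoms_law B d R x a b) (gamma_atoms_law B d R' x a b)"
proof -
  let ?g = "\<lambda>j k. gamma_law (a j k) (b j)" and ?F = "finite_measure_algebra B"
  let ?am = "\<lambda>R s. atomic_measure B R s x"
  have am[measurable]: "?am Q \<in> PiM Q (?g j) \<rightarrow>\<^sub>M ?F" if "Q \<in> {R, R', R \<union> R'}" for Q j
    using that fin x by (intro measurable_atomic_measure) auto
  have prob: "prob_space (distr (PiM Q (?g j)) ?F (?am Q))" if "Q \<in> {R, R', R \<union> R'}" for Q j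
    by (intro prob_space.prob_space_distr prob_space_gamma_PiM am that)
  have add[measurable]: "(\<lambda>(p, q). add_measure p q) \<in> ?F \<Otimes>\<^sub>M ?F \<rightarrow>\<^sub>M ?F"
    unfolding split_beta' by (intro measurable_add_measure) measurable
  have "distr (PiM (R \<union> R') (?g j)) ?F (?am (R \<union> R')) =
      distr (distr (PiM R (?g j)) ?F (?am R) \<Otimes>\<^sub>M distr (PiM R' (?g j)) ?F (?am R')) ?F (\<lambda>(p, q). add_measure p q)" for j
  proof -
    interpret product_sigma_finite "?g j"
      by (simp add: product_sigma_finite_def prob_space_imp_sigma_finite prob_space_gamma_law)
    have s: "sigma_finite_measure (distr (PiM R' (?g j)) ?F (?am R'))"
      by (intro prob_space_imp_sigma_finite prob) auto
    have [measurable]: "?am R \<in> PiM R (?g j) \<rightarrow>\<^sub>M ?F" "?am R' \<in> PiM R' (?g j) \<rightarrow>\<^sub>M ?F"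
      "?am (R \<union> R') \<in> PiM (R \<union> R') (?g j) \<rightarrow>\<^sub>M ?F"
      by (auto intro: am)
    have "distr (PiM (R \<union> R') (?g j)) ?F (?am (R \<union> R')) =
        distr (distr (PiM R (?g j) \<Otimes>\<^sub>M PiM R' (?g j)) (PiM (R \<union> R') (?g j)) (merge R R')) ?F (?am (R \<union> R'))"
      using fin disj by (simp add: distr_merge)
    also have "\<dots> = distr (PiM R (?g j) \<Otimes>\<^sub>M PiM R' (?g j)) ?F (?am (R \<union> R') \<circ> merge R R')"
      by (intro distr_distr) measurable
    also have "?am (R \<union> R') \<circ> merge R R' = (\<lambda>(p, q). add_measure p q) \<circ> (\<lambda>(s, t). (?am R s, ?am R' t))"
    proof (intro ext, clarsimp simp: atomic_measure_Un[OF fin disj])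
      fix s t
      have "?am R (merge R R' (s, t)) = ?am R s" by (rule atomic_measure_cong) (auto simp: merge_def)
      moreover have "?am R' (merge R R' (s, t)) = ?am R' t"
        using disj by (intro atomic_measure_cong) (auto simp: merge_def)
      ultimately show "add_measure (?am R (merge R R' (s, t))) (?am R' (merge R R' (s, t))) = add_measure (?am R s) (?am R' t)"
        by simp
    qed
    also have "distr (PiM R (?g j) \<Otimes>\<^sub>M PiM R' (?g j)) ?F \<dots> =
      distr (distr (PiM R (?g j) \<Otimes>\<^sub>M PiM R' (?g j)) (?F \<Otimes>\<^sub>M ?F) (\<lambda>(s, t). (?am R s, ?am R' t))) ?F (\<lambda>(p, q). add_measure p q)"
      by (intro distr_distr[symmetric]) measurable
    also have "distr (PiM R (?g j) \<Otimes>\<^sub>M PiM R' (?g j)) (?F \<Otimes>\<^sub>M ?F) (\<lambda>(s, t). (?am R s, ?am R' t)) =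
        distr (PiM R (?g j)) ?F (?am R) \<Otimes>\<^sub>M distr (PiM R' (?g j)) ?F (?am R')"
      by (intro pair_measure_distr[symmetric] s) auto
    finally show ?thesis .
  qed
  moreover have "distr (PiM {1..d} (\<lambda>j. distr (PiM R (?g j)) ?F (?am R)) \<Otimes>\<^sub>M PiM {1..d} (\<lambda>j. distr (PiM R' (?g j)) ?F (?am R')))
      (PiM {1..d} (\<lambda>_. ?F)) (\<lambda>(p, q). \<lambda>j\<in>{1..d}. (\<lambda>(p, q). add_measure p q) (p j, q j)) =
    PiM {1..d} (\<lambda>j. distr (distr (PiM R (?g j)) ?F (?am R) \<Otimes>\<^sub>M distr (PiM R' (?g j)) ?F (?am R')) ?F (\<lambda>(p, q). add_measure p q))"
    by (intro distr_pair_PiM prob) auto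
  moreover have "gamma_atoms_law B d Q x a b = PiM {1..d} (\<lambda>j. distr (PiM Q (?g j)) ?F (?am Q))"
    if "Q \<in> {R, R', R \<union> R'}" for Q
    using that fin x by (intro gamma_atoms_law_eq_PiM) auto
  ultimately show ?thesis
    by (simp add: add_law_def)
qed

section \<open>Random locations and a random number of atoms\<close>

lemma nn_integral_iid_atoms_law:
  assumes R: "finite R" and f[measurable]: "f \<in> borel_measurable (measure_vectors d P0)"
  shows "(\<integral>\<^sup>+m. f m \<partial>iid_atoms_law P0 d R a b) =
    (\<integral>\<^sup>+\<tau>. \<integral>\<^sup>+m. f m \<partial>gamma_atoms_law P0 d R \<tau> (\<lambda>j k. a j) b \<partial>PiM R (\<lambda>_. P0))"
proof -
  let ?G = "PiM {1..d} (\<lambda>j. PiM R (\<lambda>k. gamma_law (a j) (b j)))"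
  interpret sigma_finite_measure ?G
    by (intro prob_space_imp_sigma_finite prob_space_PiM prob_space_gamma_law)
  have V: "(\<lambda>(\<tau>, S). \<lambda>j\<in>{1..d}. atomic_measure P0 R (S j) \<tau>) \<in> PiM R (\<lambda>_. P0) \<Otimes>\<^sub>M ?G \<rightarrow>\<^sub>M measure_vectors d P0"
    unfolding split_beta' by (rule measurable_atomic_vectors[OF R]) measurable
  have "(\<integral>\<^sup>+m. f m \<partial>iid_atoms_law P0 d R a b) =
     (\<integral>\<^sup>+\<tau>. \<integral>\<^sup>+S. f (\<lambda>j\<in>{1..d}. atomic_measure P0 R (S j) \<tau>) \<partial>?G \<partial>PiM R (\<lambda>_. P0))"
    unfolding iid_atoms_law_def
    by (subst nn_integral_distr[OF V], simp, subst nn_integral_fst[OF measurable_compose[OF V f], symmetric]) simp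
  also have "\<dots> = (\<integral>\<^sup>+\<tau>. \<integral>\<^sup>+m. f m \<partial>gamma_atoms_law P0 d R \<tau> (\<lambda>j k. a j) b \<partial>PiM R (\<lambda>_. P0))"
  proof (intro nn_integral_cong)
    fix \<tau> assume "\<tau> \<in> space (PiM R (\<lambda>_. P0))"
    then have "(\<lambda>S. \<lambda>j\<in>{1..d}. atomic_measure P0 R (S j) \<tau>) \<in> ?G \<rightarrow>\<^sub>M measure_vectors d P0"
      by (intro measurable_atomic_vectors[OF R] measurable_const) (auto simp: space_PiM)
    then show "(\<integral>\<^sup>+S. f (\<lambda>j\<in>{1..d}. atomic_measure P0 R (S j) \<tau>) \<partial>?G) = (\<integral>\<^sup>+m. f m \<partial>gamma_atoms_law P0 d R \<tau> (\<lambda>j k. a j) b)"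
      unfolding gamma_atoms_law_def by (subst nn_integral_distr) auto
  qed
  finally show ?thesis .
qed

text \<open>The locations are exchangeable and the jumps of one component share a common law, so
  only the number of labels counts. This turns the labels left over by an allocation into
  \<open>{1..l}\<close>.\<close>

lemma iid_atoms_law_reindex:
  fixes R :: "'k set" and R' :: "'l set"
  assumes R: "finite R" "finite R'" "card R = card R'" and P0: "prob_space P0"
  shows "iid_atoms_law P0 d R a b = iid_atoms_law P0 d R' a b"
proof (rule measure_eqI)
  obtain \<sigma> where \<sigma>: "bij_betw \<sigma> R R'" using R finite_same_card_bij by blast
  then have \<sigma>': "\<sigma> k \<in> R'" if "k \<in> R" for k using that by (auto simp: bij_betw_def)
  fix A assume "A \<in> sets (iid_atoms_law P0 d R a b)"
  then have A[measurable]: "A \<in> sets (measure_vectors d P0)" by simp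
  have e: "emeasure (iid_atoms_law P0 d Q a b) A =
      (\<integral>\<^sup>+\<tau>. emeasure (gamma_atoms_law P0 d Q \<tau> (\<lambda>j k. a j) b) A \<partial>PiM Q (\<lambda>_. P0))" if "finite Q" for Q :: "'k set"
    using nn_integral_iid_atoms_law[OF that, of "indicator A" d P0 a b] A by simp
  have e': "emeasure (iid_atoms_law P0 d Q a b) A =
      (\<integral>\<^sup>+\<tau>. emeasure (gamma_atoms_law P0 d Q \<tau> (\<lambda>j k. a j) b) A \<partial>PiM Q (\<lambda>_. P0))" if "finite Q" for Q :: "'l set"
    using nn_integral_iid_atoms_law[OF that, of "indicator A" d P0 a b] A by simp
  have [measurable]: "(\<lambda>\<tau>. emeasure (gamma_atoms_law P0 d R \<tau> (\<lambda>j k. a j) b) A) \<in> borel_measurable (PiM R (\<lambda>_. P0))"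
    by (rule measurable_compose[OF measurable_prob_algebraD[OF measurable_gamma_atoms_law]
        measurable_emeasure_subprob_algebra]) (use R in auto)
  have "emeasure (iid_atoms_law P0 d R a b) A =
      (\<integral>\<^sup>+\<tau>. emeasure (gamma_atoms_law P0 d R \<tau> (\<lambda>j k. a j) b) A
        \<partial>distr (PiM R' (\<lambda>_. P0)) (PiM R (\<lambda>_. P0)) (\<lambda>w. \<lambda>n\<in>R. w (\<sigma> n)))"
    using \<sigma> \<sigma>' P0 by (subst distr_PiM_reindex[where M = "\<lambda>_. P0"]) (auto simp: e R bij_betw_def)
  also have "\<dots> = (\<integral>\<^sup>+\<tau>. emeasure (gamma_atoms_law P0 d R (\<lambda>n\<in>R. \<tau> (\<sigma> n)) (\<lambda>j k. a j) b) A \<partial>PiM R' (\<lambda>_. P0))"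
    using \<sigma>' by (subst nn_integral_distr) (auto intro!: measurable_restrict)
  also have "\<dots> = (\<integral>\<^sup>+\<tau>. emeasure (gamma_atoms_law P0 d R' \<tau> (\<lambda>j k. a j) b) A \<partial>PiM R' (\<lambda>_. P0))"
  proof (intro nn_integral_cong)
    fix \<tau> assume "\<tau> \<in> space (PiM R' (\<lambda>_. P0))"
    then have "gamma_atoms_law P0 d R (\<lambda>k. \<tau> (\<sigma> k)) (\<lambda>j k. a j) b = gamma_atoms_law P0 d R' \<tau> (\<lambda>j k. a j) b"
      using R by (intro gamma_atoms_law_reindex[OF _ \<sigma>, where a = "\<lambda>j k. a j"]) (auto simp: space_PiM)
    also have "gamma_atoms_law P0 d R (\<lambda>k. \<tau> (\<sigma> k)) (\<lambda>j k. a j) b = gamma_atoms_law P0 d R (\<lambda>n\<in>R. \<tau> (\<sigma> n)) (\<lambda>j k. a j) b"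
      by (rule gamma_atoms_law_cong) auto
    finally show "emeasure (gamma_atoms_law P0 d R (\<lambda>n\<in>R. \<tau> (\<sigma> n)) (\<lambda>j k. a j) b) A =
        emeasure (gamma_atoms_law P0 d R' \<tau> (\<lambda>j k. a j) b) A" by simp
  qed
  finally show "emeasure (iid_atoms_law P0 d R a b) A = emeasure (iid_atoms_law P0 d R' a b) A"
    by (simp add: e' R)
qed simp

text \<open>The mixture over the number of atoms becomes a series, the form in which it is later
  matched with the series over the prior number of atoms.\<close>

lemma
  assumes P0: "prob_space P0"
  shows sets_random_atoms_law: "sets (random_atoms_law q d P0 a b) = sets (measure_vectors d P0)"
    and prob_space_random_atoms_law: "prob_space (random_atoms_law q d P0 a b)"
    and nn_integral_random_atoms_law: "f \<in> borel_measurable (measure_vectors d P0) \<Longrightarrow>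
      (\<integral>\<^sup>+m. f m \<partial>random_atoms_law q d P0 a b) =
      (\<Sum>l. ennreal (pmf q l) * (\<integral>\<^sup>+m. f m \<partial>iid_atoms_law P0 d {1..l} a b))"
proof -
  have K: "(\<lambda>m. iid_atoms_law P0 d {1..m} a b) \<in> measure_pmf q \<rightarrow>\<^sub>M prob_algebra (measure_vectors d P0)"
    using P0 by (auto simp: space_prob_algebra prob_space_iid_atoms_law)
  have q: "measure_pmf q \<in> space (prob_algebra (measure_pmf q))"
    by (simp add: space_prob_algebra measure_pmf.prob_space_axioms)
  show "sets (random_atoms_law q d P0 a b) = sets (measure_vectors d P0)"
    unfolding random_atoms_law_eq by (rule sets_bind'[OF q K])
  show "prob_space (random_atoms_law q d P0 a b)"
    unfolding random_atoms_law_eq by (rule prob_space_bind'[OF q K])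
  assume f: "f \<in> borel_measurable (measure_vectors d P0)"
  show "(\<integral>\<^sup>+m. f m \<partial>random_atoms_law q d P0 a b) =
      (\<Sum>l. ennreal (pmf q l) * (\<integral>\<^sup>+m. f m \<partial>iid_atoms_law P0 d {1..l} a b))"
    unfolding random_atoms_law_eq
    by (subst nn_integral_bind[OF f measurable_prob_algebraD[OF K]])
       (simp add: nn_integral_measure_pmf nn_integral_count_space_nat)
qed

text \<open>By the series above it is enough that each point mass of \<open>q w\<close> is
  measurable in \<open>w\<close>; no sigma-algebra on the space of pmfs has to be chosen.\<close>

lemma measurable_random_atoms_law:
  assumes P0: "prob_space P0" and q[measurable]: "\<And>l. (\<lambda>w. pmf (q w) l) \<in> borel_measurable L"
    and b: "\<And>j. j \<in> {1..d} \<Longrightarrow> (\<lambda>w. b w j) \<in> borel_measurable L"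
  shows "(\<lambda>w. random_atoms_law (q w) d P0 a (b w)) \<in> L \<rightarrow>\<^sub>M prob_algebra (measure_vectors d P0)"
proof (rule measurable_prob_algebraI[OF prob_space_random_atoms_law[OF P0]], rule measurable_subprob_algebra)
  fix A assume A[measurable]: "A \<in> sets (measure_vectors d P0)"
  have "emeasure (random_atoms_law (q w) d P0 a (b w)) A =
      (\<Sum>l. ennreal (pmf (q w) l) * emeasure (iid_atoms_law P0 d {1..l} a (b w)) A)" for w
    using nn_integral_random_atoms_law[OF P0, of "indicator A" d "q w" a "b w"] A
    by (simp add: sets_random_atoms_law[OF P0])
  moreover have [measurable]: "(\<lambda>w. emeasure (iid_atoms_law P0 d {1..l} a (b w)) A) \<in> borel_measurable L" for l :: nat
    by (rule measurable_compose[OF measurable_prob_algebraD[OF measurable_iid_atoms_law[OF _ P0 b]]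
        measurable_emeasure_subprob_algebra]) auto
  ultimately show "(\<lambda>w. emeasure (random_atoms_law (q w) d P0 a (b w)) A) \<in> borel_measurable L"
    by simp
qed (auto intro: prob_space_imp_subprob_space prob_space_random_atoms_law P0 simp: sets_random_atoms_law[OF P0])

text \<open>Integrating out \<open>X\<close> first exhibits the mass under \<open>add_law\<close> as
  an integral over \<open>Y\<close>, hence as linear in \<open>Y\<close>. The two lemmas below use
  this to move mixtures over the number and over the locations of the atoms of \<open>Y\<close> out
  of \<open>add_law\<close>.\<close>

lemma
  assumes X: "prob_space X" "sets X = sets (measure_vectors d B)"
    and A[measurable]: "A \<in> sets (measure_vectors d B)"
  shows measurable_emeasure_add_vectors:
      "(\<lambda>na. emeasure X {a \<in> space X. (\<lambda>j\<in>{1..d}. add_measure (a j) (na j)) \<in> A}) \<in> borel_measurable (measure_vectors d B)"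
    and emeasure_add_law: "prob_space Y \<Longrightarrow> sets Y = sets (measure_vectors d B) \<Longrightarrow>
      emeasure (add_law B d X Y) A =
      (\<integral>\<^sup>+na. emeasure X {a \<in> space X. (\<lambda>j\<in>{1..d}. add_measure (a j) (na j)) \<in> A} \<partial>Y)"
proof -
  let ?M = "measure_vectors d B" and ?add = "\<lambda>a na. \<lambda>j\<in>{1..d}. add_measure (a j) (na j)"
  note X(2)[measurable_cong]
  have spX: "space X = space ?M" using X(2) by (rule sets_eq_imp_space_eq)
  interpret X: prob_space X by fact
  have S: "{z \<in> space (?M \<Otimes>\<^sub>M ?M). ?add (fst z) (snd z) \<in> A} \<in> sets (?M \<Otimes>\<^sub>M ?M)"
    using measurable_sets[OF measurable_add_vectors A] by (simp add: vimage_def Int_def split_beta' conj_commute)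
  have h: "(\<lambda>na. \<integral>\<^sup>+a. indicator A (?add a na) \<partial>X) \<in> borel_measurable ?M"
    using measurable_compose[OF measurable_pair_swap' measurable_compose[OF measurable_add_vectors borel_measurable_indicator[OF A]]]
    by (intro X.borel_measurable_nn_integral)
       (simp add: split_beta' measurable_cong_sets[OF sets_pair_measure_cong[OF refl X(2)] refl])
  have e: "(\<integral>\<^sup>+a. indicator A (?add a na) \<partial>X) = emeasure X {a \<in> space X. ?add a na \<in> A}" if "na \<in> space ?M" for na
  proof -
    have "{a \<in> space X. ?add a na \<in> A} \<in> sets X"
      using sets_Pair2[OF S, of na] that by (simp add: space_pair_measure vimage_def spX X(2))
    then have "emeasure X {a \<in> space X. ?add a na \<in> A} = (\<integral>\<^sup>+a. indicator {a \<in> space X. ?add a na \<in> A} a \<partial>X)"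
      by simp
    also have "\<dots> = (\<integral>\<^sup>+a. indicator A (?add a na) \<partial>X)"
      by (intro nn_integral_cong) (auto simp: indicator_def)
    finally show ?thesis by simp
  qed
  show "(\<lambda>na. emeasure X {a \<in> space X. ?add a na \<in> A}) \<in> borel_measurable ?M"
    using h by (subst measurable_cong[OF e[symmetric]]) auto
  assume Y: "prob_space Y" "sets Y = sets ?M"
  note Y(2)[measurable_cong]
  have spY: "space Y = space ?M" using Y(2) by (rule sets_eq_imp_space_eq)
  interpret Y: prob_space Y by fact
  interpret XY: pair_sigma_finite X Y ..
  have [measurable]: "(\<lambda>(a, na). ?add a na) \<in> X \<Otimes>\<^sub>M Y \<rightarrow>\<^sub>M ?M"
    by measurable
  have "emeasure (add_law B d X Y) A = (\<integral>\<^sup>+z. indicator A (case z of (a, na) \<Rightarrow> ?add a na) \<partial>(X \<Otimes>\<^sub>M Y))"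
    unfolding add_law_def
    by (subst nn_integral_indicator[symmetric], simp, subst nn_integral_distr, auto)
  also have "\<dots> = (\<integral>\<^sup>+na. \<integral>\<^sup>+a. indicator A (?add a na) \<partial>X \<partial>Y)"
    by (subst XY.nn_integral_snd[symmetric]) auto
  also have "\<dots> = (\<integral>\<^sup>+na. emeasure X {a \<in> space X. ?add a na \<in> A} \<partial>Y)"
    by (intro nn_integral_cong e) (simp add: spY)
  finally show "emeasure (add_law B d X Y) A = \<dots>" .
qed

lemma emeasure_add_law_random_atoms_law:
  assumes "prob_space X" "sets X = sets (measure_vectors d P0)" "prob_space P0"
    and "A \<in> sets (measure_vectors d P0)"
  shows "emeasure (add_law P0 d X (random_atoms_law q d P0 a b)) A =
    (\<Sum>l. ennreal (pmf q l) * emeasure (add_law P0 d X (iid_atoms_law P0 d {1..l} a b)) A)"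
  using assms
  by (subst emeasure_add_law)
     (simp_all add: sets_random_atoms_law prob_space_random_atoms_law nn_integral_random_atoms_law
       measurable_emeasure_add_vectors emeasure_add_law prob_space_iid_atoms_law)

lemma emeasure_add_law_iid_atoms_law:
  assumes X: "prob_space X" "sets X = sets (measure_vectors d P0)" and P0: "prob_space P0"
    and A: "A \<in> sets (measure_vectors d P0)" and R: "finite R"
  shows "(\<integral>\<^sup>+y. emeasure (add_law P0 d X (gamma_atoms_law P0 d R y (\<lambda>j k. a j) b)) A \<partial>PiM R (\<lambda>_. P0)) =
    emeasure (add_law P0 d X (iid_atoms_law P0 d R a b)) A"
  unfolding emeasure_add_law[OF X A prob_space_iid_atoms_law[OF R P0] sets_iid_atoms_law]
    nn_integral_iid_atoms_law[OF R measurable_emeasure_add_vectors[OF X A]]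
  by (intro nn_integral_cong emeasure_add_law[OF X A] prob_space_gamma_atoms_law R sets_gamma_atoms_law)
     (auto simp: space_PiM)

text \<open>A product of finite sums expands over choice functions: the candidate is the image of a
  point measure on \<open>PiE I X\<close>, compared on boxes by distributivity. Applied to the draws
  within a group and then to the groups, it produces the sum over allocations.\<close>

lemma emeasure_PiM_discrete:
  assumes I: "finite I" and X: "\<And>i. i \<in> I \<Longrightarrow> finite (X i)"
    and w: "\<And>i x. i \<in> I \<Longrightarrow> x \<in> X i \<Longrightarrow> w i x < top"
    and g: "\<And>i x. i \<in> I \<Longrightarrow> x \<in> X i \<Longrightarrow> g i x \<in> space (M i)"
    and s: "\<And>i. i \<in> I \<Longrightarrow> sets (N i) = sets (M i)"
    and N: "\<And>i A. i \<in> I \<Longrightarrow> A \<in> sets (M i) \<Longrightarrow>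
      emeasure (N i) A = (\<Sum>x\<in>X i. w i x * indicator A (g i x))"
    and A: "A \<in> sets (PiM I M)"
  shows "emeasure (PiM I N) A =
    (\<Sum>x\<in>PiE I X. (\<Prod>i\<in>I. w i (x i)) * indicator A (\<lambda>i\<in>I. g i (x i)))"
proof -
  let ?p = "point_measure (PiE I X) (\<lambda>x. \<Prod>i\<in>I. w i (x i))"
  let ?g = "\<lambda>x. \<lambda>i\<in>I. g i (x i)"
  let ?Q = "distr ?p (PiM I M) ?g"
  have fin: "finite (PiE I X)" using I X by (intro finite_PiE) auto
  have Q: "emeasure ?Q E = (\<Sum>x\<in>PiE I X. (\<Prod>i\<in>I. w i (x i)) * indicator E (?g x))"
    if "E \<in> sets (PiM I M)" for E
  proof -
    have "?g \<in> ?p \<rightarrow>\<^sub>M PiM I M"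
      using g by (auto simp: point_measure_def space_PiM PiE_iff)
    then have "emeasure ?Q E = emeasure ?p (?g -` E \<inter> PiE I X)"
      using that by (subst emeasure_distr) (auto simp: space_point_measure)
    also have "\<dots> = (\<Sum>x\<in>?g -` E \<inter> PiE I X. \<Prod>i\<in>I. w i (x i))"
      by (intro emeasure_point_measure_finite fin) auto
    also have "\<dots> = (\<Sum>x\<in>PiE I X. (\<Prod>i\<in>I. w i (x i)) * indicator E (?g x))"
      using fin by (intro sum.mono_neutral_cong_left) (auto simp: indicator_def)
    finally show ?thesis .
  qed
  have "?Q = PiM I N"
  proof (rule PiM_eqI'[OF I])
    fix i assume i: "i \<in> I"
    have "emeasure (N i) (space (N i)) < top"
      using N[OF i sets.top] X[OF i] w[OF i] sets_eq_imp_space_eq[OF s[OF i]]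
      by (simp add: ennreal_mult_less_top indicator_def)
    then have "finite_measure (N i)" by (intro finite_measureI) simp
    then show "sigma_finite_measure (N i)" by (simp add: finite_measure_def)
  next
    show "sets ?Q = sets (PiM I N)" using s by (simp cong: sets_PiM_cong)
    fix E assume "\<And>i. i \<in> I \<Longrightarrow> E i \<in> sets (N i)"
    then have E: "\<And>i. i \<in> I \<Longrightarrow> E i \<in> sets (M i)" using s by simp
    have "emeasure ?Q (Pi\<^sub>E I E) = (\<Sum>x\<in>PiE I X. (\<Prod>i\<in>I. w i (x i)) * indicator (Pi\<^sub>E I E) (?g x))"
      using I E by (intro Q sets_PiM_I_finite) auto
    also have "\<dots> = (\<Sum>x\<in>PiE I X. \<Prod>i\<in>I. w i (x i) * indicator (E i) (g i (x i)))"
      by (intro sum.cong refl) (simp add: indicator_PiE_prod[OF I] prod.distrib)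
    also have "\<dots> = (\<Prod>i\<in>I. \<Sum>x\<in>X i. w i x * indicator (E i) (g i x))"
      using I X by (intro prod_sum_PiE[symmetric]) auto
    also have "\<dots> = (\<Prod>i\<in>I. emeasure (N i) (E i))"
      using N E by (intro prod.cong) auto
    finally show "emeasure ?Q (Pi\<^sub>E I E) = \<dots>" .
  qed
  with Q[OF A] show ?thesis by simp
qed

text \<open>With the other coordinates fixed, coordinate \<open>k\<close> hits the value at
  \<open>l\<close> with probability zero by diffuseness, and there are finitely many pairs.\<close>

lemma AE_PiM_inj_on:
  assumes P0: "prob_space P0" and diffuse: "\<And>x. x \<in> space P0 \<Longrightarrow> emeasure P0 {x} = 0"
    and diag[measurable]: "{z \<in> space (P0 \<Otimes>\<^sub>M P0). fst z = snd z} \<in> sets (P0 \<Otimes>\<^sub>M P0)"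
    and R: "finite R"
  shows "AE \<tau> in PiM R (\<lambda>_. P0). inj_on \<tau> R"
proof -
  interpret prob_space P0 by fact
  interpret product_sigma_finite "\<lambda>_. P0" ..
  have eq: "Measurable.pred (PiM R (\<lambda>_. P0)) (\<lambda>\<tau>. \<tau> k = \<tau> l)" if "k \<in> R" "l \<in> R" for k l
  proof -
    have "(\<lambda>\<tau>. (\<tau> k, \<tau> l)) \<in> PiM R (\<lambda>_. P0) \<rightarrow>\<^sub>M P0 \<Otimes>\<^sub>M P0"
      using that by measurable
    from measurable_sets[OF this diag] show ?thesis
      unfolding pred_def using that
      by (elim back_subst[where P = "\<lambda>A. A \<in> sets _"]) (auto simp: space_pair_measure space_PiM)
  qed
  have "AE \<tau> in PiM R (\<lambda>_. P0). \<tau> k \<noteq> \<tau> l" if kl: "k \<in> R" "l \<in> R" "k \<noteq> l" for k l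
  proof -
    define I where "I = R - {k}"
    have I: "finite I" "k \<notin> I" "insert k I = R" "l \<in> I" using R kl by (auto simp: I_def)
    let ?f = "\<lambda>\<tau>. indicator {\<tau>. \<tau> k = \<tau> l} \<tau> :: ennreal"
    have f: "?f \<in> borel_measurable (PiM R (\<lambda>_. P0))"
      using eq[OF kl(1,2)] by (auto intro!: borel_measurable_indicator' simp: pred_def)
    have "(\<integral>\<^sup>+\<tau>. ?f \<tau> \<partial>PiM R (\<lambda>_. P0)) = (\<integral>\<^sup>+x. (\<integral>\<^sup>+y. ?f (x(k := y)) \<partial>P0) \<partial>PiM I (\<lambda>_. P0))"
      using product_nn_integral_insert[OF I(1,2), of ?f] f by (simp add: I)
    also have "\<dots> = (\<integral>\<^sup>+x. 0 \<partial>PiM I (\<lambda>_. P0))"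
    proof (intro nn_integral_cong)
      fix x assume "x \<in> space (PiM I (\<lambda>_. P0))"
      then have xl: "x l \<in> space P0" using I by (auto simp: space_PiM)
      \<comment> \<open>Singletons are measurable as sections of the diagonal.\<close>
      have s: "{x l} \<in> sets P0"
        using sets_Pair1[OF diag, of "x l"] xl
        by (elim back_subst[where P = "\<lambda>A. A \<in> sets _"]) (auto simp: space_pair_measure)
      have "(\<integral>\<^sup>+y. ?f (x(k := y)) \<partial>P0) = (\<integral>\<^sup>+y. indicator {x l} y \<partial>P0)"
        using kl by (intro nn_integral_cong) (auto simp: indicator_def)
      then show "(\<integral>\<^sup>+y. ?f (x(k := y)) \<partial>P0) = 0" using s diffuse[OF xl] by simp
    qed
    finally have "(\<integral>\<^sup>+\<tau>. ?f \<tau> \<partial>PiM R (\<lambda>_. P0)) = 0" by simp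
    then have "AE \<tau> in PiM R (\<lambda>_. P0). ?f \<tau> = 0"
      using nn_integral_0_iff_AE[OF f] by simp
    then show ?thesis by (rule AE_mp) (auto simp: indicator_def)
  qed
  then have "AE \<tau> in PiM R (\<lambda>_. P0). \<forall>k\<in>R. \<forall>l\<in>R. k \<noteq> l \<longrightarrow> \<tau> k \<noteq> \<tau> l"
    using R by (intro AE_finite_allI) auto
  then show ?thesis by (rule AE_mp) (auto simp: inj_on_def)
qed

section \<open>Samples and their coincidence patterns\<close>

text \<open>With \<open>c\<close> an allocation and \<open>f\<close> the atom locations this is the
  sample; with \<open>f\<close> a map of labels it renames an allocation. The restrictions make the
  result extensional, as elements of the product spaces are.\<close>

definition relabel :: "nat \<Rightarrow> (nat \<Rightarrow> nat) \<Rightarrow> ('a \<Rightarrow> 'b) \<Rightarrow> (nat \<Rightarrow> nat \<Rightarrow> 'a) \<Rightarrow> nat \<Rightarrow> nat \<Rightarrow> 'b" where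
  "relabel d n f c = (\<lambda>j\<in>{1..d}. \<lambda>i\<in>{1..n j}. f (c j i))"

definition allocations :: "nat \<Rightarrow> (nat \<Rightarrow> nat) \<Rightarrow> nat \<Rightarrow> (nat \<Rightarrow> nat \<Rightarrow> nat) set" where
  "allocations d n m = (\<Pi>\<^sub>E j\<in>{1..d}. \<Pi>\<^sub>E i\<in>{1..n j}. {1..m})"

lemma distinct_values_eq: "distinct_values d n t = (\<lambda>(j, i). t j i) ` (SIGMA j:{1..d}. {1..n j})"
  by (auto simp: distinct_values_def) blast

lemma finite_distinct_values[simp]: "finite (distinct_values d n t)"
  by (simp add: distinct_values_eq)

lemma card_distinct_values_le: "card (distinct_values d n t) \<le> (\<Sum>j\<in>{1..d}. n j)"
  unfolding distinct_values_eq by (rule order.trans[OF card_image_le]) auto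

lemma distinct_values_relabel: "distinct_values d n (relabel d n f c) = f ` distinct_values d n c"
  by (auto simp: distinct_values_def relabel_def intro!: imageI)

lemma multiplicity_of_relabel:
  assumes "inj_on f (distinct_values d n c)" "k \<in> distinct_values d n c" "j \<in> {1..d}"
  shows "multiplicity_of n (relabel d n f c) j (f k) = multiplicity_of n c j k"
proof -
  have "c j i \<in> distinct_values d n c" if "i \<in> {1..n j}" for i
    using assms(3) that by (auto simp: distinct_values_def)
  then have "{i \<in> {1..n j}. relabel d n f c j i = f k} = {i \<in> {1..n j}. c j i = k}"
    using assms by (auto simp: relabel_def dest: inj_onD)
  then show ?thesis by (simp add: multiplicity_of_def)
qed

lemma multiplicity_of_eq_0:
  assumes "k \<notin> distinct_values d n c" "j \<in> {1..d}"
  shows "multiplicity_of n c j k = 0"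
  using assms by (auto simp: multiplicity_of_def distinct_values_def)

lemma relabel_relabel: "relabel d n f (relabel d n g c) = relabel d n (\<lambda>k. f (g k)) c"
  by (auto simp: relabel_def fun_eq_iff)

lemma relabel_cong:
  "(\<And>k. k \<in> distinct_values d n c \<Longrightarrow> f k = g k) \<Longrightarrow> relabel d n f c = relabel d n g c"
  by (auto simp: relabel_def fun_eq_iff distinct_values_def)

lemma relabel_ident: "c \<in> (\<Pi>\<^sub>E j\<in>{1..d}. \<Pi>\<^sub>E i\<in>{1..n j}. X) \<Longrightarrow> relabel d n (\<lambda>k. k) c = c"
  by (auto simp: relabel_def fun_eq_iff PiE_iff extensional_def)

lemma finite_allocations: "finite (allocations d n m)"
  unfolding allocations_def by (intro finite_PiE) auto

text \<open>Invariance under relabelling by the identity expresses that \<open>c\<close> is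
  extensional; what remains of membership is a condition on the range.\<close>

lemma distinct_values_allocations:
  "c \<in> allocations d n m \<longleftrightarrow> distinct_values d n c \<subseteq> {1..m} \<and> c = relabel d n (\<lambda>k. k) c"
proof
  assume c: "c \<in> allocations d n m"
  then show "distinct_values d n c \<subseteq> {1..m} \<and> c = relabel d n (\<lambda>k. k) c"
    using relabel_ident[of c d n "{1..m}"] by (auto simp: allocations_def distinct_values_def PiE_iff)
next
  assume c: "distinct_values d n c \<subseteq> {1..m} \<and> c = relabel d n (\<lambda>k. k) c"
  have "c j i \<in> distinct_values d n c" if "j \<in> {1..d}" "i \<in> {1..n j}" for j i
    using that by (auto simp: distinct_values_def)
  with conjunct1[OF c] have "relabel d n (\<lambda>k. k) c \<in> allocations d n m"
    unfolding allocations_def relabel_def restrict_PiE_iff by blast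
  then show "c \<in> allocations d n m" by (subst conjunct2[OF c])
qed

section \<open>Measurability on the space of samples\<close>

lemma space_samples_space:
  "space (samples_space d n B) = (\<Pi>\<^sub>E j\<in>{1..d}. \<Pi>\<^sub>E i\<in>{1..n j}. space B)"
  by (simp add: space_PiM)

lemma measurable_nested_component:
  assumes "j \<in> I" "i \<in> J j"
  shows "(\<lambda>x. x j i) \<in> PiM I (\<lambda>j. PiM (J j) (M j)) \<rightarrow>\<^sub>M M j i"
proof -
  have "(\<lambda>x. x j) \<in> PiM I (\<lambda>j. PiM (J j) (M j)) \<rightarrow>\<^sub>M PiM (J j) (M j)"
    using assms(1) by (rule measurable_component_singleton)
  from measurable_compose[OF this measurable_component_singleton[of i "J j" "M j"]] assms(2)
  show ?thesis by simp
qed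

lemma measurable_sample_component:
  assumes "(j, i) \<in> (SIGMA j:{1..d}. {1..n j})"
  shows "(\<lambda>t. t j i) \<in> samples_space d n B \<rightarrow>\<^sub>M B"
  using assms measurable_nested_component[of j "{1..d}" i "\<lambda>j. {1..n j}" "\<lambda>_ _. B"] by simp

lemma measurable_relabel:
  assumes "\<And>k. k \<in> distinct_values d n c \<Longrightarrow> (\<lambda>w. f w k) \<in> L \<rightarrow>\<^sub>M B"
  shows "(\<lambda>w. relabel d n (f w) c) \<in> L \<rightarrow>\<^sub>M samples_space d n B"
  unfolding relabel_def using assms
  by (intro measurable_restrict) (auto simp: distinct_values_def)

text \<open>The law of the allocated part, with allocation pattern \<open>c\<close> and atom locations \<open>\<tau>\<close>.\<close>

definition allocated_law where
  "allocated_law B d n \<gamma> c \<tau> u = gamma_atoms_law B d (distinct_values d n c) \<tau>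
     (\<lambda>j k. real (multiplicity_of n c j k) + \<gamma> j) (\<lambda>j. u j + 1)"

lemma sets_allocated_law[simp, measurable_cong]:
  "sets (allocated_law B d n \<gamma> c \<tau> u) = sets (measure_vectors d B)"
  by (simp add: allocated_law_def)

text \<open>For distinct locations, ties among values are exactly ties among labels, so
  multiplicities agree. This is the sense in which the allocated atoms can be read off the
  sample.\<close>

lemma allocated_law_relabel:
  assumes "inj_on \<tau> (distinct_values d n c)"
    and "\<And>k. k \<in> distinct_values d n c \<Longrightarrow> x (\<tau> k) \<in> space B"
  shows "allocated_law B d n \<gamma> (relabel d n \<tau> c) x u = allocated_law B d n \<gamma> c (\<lambda>k. x (\<tau> k)) u"
proof -
  have "allocated_law B d n \<gamma> (relabel d n \<tau> c) x u =
    gamma_atoms_law B d (distinct_values d n c) (\<lambda>k. x (\<tau> k))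
     (\<lambda>j k. real (multiplicity_of n (relabel d n \<tau> c) j (\<tau> k)) + \<gamma> j) (\<lambda>j. u j + 1)"
    unfolding allocated_law_def using assms
    by (intro gamma_atoms_law_reindex[symmetric,
          where a = "\<lambda>j k. real (multiplicity_of n (relabel d n \<tau> c) j k) + \<gamma> j"])
       (auto simp: distinct_values_relabel bij_betw_def)
  also have "\<dots> = allocated_law B d n \<gamma> c (\<lambda>k. x (\<tau> k)) u"
    unfolding allocated_law_def using assms
    by (intro gamma_atoms_law_cong) (auto simp: multiplicity_of_relabel)
  finally show ?thesis .
qed

text \<open>Bridge to the form of the theorem: \<open>\<theta>\<close> is any enumeration of the
  distinct values, and reindexing along it replaces the labels \<open>{1..K}\<close> by the values
  themselves.\<close>

lemma fixed_atoms_law_eq_allocated_law: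
  assumes \<tau>: "inj_on \<tau> (distinct_values d n c)" "\<And>k. k \<in> distinct_values d n c \<Longrightarrow> \<tau> k \<in> space B"
    and t: "t = relabel d n \<tau> c" and \<theta>: "bij_betw \<theta> {1..K} (distinct_values d n t)"
  shows "fixed_atoms_law B d K \<theta> (\<lambda>j k. real (multiplicity_of n t j (\<theta> k)) + \<gamma> j) (\<lambda>j. u j + 1) =
    allocated_law B d n \<gamma> c \<tau> u"
proof -
  have "fixed_atoms_law B d K \<theta> (\<lambda>j k. real (multiplicity_of n t j (\<theta> k)) + \<gamma> j) (\<lambda>j. u j + 1) =
      allocated_law B d n \<gamma> t (\<lambda>k. k) u"
    unfolding fixed_atoms_law_eq allocated_law_def using \<theta> \<tau>
    by (intro gamma_atoms_law_reindex[where x = "\<lambda>k. k" and a = "\<lambda>j k. real (multiplicity_of n t j k) + \<gamma> j"])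
       (auto simp: t distinct_values_relabel)
  then show ?thesis using allocated_law_relabel[OF \<tau>(1), of "\<lambda>k. k" B \<gamma> u] \<tau>(2) by (simp add: t)
qed

lemma measurable_allocated_law:
  assumes "\<And>k. k \<in> distinct_values d n c \<Longrightarrow> (\<lambda>w. x w k) \<in> L \<rightarrow>\<^sub>M B"
    and "\<And>j. j \<in> {1..d} \<Longrightarrow> (\<lambda>w. u w j) \<in> borel_measurable L"
  shows "(\<lambda>w. allocated_law B d n \<gamma> c (x w) (u w)) \<in> L \<rightarrow>\<^sub>M prob_algebra (measure_vectors d B)"
  unfolding allocated_law_def using assms by (intro measurable_gamma_atoms_law) auto

text \<open>The ties are exactly those of \<open>c\<close>: \<open>relabel\<close> forces them,
  injectivity of the locations forbids further ones.\<close>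

definition coincidence_set :: "nat \<Rightarrow> (nat \<Rightarrow> nat) \<Rightarrow> 'a measure \<Rightarrow> (nat \<Rightarrow> nat \<Rightarrow> nat) \<Rightarrow> (nat \<Rightarrow> nat \<Rightarrow> 'a) set" where
  "coincidence_set d n B c =
     {t \<in> space (samples_space d n B). \<exists>\<tau>. inj_on \<tau> (distinct_values d n c) \<and> t = relabel d n \<tau> c}"

text \<open>Numbering the distinct values from 1 on gives the pattern, and their number is at most
  the number of observations. So finitely many patterns cover the samples. The sets may repeat,
  since patterns that differ by a renaming of labels give the same set.\<close>

lemma ex_coincidence_set:
  assumes t: "t \<in> space (samples_space d n B)"
  shows "\<exists>c\<in>allocations d n (\<Sum>j\<in>{1..d}. n j). t \<in> coincidence_set d n B c"
proof -
  let ?T = "distinct_values d n t"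
  obtain h where h: "bij_betw h ?T {1..card ?T}"
    using ex_bij_betw_nat_finite_1[OF finite_distinct_values] bij_betw_inv by blast
  define c where "c = relabel d n h t"
  have "distinct_values d n c = {1..card ?T}"
    using h by (simp add: c_def distinct_values_relabel bij_betw_def)
  moreover have "c = relabel d n (\<lambda>k. k) c" by (simp add: c_def relabel_relabel)
  ultimately have c: "c \<in> allocations d n (\<Sum>j\<in>{1..d}. n j)"
    using card_distinct_values_le[of d n t] by (simp add: distinct_values_allocations)
  have "relabel d n (the_inv_into ?T h) c = relabel d n (\<lambda>k. k) t"
    using h unfolding c_def relabel_relabel
    by (intro relabel_cong) (auto simp: bij_betw_def the_inv_into_f_f)
  moreover have "relabel d n (\<lambda>k. k) t = t"
    using t by (intro relabel_ident) (simp add: space_samples_space)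
  moreover have "inj_on (the_inv_into ?T h) (distinct_values d n c)"
    unfolding c_def distinct_values_relabel using h by (intro inj_on_the_inv_into bij_betw_imp_inj_on)
  ultimately have "t \<in> coincidence_set d n B c"
    unfolding coincidence_set_def using t by (intro CollectI conjI exI[of _ "the_inv_into ?T h"]) simp_all
  with c show ?thesis by blast
qed

text \<open>One fixed sample position is selected for each label. The atom with that label is then a
  coordinate of the sample, hence measurable in it.\<close>

definition pattern_index :: "nat \<Rightarrow> (nat \<Rightarrow> nat) \<Rightarrow> (nat \<Rightarrow> nat \<Rightarrow> nat) \<Rightarrow> nat \<Rightarrow> nat \<times> nat" where
  "pattern_index d n c k = (SOME p. p \<in> (SIGMA j:{1..d}. {1..n j}) \<and> c (fst p) (snd p) = k)"

definition pattern_atom :: "nat \<Rightarrow> (nat \<Rightarrow> nat) \<Rightarrow> (nat \<Rightarrow> nat \<Rightarrow> nat) \<Rightarrow> (nat \<Rightarrow> nat \<Rightarrow> 'a) \<Rightarrow> nat \<Rightarrow> 'a" where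
  "pattern_atom d n c t k = t (fst (pattern_index d n c k)) (snd (pattern_index d n c k))"

lemma pattern_index:
  assumes "k \<in> distinct_values d n c"
  shows "pattern_index d n c k \<in> (SIGMA j:{1..d}. {1..n j})"
    and "c (fst (pattern_index d n c k)) (snd (pattern_index d n c k)) = k"
proof -
  have "\<exists>p. p \<in> (SIGMA j:{1..d}. {1..n j}) \<and> c (fst p) (snd p) = k"
    using assms by (auto simp: distinct_values_def)
  then have "pattern_index d n c k \<in> (SIGMA j:{1..d}. {1..n j}) \<and>
      c (fst (pattern_index d n c k)) (snd (pattern_index d n c k)) = k"
    unfolding pattern_index_def by (rule someI_ex)
  then show "pattern_index d n c k \<in> (SIGMA j:{1..d}. {1..n j})"
    and "c (fst (pattern_index d n c k)) (snd (pattern_index d n c k)) = k" by auto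
qed

lemma pattern_atomE:
  assumes "k \<in> distinct_values d n c"
  obtains j i where "(j, i) \<in> (SIGMA j:{1..d}. {1..n j})" "c j i = k" "pattern_atom d n c t k = t j i"
  using pattern_index[OF assms] unfolding pattern_atom_def by (metis prod.collapse)

lemma pattern_atom_relabel:
  assumes "k \<in> distinct_values d n c"
  shows "pattern_atom d n c (relabel d n \<tau> c) k = \<tau> k"
  using assms by (rule pattern_atomE[where t = "relabel d n \<tau> c"]) (auto simp: relabel_def)

lemma coincidence_setD:
  assumes "t \<in> coincidence_set d n B c"
  shows "inj_on (pattern_atom d n c t) (distinct_values d n c)"
    and "t = relabel d n (pattern_atom d n c t) c"
    and "k \<in> distinct_values d n c \<Longrightarrow> pattern_atom d n c t k \<in> space B"
proof -
  obtain \<tau> where \<tau>: "inj_on \<tau> (distinct_values d n c)" "t = relabel d n \<tau> c"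
    and t: "t \<in> space (samples_space d n B)"
    using assms by (auto simp: coincidence_set_def)
  have *: "pattern_atom d n c t k = \<tau> k" if "k \<in> distinct_values d n c" for k
    using pattern_atom_relabel[OF that] \<tau> by simp
  show "inj_on (pattern_atom d n c t) (distinct_values d n c)"
    by (rule inj_on_cong[THEN iffD2, OF * \<tau>(1)])
  show "t = relabel d n (pattern_atom d n c t) c"
    by (rule trans[OF \<tau>(2) relabel_cong[OF *[symmetric]]])
  show "pattern_atom d n c t k \<in> space B" if k: "k \<in> distinct_values d n c"
  proof -
    obtain j i where "(j, i) \<in> (SIGMA j:{1..d}. {1..n j})" "pattern_atom d n c t k = t j i"
      using k by (rule pattern_atomE)
    then show ?thesis using t by (auto simp: space_samples_space PiE_iff)
  qed
qed

lemma measurable_pattern_atom: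
  assumes "k \<in> distinct_values d n c"
  shows "(\<lambda>t. pattern_atom d n c t k) \<in> samples_space d n B \<rightarrow>\<^sub>M B"
  unfolding pattern_atom_def using pattern_index(1)[OF assms]
  by (intro measurable_sample_component) auto

text \<open>The existential over locations is eliminated: two sample positions must agree exactly
  when \<open>c\<close> agrees there. This leaves finitely many equality events, measurable by the
  hypothesis on the diagonal.\<close>

lemma sets_coincidence_set:
  assumes diag: "{z \<in> space (B \<Otimes>\<^sub>M B). fst z = snd z} \<in> sets (B \<Otimes>\<^sub>M B)"
  shows "coincidence_set d n B c \<in> sets (samples_space d n B)"
proof -
  let ?S = "samples_space d n B" and ?I = "SIGMA j:{1..d}. {1..n j}"
  have eq: "{t \<in> space ?S. t j i = t j' i'} \<in> sets ?S" if "(j, i) \<in> ?I" "(j', i') \<in> ?I" for j i j' i'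
  proof -
    have "(\<lambda>t. (t j i, t j' i')) \<in> ?S \<rightarrow>\<^sub>M B \<Otimes>\<^sub>M B"
      using that by (intro measurable_Pair measurable_sample_component)
    note m = this
    have "(\<lambda>t. (t j i, t j' i')) -` {z \<in> space (B \<Otimes>\<^sub>M B). fst z = snd z} \<inter> space ?S = {t \<in> space ?S. t j i = t j' i'}"
      using measurable_space[OF m] by auto
    with measurable_sets[OF m diag] show ?thesis by simp
  qed
  have "coincidence_set d n B c =
     {t \<in> space ?S. \<forall>p\<in>?I. \<forall>q\<in>?I. (t (fst p) (snd p) = t (fst q) (snd q)) = (c (fst p) (snd p) = c (fst q) (snd q))}"
  proof (intro set_eqI iffI)
    fix t assume "t \<in> coincidence_set d n B c"
    then obtain \<tau> where \<tau>: "inj_on \<tau> (distinct_values d n c)" "t = relabel d n \<tau> c" "t \<in> space ?S"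
      by (auto simp: coincidence_set_def)
    have "(t j i = t j' i') = (c j i = c j' i')" if "(j, i) \<in> ?I" "(j', i') \<in> ?I" for j i j' i'
    proof -
      have "c j i \<in> distinct_values d n c" "c j' i' \<in> distinct_values d n c"
        using that by (auto simp: distinct_values_def)
      from inj_on_eq_iff[OF \<tau>(1) this] show ?thesis using that by (simp add: \<tau>(2) relabel_def)
    qed
    with \<tau>(3) show "t \<in> {t \<in> space ?S. \<forall>p\<in>?I. \<forall>q\<in>?I. (t (fst p) (snd p) = t (fst q) (snd q)) = (c (fst p) (snd p) = c (fst q) (snd q))}"
      by force
  next
    fix t assume t: "t \<in> {t \<in> space ?S. \<forall>p\<in>?I. \<forall>q\<in>?I. (t (fst p) (snd p) = t (fst q) (snd q)) = (c (fst p) (snd p) = c (fst q) (snd q))}"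
    then have t': "(t j i = t j' i') = (c j i = c j' i')" if "(j, i) \<in> ?I" "(j', i') \<in> ?I" for j i j' i'
      using that by force
    \<comment> \<open>Positions with equal labels carry equal values, so the selected position
      represents its whole class.\<close>
    have "pattern_atom d n c t (c j i) = t j i" if ji: "(j, i) \<in> ?I" for j i
    proof -
      have "c j i \<in> distinct_values d n c" using ji by (auto simp: distinct_values_def)
      then obtain j' i' where "(j', i') \<in> ?I" "c j' i' = c j i" "pattern_atom d n c t (c j i) = t j' i'"
        by (rule pattern_atomE)
      then show ?thesis using t' ji by metis
    qed
    then have "relabel d n (pattern_atom d n c t) c = relabel d n (\<lambda>k. k) t"
      by (auto simp: relabel_def fun_eq_iff)
    also have "\<dots> = t" using t by (intro relabel_ident) (auto simp: space_samples_space)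
    finally have "t = relabel d n (pattern_atom d n c t) c" ..
    moreover have "inj_on (pattern_atom d n c t) (distinct_values d n c)"
    proof (rule inj_onI)
      fix k l assume kl: "k \<in> distinct_values d n c" "l \<in> distinct_values d n c"
        "pattern_atom d n c t k = pattern_atom d n c t l"
      obtain j i where 1: "(j, i) \<in> ?I" "c j i = k" "pattern_atom d n c t k = t j i"
        using kl(1) by (rule pattern_atomE)
      obtain j' i' where 2: "(j', i') \<in> ?I" "c j' i' = l" "pattern_atom d n c t l = t j' i'"
        using kl(2) by (rule pattern_atomE)
      show "k = l" using t'[OF 1(1) 2(1)] 1 2 kl(3) by simp
    qed
    ultimately show "t \<in> coincidence_set d n B c" using t by (auto simp: coincidence_set_def)
  qed
  also have "\<dots> \<in> sets ?S"
  proof -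
    have P: "{t \<in> space ?S. (t (fst p) (snd p) = t (fst q) (snd q)) = b} \<in> sets ?S" if "p \<in> ?I" "q \<in> ?I" for p q b
      using eq[of "fst p" "snd p" "fst q" "snd q"] that by (cases b) (auto intro: sets.sets_Collect_neg)
    show ?thesis using P by (intro sets.sets_Collect_finite_All) auto
  qed
  finally show ?thesis .
qed

section \<open>The law of the number of non-allocated atoms\<close>

lemma pmf_pois1_0: "pmf (pois1_pmf l) 0 = 0"
  by (auto simp: pois1_pmf_def pmf_eq_0_set_pmf)

lemma pmf_pois1_Suc: "pmf (pois1_pmf l) (Suc x) = pmf (poisson_pmf l) x"
  unfolding pois1_pmf_def by (rule pmf_map_inj') auto

lemma pmf_q_star:
  assumes "l \<ge> 0"
  shows "pmf (q_star l k) x = (1 - real k / (l + real k)) * pmf (pois1_pmf l) x +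
    real k / (l + real k) * pmf (poisson_pmf l) x"
  unfolding q_star_def using assms by (intro pmf_mixture_pmf) (auto simp: divide_le_eq_1)

text \<open>In the shifted part \<open>l * l ^ (x - 1) / fact (x - 1)\<close> equals
  \<open>l ^ x * x / fact x\<close> for \<open>x > 0\<close>, so the two parts of the mixture
  combine into the single factor \<open>x + k\<close>.\<close>

lemma pmf_q_star_pos:
  assumes l: "l > 0"
  shows "pmf (q_star l k) x = exp (- l) * l ^ x * real (x + k) / fact x / (l + real k)"
proof -
  have lk: "l + real k > 0" using l by simp
  have "(1 - real k / (l + real k)) * pmf (pois1_pmf l) x = exp (- l) * l ^ x * real x / fact x / (l + real k)"
  proof (cases x)
    case (Suc y)
    have w: "1 - real k / (l + real k) = l / (l + real k)"
      using lk by (simp add: field_simps)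
    have f: "real (Suc y) / fact (Suc y) = (1 / fact y :: real)"
      unfolding fact_Suc by (simp del: of_nat_Suc)
    have "exp (- l) * l ^ x * real x / fact x / (l + real k) =
        exp (- l) * l ^ Suc y * (real (Suc y) / fact (Suc y)) / (l + real k)"
      unfolding Suc by (simp only: times_divide_eq_right)
    also have "\<dots> = l / (l + real k) * (l ^ y / fact y * exp (- l))"
      unfolding f by (simp add: mult_ac)
    finally have "exp (- l) * l ^ x * real x / fact x / (l + real k) = l / (l + real k) * (l ^ y / fact y * exp (- l))" .
    moreover have "(1 - real k / (l + real k)) * pmf (pois1_pmf l) x = l / (l + real k) * (l ^ y / fact y * exp (- l))"
      using l by (simp add: w Suc pmf_pois1_Suc)
    ultimately show ?thesis by (rule trans[OF _ sym, rotated])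
  qed (simp add: pmf_pois1_0)
  then show ?thesis
    using l by (simp add: pmf_q_star add_divide_distrib distrib_left distrib_right mult_ac)
qed

lemma measurable_pmf_q_star:
  assumes f[measurable]: "f \<in> borel_measurable L" and nonneg: "\<And>w. w \<in> space L \<Longrightarrow> f w \<ge> 0"
  shows "(\<lambda>w. pmf (q_star (f w) k) x) \<in> borel_measurable L"
proof -
  \<comment> \<open>The closed form is for positive parameters, and the parameter 0 contributes a
    constant. It does occur: \<open>psi\<close> vanishes at \<open>u = - 1\<close> and the kernel
    has to be measurable over all real \<open>u\<close>.\<close>
  have "(\<lambda>w. if f w = 0 then pmf (q_star 0 k) x
      else exp (- f w) * f w ^ x * real (x + k) / fact x / (f w + real k)) \<in> borel_measurable L"
    by measurable
  also have "?this \<longleftrightarrow> (\<lambda>w. pmf (q_star (f w) k) x) \<in> borel_measurable L"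
    using nonneg by (intro measurable_cong) (auto simp: pmf_q_star_pos less_le)
  finally show ?thesis .
qed

text \<open>
  The number of ways to choose the \<open>k\<close> allocated atoms turns the prior law of the number of
  atoms into \<^const>\<open>q_star\<close>.
\<close>

lemma pmf_pois1_choose:
  assumes "\<Lambda> > 0" "\<psi> > 0" "k \<ge> 1"
  shows "pmf (pois1_pmf \<Lambda>) (l + k) * real ((l + k) choose k) * \<psi> ^ l =
    \<Lambda> ^ (k - 1) * exp (- \<Lambda>) / fact k * (\<Lambda> * \<psi> + real k) * exp (\<Lambda> * \<psi>) * pmf (q_star (\<Lambda> * \<psi>) k) l"
proof -
  obtain k' where k: "k = Suc k'" using assms(3) by (cases k) auto
  have pos: "\<Lambda> * \<psi> > 0" using assms by simp
  then have ne: "\<Lambda> * \<psi> + real k \<noteq> 0" by (metis add_pos_nonneg less_irrefl of_nat_0_le_iff)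
  have "pmf (pois1_pmf \<Lambda>) (l + k) * real ((l + k) choose k) * \<psi> ^ l =
      \<Lambda> ^ (l + k') / fact (l + k') * exp (- \<Lambda>) * (fact (l + k) / (fact k * fact l)) * \<psi> ^ l"
  proof -
    have "real ((l + k) choose k) = fact (l + k) / (fact k * fact l)"
      by (simp add: binomial_fact)
    moreover have "pmf (pois1_pmf \<Lambda>) (l + k) = \<Lambda> ^ (l + k') / fact (l + k') * exp (- \<Lambda>)"
      using assms by (simp add: k pmf_pois1_Suc)
    ultimately show ?thesis by simp
  qed
  \<comment> \<open>The prior is shifted by one, so cancelling \<open>fact (l + k')\<close> leaves a
    factor \<open>l + k\<close>, the one found in \<open>pmf_q_star_pos\<close>.\<close>
  also have "fact (l + k) = (real (l + k) * fact (l + k') :: real)"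
    by (simp add: k)
  also have "\<Lambda> ^ (l + k') / fact (l + k') * exp (- \<Lambda>) * (real (l + k) * fact (l + k') / (fact k * fact l)) * \<psi> ^ l =
      \<Lambda> ^ k' * exp (- \<Lambda>) / fact k * ((\<Lambda> * \<psi>) ^ l * real (l + k) / fact l)"
    by (simp add: power_add power_mult_distrib del: fact_Suc of_nat_add)
  also have "(\<Lambda> * \<psi>) ^ l * real (l + k) / fact l =
     (\<Lambda> * \<psi> + real k) * exp (\<Lambda> * \<psi>) * pmf (q_star (\<Lambda> * \<psi>) k) l"
  proof -
    have e: "a * e * (e' * p * r / f / a) = (e * e') * (p * r / f)" if "a \<noteq> 0" for a e e' p r f :: real
      using that by simp
    show ?thesis
      unfolding pmf_q_star_pos[OF pos] e[OF ne] by (simp add: mult_exp_exp del: of_nat_add)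
  qed
  finally show ?thesis by (simp add: k mult.assoc)
qed

section \<open>Allocations by their range\<close>

text \<open>Allocations whose range has \<open>k\<close> elements, brought to the standard range
  \<open>{1..k}\<close>.\<close>

definition onto_allocations :: "nat \<Rightarrow> (nat \<Rightarrow> nat) \<Rightarrow> nat \<Rightarrow> (nat \<Rightarrow> nat \<Rightarrow> nat) set" where
  "onto_allocations d n k = {c \<in> allocations d n k. distinct_values d n c = {1..k}}"

lemma finite_onto_allocations: "finite (onto_allocations d n k)"
  by (simp add: onto_allocations_def finite_allocations)

lemma onto_allocations_empty:
  assumes "k > (\<Sum>j\<in>{1..d}. n j)"
  shows "onto_allocations d n k = {}"
proof -
  have "card (distinct_values d n c) \<noteq> k" for c :: "nat \<Rightarrow> nat \<Rightarrow> nat"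
    using card_distinct_values_le[of d n c] assms by simp
  then show ?thesis by (auto simp: onto_allocations_def) (metis card_atLeastAtMost diff_Suc_1 One_nat_def)
qed

lemma relabel_ident_allocations: "c \<in> allocations d n m \<Longrightarrow> relabel d n (\<lambda>k. k) c = c"
  unfolding allocations_def by (rule relabel_ident)

text \<open>Allocations with range \<open>R\<close> correspond to those onto
  \<open>{1..card R}\<close> by a renaming that preserves the summand, and \<open>m choose k\<close>
  ranges have size \<open>k\<close>. The number of missed labels is a separate argument of
  \<open>\<Psi>\<close> because the renaming changes \<open>m\<close> into \<open>k\<close> but
  leaves that number alone.\<close>

lemma sum_allocations:
  fixes \<Psi> :: "nat \<Rightarrow> (nat \<Rightarrow> nat \<Rightarrow> nat) \<Rightarrow> nat \<Rightarrow> ennreal"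
  assumes inv: "\<And>k c \<sigma> l. inj_on \<sigma> {1..k} \<Longrightarrow> \<sigma> ` {1..k} \<subseteq> {1..m} \<Longrightarrow> c \<in> onto_allocations d n k \<Longrightarrow>
    \<Psi> m (relabel d n \<sigma> c) l = \<Psi> k c l"
  shows "(\<Sum>c\<in>allocations d n m. \<Psi> m c (m - card (distinct_values d n c))) =
    (\<Sum>k\<in>{..(\<Sum>j\<in>{1..d}. n j)}. of_nat (m choose k) * (\<Sum>c\<in>onto_allocations d n k. \<Psi> k c (m - k)))"
proof -
  let ?N = "\<Sum>j\<in>{1..d}. n j"
  define F where "F k = (\<Sum>c\<in>onto_allocations d n k. \<Psi> k c (m - k))" for k
  have R: "(\<Sum>c\<in>{c \<in> allocations d n m. distinct_values d n c = R}. \<Psi> m c (m - card (distinct_values d n c))) = F (card R)"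
    if R: "R \<in> Pow {1..m}" for R
  proof -
    have "finite R" using R finite_subset by blast
    then obtain \<sigma> where \<sigma>: "bij_betw \<sigma> {1..card R} R" using ex_bij_betw_nat_finite_1 by blast
    let ?\<sigma>' = "the_inv_into {1..card R} \<sigma>"
    have inj: "inj_on \<sigma> {1..card R}" and im: "\<sigma> ` {1..card R} = R" using \<sigma> by (auto simp: bij_betw_def)
    show ?thesis unfolding F_def
    proof (rule sum.reindex_bij_witness[where i = "relabel d n \<sigma>" and j = "relabel d n ?\<sigma>'"])
      fix c assume "c \<in> {c \<in> allocations d n m. distinct_values d n c = R}"
      then have c: "c \<in> allocations d n m" "distinct_values d n c = R" by auto
      have "relabel d n \<sigma> (relabel d n ?\<sigma>' c) = relabel d n (\<lambda>k. k) c"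
        unfolding relabel_relabel using inj im c by (intro relabel_cong) (simp add: f_the_inv_into_f)
      also have "\<dots> = c" by (rule relabel_ident_allocations[OF c(1)])
      finally show r: "relabel d n \<sigma> (relabel d n ?\<sigma>' c) = c" .
      have "distinct_values d n (relabel d n ?\<sigma>' c) = {1..card R}"
        unfolding distinct_values_relabel c using the_inv_into_onto[OF inj] im by simp
      then show o: "relabel d n ?\<sigma>' c \<in> onto_allocations d n (card R)"
        by (simp add: onto_allocations_def distinct_values_allocations relabel_relabel)
      show "\<Psi> (card R) (relabel d n ?\<sigma>' c) (m - card R) = \<Psi> m c (m - card (distinct_values d n c))"
        using inv[OF inj _ o, of "m - card R"] im R by (simp add: r c)
    next
      fix c assume "c \<in> onto_allocations d n (card R)"
      then have c: "c \<in> allocations d n (card R)" "distinct_values d n c = {1..card R}"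
        by (auto simp: onto_allocations_def)
      have "relabel d n ?\<sigma>' (relabel d n \<sigma> c) = relabel d n (\<lambda>k. k) c"
        unfolding relabel_relabel using inj c by (intro relabel_cong) (simp add: the_inv_into_f_f)
      also have "\<dots> = c" by (rule relabel_ident_allocations[OF c(1)])
      finally show "relabel d n ?\<sigma>' (relabel d n \<sigma> c) = c" .
      show "relabel d n \<sigma> c \<in> {c \<in> allocations d n m. distinct_values d n c = R}"
        using R im by (simp add: distinct_values_allocations distinct_values_relabel c relabel_relabel)
    qed
  qed
  have "(\<Sum>c\<in>allocations d n m. \<Psi> m c (m - card (distinct_values d n c))) =
      (\<Sum>R\<in>Pow {1..m}. \<Sum>c\<in>{c \<in> allocations d n m. distinct_values d n c = R}. \<Psi> m c (m - card (distinct_values d n c)))"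
  proof -
    have "distinct_values d n ` allocations d n m \<subseteq> Pow {1..m}"
      using distinct_values_allocations by blast
    then show ?thesis by (intro sum.group[symmetric] finite_allocations) simp_all
  qed
  also have "\<dots> = (\<Sum>R\<in>Pow {1..m}. F (card R))"
    by (intro sum.cong refl R)
  also have "\<dots> = (\<Sum>k\<in>{..m}. \<Sum>R\<in>{R \<in> Pow {1..m}. card R = k}. F (card R))"
  proof -
    have "card R \<le> m" if "R \<subseteq> {1..m}" for R
      using card_mono[OF _ that] by simp
    then have "card ` Pow {1..m} \<subseteq> {..m}" by auto
    then show ?thesis by (intro sum.group[symmetric]) simp_all
  qed
  also have "\<dots> = (\<Sum>k\<in>{..m}. of_nat (m choose k) * F k)"
  proof (intro sum.cong refl)
    fix k
    have "(\<Sum>R\<in>{R \<in> Pow {1..m}. card R = k}. F (card R)) = (\<Sum>R\<in>{R. R \<subseteq> {1..m} \<and> card R = k}. F k)"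
      by (intro sum.cong) auto
    then show "(\<Sum>R\<in>{R \<in> Pow {1..m}. card R = k}. F (card R)) = of_nat (m choose k) * F k"
      by (simp add: n_subsets)
  qed
  \<comment> \<open>Binomials vanish for \<open>k > m\<close>, and no allocation is onto more labels
    than there are observations. The range of \<open>k\<close> is thereby freed from
    \<open>m\<close>, so that the series over \<open>m\<close> can later be exchanged with this
    sum.\<close>
  also have "\<dots> = (\<Sum>k\<in>{..m} \<union> {..?N}. of_nat (m choose k) * F k)"
    by (intro sum.mono_neutral_left) (auto simp: not_le)
  also have "\<dots> = (\<Sum>k\<in>{..?N}. of_nat (m choose k) * F k)"
    by (intro sum.mono_neutral_right) (auto simp: not_le F_def onto_allocations_empty)
  finally show ?thesis by (simp add: F_def)
qed

section \<open>Exponential tilting of the jumps\<close>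

text \<open>For positive \<open>a\<close> and \<open>u\<close>, the mean of
  \<open>S ^ r * exp (- u * S)\<close> when \<open>S\<close> is Gamma distributed with shape
  \<open>a\<close> and rate 1: the constant of \<open>density_gamma_law_tilt\<close> at
  \<open>b = 1\<close>.\<close>

definition tilt_const :: "real \<Rightarrow> nat \<Rightarrow> real \<Rightarrow> real" where
  "tilt_const a r u = Gamma (a + real r) / (Gamma a * (1 + u) powr (a + real r))"

lemma tilt_const_0: "a > 0 \<Longrightarrow> u > 0 \<Longrightarrow> tilt_const a 0 u = psi a u"
  using Gamma_real_pos[of a] by (simp add: tilt_const_def psi_def powr_minus_divide less_imp_neq[symmetric])

text \<open>The factor splits over the jumps, so conjugacy applies to each;
  \<open>PiM_density\<close> is used in both directions, for the inner and for the outer product.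
  Jumps with \<open>r j k = 0\<close> are tilted too, in the rate alone.\<close>

lemma nn_integral_gamma_PiM_tilt:
  fixes R :: "'k set"
  fixes d :: nat
  assumes R: "finite R" and \<gamma>: "\<And>j. j \<in> {1..d} \<Longrightarrow> \<gamma> j > 0" and u: "\<And>j. j \<in> {1..d} \<Longrightarrow> u j > 0"
    and f: "f \<in> borel_measurable (PiM {1..d} (\<lambda>j. PiM R (\<lambda>k. borel)))"
  shows "(\<integral>\<^sup>+S. f S * (\<Prod>j\<in>{1..d}. \<Prod>k\<in>R. ennreal (S j k ^ r j k * exp (- (u j * S j k))))
      \<partial>PiM {1..d} (\<lambda>j. PiM R (\<lambda>k. gamma_law (\<gamma> j) 1))) =
    (\<Prod>j\<in>{1..d}. \<Prod>k\<in>R. ennreal (tilt_const (\<gamma> j) (r j k) (u j))) *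
    (\<integral>\<^sup>+S. f S \<partial>PiM {1..d} (\<lambda>j. PiM R (\<lambda>k. gamma_law (real (r j k) + \<gamma> j) (u j + 1))))"
proof -
  let ?e = "\<lambda>j k x. ennreal (x ^ r j k * exp (- (u j * x)))"
  let ?C = "\<lambda>j k. ennreal (tilt_const (\<gamma> j) (r j k) (u j))"
  let ?g = "\<lambda>j k. gamma_law (\<gamma> j) 1" and ?h = "\<lambda>j k. gamma_law (real (r j k) + \<gamma> j) (u j + 1)"
  note sf = prob_space_imp_sigma_finite[OF prob_space_gamma_law] prob_space_imp_sigma_finite[OF prob_space_gamma_PiM]
  have fin_const: "finite_measure (density M (\<lambda>_. c))" if "prob_space M" "c < top" for c :: ennreal and M :: "'z measure"
    using that prob_space.emeasure_space_1[OF that(1)]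
    by (intro finite_measureI) (simp add: emeasure_density)
  have 1: "density (?g j k) (?e j k) = density (?h j k) (\<lambda>_. ?C j k)" if "j \<in> {1..d}" for j k
    using density_gamma_law_tilt[of "\<gamma> j" 1 "u j" "r j k"] \<gamma>[OF that] u[OF that]
    by (simp add: tilt_const_def add.commute)
  have sf1: "sigma_finite_measure (density (?h j k) (\<lambda>_. ?C j k))" for j k
    using fin_const[OF prob_space_gamma_law, of "?C j k"] by (simp add: finite_measure_def)
  have 2: "density (PiM R (?g j)) (\<lambda>x. \<Prod>k\<in>R. ?e j k (x k)) = density (PiM R (?h j)) (\<lambda>_. \<Prod>k\<in>R. ?C j k)"
    if "j \<in> {1..d}" for j
  proof -
    have "density (PiM R (?g j)) (\<lambda>x. \<Prod>k\<in>R. ?e j k (x k)) = PiM R (\<lambda>k. density (?g j k) (?e j k))"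
      using sf1 by (intro PiM_density[symmetric] R sf) (auto simp: 1[OF that])
    also have "\<dots> = density (PiM R (?h j)) (\<lambda>_. \<Prod>k\<in>R. ?C j k)"
      unfolding 1[OF that] using sf1 by (intro PiM_density R sf) auto
    finally show ?thesis .
  qed
  have sf2: "sigma_finite_measure (density (PiM R (?h j)) (\<lambda>_. \<Prod>k\<in>R. ?C j k))" for j
  proof -
    have "(\<Prod>k\<in>R. ?C j k) \<noteq> top" using R by (simp add: ennreal_prod_eq_top)
    then show ?thesis
      using fin_const[OF prob_space_gamma_PiM, of "\<Prod>k\<in>R. ?C j k" R "\<lambda>k. real (r j k) + \<gamma> j" "u j + 1"]
      by (simp add: finite_measure_def less_top)
  qed
  have meas: "(\<lambda>x. \<Prod>k\<in>R. ?e j k (x k)) \<in> borel_measurable (PiM R (?g j))" for j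
    by measurable
  have 3: "density (PiM {1..d} (\<lambda>j. PiM R (?g j))) (\<lambda>S. \<Prod>j\<in>{1..d}. \<Prod>k\<in>R. ?e j k (S j k)) =
      density (PiM {1..d} (\<lambda>j. PiM R (?h j))) (\<lambda>_. \<Prod>j\<in>{1..d}. \<Prod>k\<in>R. ?C j k)"
  proof -
    have "density (PiM {1..d} (\<lambda>j. PiM R (?g j))) (\<lambda>S. \<Prod>j\<in>{1..d}. \<Prod>k\<in>R. ?e j k (S j k)) =
        PiM {1..d} (\<lambda>j. density (PiM R (?g j)) (\<lambda>x. \<Prod>k\<in>R. ?e j k (x k)))"
      using sf2 by (intro PiM_density[symmetric] sf meas) (simp_all add: 2)
    also have "\<dots> = PiM {1..d} (\<lambda>j. density (PiM R (?h j)) (\<lambda>_. \<Prod>k\<in>R. ?C j k))"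
      by (intro PiM_cong refl 2)
    also have "\<dots> = density (PiM {1..d} (\<lambda>j. PiM R (?h j))) (\<lambda>_. \<Prod>j\<in>{1..d}. \<Prod>k\<in>R. ?C j k)"
      using sf2 by (intro PiM_density sf) auto
    finally show ?thesis .
  qed
  have fg: "f \<in> borel_measurable (PiM {1..d} (\<lambda>j. PiM R (?g j)))" "f \<in> borel_measurable (PiM {1..d} (\<lambda>j. PiM R (?h j)))"
    by (rule measurable_cong_sets[THEN equalityD2, THEN subsetD, OF _ refl f], intro sets_PiM_cong refl, simp)+
  have meas2: "(\<lambda>S. \<Prod>j\<in>{1..d}. \<Prod>k\<in>R. ?e j k (S j k)) \<in> borel_measurable (PiM {1..d} (\<lambda>j. PiM R (?g j)))"
  proof -
    have [measurable]: "(\<lambda>S. S j k) \<in> borel_measurable (PiM {1..d} (\<lambda>j. PiM R (?g j)))"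
      if "j \<in> {1..d}" "k \<in> R" for j k
      using measurable_nested_component[of j "{1..d}" k "\<lambda>_. R" ?g] that
      by (simp only: measurable_cong_sets[OF refl sets_gamma_law])
    show ?thesis by measurable
  qed
  have "(\<integral>\<^sup>+S. f S * (\<Prod>j\<in>{1..d}. \<Prod>k\<in>R. ?e j k (S j k)) \<partial>PiM {1..d} (\<lambda>j. PiM R (?g j))) =
      (\<integral>\<^sup>+S. f S \<partial>density (PiM {1..d} (\<lambda>j. PiM R (?g j))) (\<lambda>S. \<Prod>j\<in>{1..d}. \<Prod>k\<in>R. ?e j k (S j k)))"
    by (subst nn_integral_density[OF meas2 fg(1)]) (rule nn_integral_cong, rule mult.commute)
  also have "\<dots> = (\<Prod>j\<in>{1..d}. \<Prod>k\<in>R. ?C j k) * (\<integral>\<^sup>+S. f S \<partial>PiM {1..d} (\<lambda>j. PiM R (?h j)))"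
    unfolding 3 by (subst nn_integral_density[OF borel_measurable_const fg(2)]) (rule nn_integral_cmult[OF fg(2)])
  finally show ?thesis .
qed

text \<open>A label missed by \<open>c\<close> has multiplicity 0 in every group and contributes the
  Laplace transform \<open>psi\<close> of a jump. The resulting power is what rescales \<Lambda> to
  \<Lambda> times the product of the \<open>psi\<close>.\<close>

lemma prod_tilt_const:
  fixes d :: nat
  assumes c: "distinct_values d n c \<subseteq> {1..m}" and \<gamma>: "\<And>j. j \<in> {1..d} \<Longrightarrow> \<gamma> j > 0"
    and u: "\<And>j. j \<in> {1..d} \<Longrightarrow> u j > 0"
  shows "(\<Prod>j\<in>{1..d}. \<Prod>k\<in>{1..m}. ennreal (tilt_const (\<gamma> j) (multiplicity_of n c j k) (u j))) =
    ennreal (\<Prod>j\<in>{1..d}. psi (\<gamma> j) (u j)) ^ (m - card (distinct_values d n c)) *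
    (\<Prod>j\<in>{1..d}. \<Prod>k\<in>distinct_values d n c. ennreal (tilt_const (\<gamma> j) (multiplicity_of n c j k) (u j)))"
proof -
  let ?R = "distinct_values d n c"
  let ?t = "\<lambda>j k. ennreal (tilt_const (\<gamma> j) (multiplicity_of n c j k) (u j))"
  have "(\<Prod>k\<in>{1..m}. ?t j k) = ennreal (psi (\<gamma> j) (u j)) ^ (m - card ?R) * (\<Prod>k\<in>?R. ?t j k)" if j: "j \<in> {1..d}" for j
  proof -
    have "(\<Prod>k\<in>{1..m}. ?t j k) = (\<Prod>k\<in>{1..m} - ?R. ?t j k) * (\<Prod>k\<in>?R. ?t j k)"
      using c by (intro prod.subset_diff) auto
    also have "(\<Prod>k\<in>{1..m} - ?R. ?t j k) = (\<Prod>k\<in>{1..m} - ?R. ennreal (psi (\<gamma> j) (u j)))"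
      using j \<gamma> u by (intro prod.cong refl) (simp add: multiplicity_of_eq_0[of _ d] tilt_const_0)
    also have "\<dots> = ennreal (psi (\<gamma> j) (u j)) ^ (m - card ?R)"
      using c by (simp add: card_Diff_subset)
    finally show ?thesis .
  qed
  then have "(\<Prod>j\<in>{1..d}. \<Prod>k\<in>{1..m}. ?t j k) =
     (\<Prod>j\<in>{1..d}. ennreal (psi (\<gamma> j) (u j))) ^ (m - card ?R) * (\<Prod>j\<in>{1..d}. \<Prod>k\<in>?R. ?t j k)"
    by (simp add: prod.distrib prod_power_distrib)
  also have "(\<Prod>j\<in>{1..d}. ennreal (psi (\<gamma> j) (u j))) = ennreal (\<Prod>j\<in>{1..d}. psi (\<gamma> j) (u j))"
    by (rule prod_ennreal) (simp add: psi_def)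
  finally show ?thesis .
qed

section \<open>Changing spaces and kernels in a conditional law\<close>

lemma has_cond_law_cong_sets:
  assumes "sets X = sets X'" "sets Y = sets Y'"
  shows "has_cond_law \<Omega> X x Y y \<kappa> \<longleftrightarrow> has_cond_law \<Omega> X' x Y' y \<kappa>"
  using measurable_cong_sets[OF refl assms(1), of \<Omega>] measurable_cong_sets[OF refl assms(2), of \<Omega>]
    subprob_algebra_cong[OF assms(1)] measurable_cong_sets[OF assms(2) refl, of "subprob_algebra X'"]
    distr_cong[OF refl assms(2), of \<Omega> y y] assms
  by (simp add: has_cond_law_def)

lemma has_cond_law_cong_kernel:
  assumes "\<And>z. z \<in> space Y \<Longrightarrow> \<kappa> z = \<kappa>' z"
  shows "has_cond_law \<Omega> X x Y y \<kappa> \<longleftrightarrow> has_cond_law \<Omega> X x Y y \<kappa>'"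
proof -
  have "(\<integral>\<^sup>+z\<in>D. emeasure (\<kappa> z) A \<partial>distr \<Omega> Y y) = (\<integral>\<^sup>+z\<in>D. emeasure (\<kappa>' z) A \<partial>distr \<Omega> Y y)" for D A
    using assms by (intro nn_integral_cong) simp
  then show ?thesis
    using measurable_cong[of Y \<kappa> \<kappa>' "subprob_algebra X"] assms by (simp add: has_cond_law_def)
qed

section \<open>The likelihood of an allocation\<close>

text \<open>
  The factors of the density of \<open>U\<close> given \<open>\<mu>\<close> that do not involve \<open>T\<^sub>j\<close>; the factor
  \<open>T\<^sub>j\<close> to the power \<open>n\<^sub>j\<close> cancels and the exponential one goes to \<open>jump_likelihood\<close>.
\<close>

definition aux_density :: "nat \<Rightarrow> (nat \<Rightarrow> nat) \<Rightarrow> (nat \<Rightarrow> real) \<Rightarrow> ennreal" where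
  "aux_density d n u = (\<Prod>j\<in>{1..d}. ennreal (if u j > 0 then u j powr (real (n j) - 1) / Gamma (real (n j)) else 0))"

definition jump_likelihood :: "nat \<Rightarrow> (nat \<Rightarrow> nat) \<Rightarrow> nat \<Rightarrow> (nat \<Rightarrow> nat \<Rightarrow> nat) \<Rightarrow> (nat \<Rightarrow> real) \<Rightarrow> (nat \<Rightarrow> nat \<Rightarrow> real) \<Rightarrow> ennreal" where
  "jump_likelihood d n m c u S =
     (\<Prod>j\<in>{1..d}. \<Prod>k\<in>{1..m}. ennreal (S j k ^ multiplicity_of n c j k * exp (- (u j * S j k))))"

lemma measurable_aux_density[measurable]: "aux_density d n \<in> borel_measurable (PiM {1..d} (\<lambda>_. lborel))"
  unfolding aux_density_def by measurable

text \<open>Confines the later identities to positive \<open>u\<close>, where tilting and the closed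
  form of \<open>q_star\<close> apply.\<close>

lemma aux_density_nonzeroD:
  assumes "aux_density d n u \<noteq> 0" "j \<in> {1..d}"
  shows "u j > 0"
proof (rule ccontr)
  assume "\<not> u j > 0"
  then have "aux_density d n u = 0"
    unfolding aux_density_def using assms(2) by (intro prod_zero) (auto intro!: bexI[of _ j])
  with assms(1) show False by simp
qed

lemma measurable_jump_likelihood[measurable]:
  assumes S: "\<And>j k. j \<in> {1..d} \<Longrightarrow> k \<in> {1..m} \<Longrightarrow> (\<lambda>w. S w j k) \<in> borel_measurable L"
    and u: "\<And>j. j \<in> {1..d} \<Longrightarrow> (\<lambda>w. u w j) \<in> borel_measurable L"
  shows "(\<lambda>w. jump_likelihood d n m c (u w) (S w)) \<in> borel_measurable L"
proof -
  note S[measurable] u[measurable]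
  show ?thesis unfolding jump_likelihood_def by measurable
qed

lemma prod_multiplicity_of:
  fixes f :: "nat \<Rightarrow> real"
  assumes "\<And>i. i \<in> {1..n j} \<Longrightarrow> c j i \<in> {1..m}"
  shows "(\<Prod>i\<in>{1..n j}. f (c j i)) = (\<Prod>k\<in>{1..m}. f k ^ multiplicity_of n c j k)"
proof -
  have "(\<Prod>i\<in>{1..n j}. f (c j i)) = (\<Prod>k\<in>{1..m}. \<Prod>i\<in>{i \<in> {1..n j}. c j i = k}. f (c j i))"
    using assms by (intro prod.group[symmetric]) auto
  also have "\<dots> = (\<Prod>k\<in>{1..m}. \<Prod>i\<in>{i \<in> {1..n j}. c j i = k}. f k)"
    by (intro prod.cong) auto
  finally show ?thesis by (simp add: multiplicity_of_def)
qed

text \<open>The power \<open>T ^ n j\<close> in the density of rate \<open>T\<close> cancels the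
  denominators of the drawn probabilities. Since \<open>T\<close> is the sum of the jumps, the
  exponential splits over the atoms as well, and the allocation enters through its multiplicities
  only.\<close>

lemma gamma_density_likelihood:
  fixes s :: "nat \<Rightarrow> real"
  assumes s: "\<And>k. k \<in> {1..m} \<Longrightarrow> s k > 0" and c: "\<And>i. i \<in> {1..n j} \<Longrightarrow> c j i \<in> {1..m}"
    and m: "m \<ge> 1" and T: "T = (\<Sum>k\<in>{1..m}. s k)" and n: "n j \<ge> 1"
  shows "ennreal (gamma_density (real (n j)) T v) * (\<Prod>i\<in>{1..n j}. ennreal (s (c j i) / T)) =
    ennreal (if v > 0 then v powr (real (n j) - 1) / Gamma (real (n j)) else 0) *
    (\<Prod>k\<in>{1..m}. ennreal (s k ^ multiplicity_of n c j k * exp (- (v * s k))))"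
proof -
  have T0: "T > 0" unfolding T using m s by (intro sum_pos) auto
  have G: "Gamma (real (n j)) > 0" using n by (intro Gamma_real_pos) simp
  have "(\<Prod>i\<in>{1..n j}. ennreal (s (c j i) / T)) = ennreal (\<Prod>i\<in>{1..n j}. s (c j i) / T)"
    using c s T0 by (intro prod_ennreal) (simp add: less_imp_le)
  also have "(\<Prod>i\<in>{1..n j}. s (c j i) / T) = (\<Prod>k\<in>{1..m}. s k ^ multiplicity_of n c j k) / T ^ n j"
    using prod_multiplicity_of[of n j c m s] c by (simp add: prod_dividef)
  finally have 1: "(\<Prod>i\<in>{1..n j}. ennreal (s (c j i) / T)) =
      ennreal ((\<Prod>k\<in>{1..m}. s k ^ multiplicity_of n c j k) / T ^ n j)" .
  have "(\<Prod>k\<in>{1..m}. ennreal (s k ^ multiplicity_of n c j k * exp (- (v * s k)))) =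
      ennreal (\<Prod>k\<in>{1..m}. s k ^ multiplicity_of n c j k * exp (- (v * s k)))"
    using s by (intro prod_ennreal) (simp add: less_imp_le)
  also have "(\<Prod>k\<in>{1..m}. s k ^ multiplicity_of n c j k * exp (- (v * s k))) =
      (\<Prod>k\<in>{1..m}. s k ^ multiplicity_of n c j k) * exp (- (T * v))"
    by (simp add: prod.distrib exp_sum[symmetric] T sum_distrib_left sum_negf mult.commute)
  finally have 2: "(\<Prod>k\<in>{1..m}. ennreal (s k ^ multiplicity_of n c j k * exp (- (v * s k)))) =
      ennreal ((\<Prod>k\<in>{1..m}. s k ^ multiplicity_of n c j k) * exp (- (T * v)))" .
  have P: "(\<Prod>k\<in>{1..m}. s k ^ multiplicity_of n c j k) \<ge> 0"
    using s by (intro prod_nonneg) (simp add: less_imp_le)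
  show ?thesis
  proof (cases "v > 0")
    case True
    have "T powr real (n j) = T ^ n j" using T0 by (rule powr_realpow)
    then show ?thesis
      unfolding 1 2 using True T0 G P
      by (subst (1 2) ennreal_mult[symmetric]) (auto simp: gamma_density_def)
  qed (simp add: gamma_density_def)
qed

text \<open>A draw from \<open>normalize_measure (V j)\<close> amounts to choosing label
  \<open>k\<close> with probability \<open>S j k / T j\<close>, even when locations coincide.
  Positive jumps make every total \<open>T j\<close> positive, so that normalizations and rates are
  genuine.\<close>

lemma emeasure_sample_kernel:
  assumes n: "\<And>j. j \<in> {1..d} \<Longrightarrow> n j \<ge> 1" and m: "m \<ge> 1"
    and \<tau>: "\<And>k. k \<in> {1..m} \<Longrightarrow> \<tau> k \<in> space B"
    and S: "\<And>j k. j \<in> {1..d} \<Longrightarrow> k \<in> {1..m} \<Longrightarrow> S j k > 0"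
    and V: "\<And>j. j \<in> {1..d} \<Longrightarrow> V j = atomic_measure B {1..m} (S j) \<tau>"
    and D: "D \<in> sets (samples_space d n B \<Otimes>\<^sub>M PiM {1..d} (\<lambda>_. borel))"
  shows "emeasure (PiM {1..d} (\<lambda>j. PiM {1..n j} (\<lambda>_. normalize_measure (V j))) \<Otimes>\<^sub>M
      PiM {1..d} (\<lambda>j. gamma_law (real (n j)) (measure (V j) (space (V j))))) D =
    (\<Sum>c\<in>allocations d n m. \<integral>\<^sup>+u. aux_density d n u * indicator D (relabel d n \<tau> c, u) *
      jump_likelihood d n m c u S \<partial>PiM {1..d} (\<lambda>_. lborel))"
proof -
  define T where "T j = (\<Sum>k\<in>{1..m}. S j k)" for j
  have T0: "T j > 0" if "j \<in> {1..d}" for j unfolding T_def using m S that by (intro sum_pos) auto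
  have VT: "emeasure (V j) (space (V j)) = ennreal (T j)" if "j \<in> {1..d}" for j
  proof -
    have "emeasure (V j) (space (V j)) = (\<Sum>k\<in>{1..m}. ennreal (S j k) * indicator (space B) (\<tau> k))"
      by (simp add: V[OF that] emeasure_atomic_measure)
    also have "\<dots> = (\<Sum>k\<in>{1..m}. ennreal (S j k))" using \<tau> by (intro sum.cong) auto
    also have "\<dots> = ennreal (T j)" unfolding T_def using S that by (intro sum_ennreal) (auto simp: less_imp_le)
    finally show ?thesis .
  qed
  have VT': "measure (V j) (space (V j)) = T j" if "j \<in> {1..d}" for j
    using VT[OF that] T0[OF that] by (simp add: measure_def)
  have N: "emeasure (normalize_measure (V j)) E = (\<Sum>k\<in>{1..m}. ennreal (S j k / T j) * indicator E (\<tau> k))"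
    if j: "j \<in> {1..d}" and E: "E \<in> sets B" for j E
  proof -
    have "emeasure (normalize_measure (V j)) E = inverse (ennreal (T j)) * (\<Sum>k\<in>{1..m}. ennreal (S j k) * indicator E (\<tau> k))"
      using E by (simp add: normalize_measure_def VT[OF j]) (simp add: V[OF j] emeasure_atomic_measure)
    also have "\<dots> = (\<Sum>k\<in>{1..m}. ennreal (S j k / T j) * indicator E (\<tau> k))"
      using T0[OF j] S[OF j] unfolding sum_distrib_left
      by (intro sum.cong refl)
         (simp add: inverse_ennreal mult.assoc[symmetric] ennreal_mult[symmetric] less_imp_le divide_inverse mult.commute)
    finally show ?thesis .
  qed
  have sets_N: "sets (normalize_measure (V j)) = sets B" if "j \<in> {1..d}" for j
    using that by (simp add: normalize_measure_def V)
  have fin_N: "emeasure (normalize_measure (V j)) (space (normalize_measure (V j))) < top" if "j \<in> {1..d}" for j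
    using N[OF that sets.top] sets_eq_imp_space_eq[OF sets_N[OF that]]
    by (simp add: ennreal_mult_less_top indicator_def)
  have sf_N: "sigma_finite_measure (normalize_measure (V j))" if "j \<in> {1..d}" for j
    using finite_measureI[of "normalize_measure (V j)"] fin_N[OF that] by (simp add: finite_measure_def)
  let ?N = "\<lambda>j. PiM {1..n j} (\<lambda>_. normalize_measure (V j))"
  \<comment> \<open>Draws within group \<open>j\<close>: the choice functions send sample positions
    to labels. The same expansion over the groups, in \<open>K1\<close>, turns them into
    allocations.\<close>
  have K1j: "emeasure (?N j) E = (\<Sum>x\<in>PiE {1..n j} (\<lambda>_. {1..m}). (\<Prod>i\<in>{1..n j}. ennreal (S j (x i) / T j)) * indicator E (\<lambda>i\<in>{1..n j}. \<tau> (x i)))"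
    if j: "j \<in> {1..d}" and E: "E \<in> sets (PiM {1..n j} (\<lambda>_. B))" for j E
    using sets_N[OF j] \<tau> N[OF j] E by (intro emeasure_PiM_discrete) auto
  have K1: "emeasure (PiM {1..d} ?N) E =
      (\<Sum>c\<in>allocations d n m. (\<Prod>j\<in>{1..d}. \<Prod>i\<in>{1..n j}. ennreal (S j (c j i) / T j)) * indicator E (relabel d n \<tau> c))"
    if E: "E \<in> sets (samples_space d n B)" for E
    unfolding allocations_def relabel_def
  proof (rule emeasure_PiM_discrete[where M = "\<lambda>j. PiM {1..n j} (\<lambda>_. B)"])
    show "finite (\<Pi>\<^sub>E i\<in>{1..n j}. {1..m})" for j by (intro finite_PiE) auto
    show "(\<Prod>i\<in>{1..n j}. ennreal (S j (x i) / T j)) < top" for j and x :: "nat \<Rightarrow> nat"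
      by (simp add: less_top[symmetric] ennreal_prod_eq_top)
    show "(\<lambda>i\<in>{1..n j}. \<tau> (x i)) \<in> space (PiM {1..n j} (\<lambda>_. B))" if "x \<in> (\<Pi>\<^sub>E i\<in>{1..n j}. {1..m})" for j x
      using that \<tau> by (auto simp: space_PiM PiE_iff)
    show "sets (?N j) = sets (PiM {1..n j} (\<lambda>_. B))" if "j \<in> {1..d}" for j
      using sets_N[OF that] by (intro sets_PiM_cong) auto
  qed (use K1j E in \<open>auto simp: restrict_def\<close>)
  let ?G = "PiM {1..d} (\<lambda>j. gamma_law (real (n j)) (measure (V j) (space (V j))))"
  have G: "?G = density (PiM {1..d} (\<lambda>_. lborel)) (\<lambda>u. \<Prod>j\<in>{1..d}. ennreal (gamma_density (real (n j)) (T j) (u j)))"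
  proof -
    have g: "gamma_law (real (n j)) (T j) = density lborel (\<lambda>x. ennreal (gamma_density (real (n j)) (T j) x))"
      if "j \<in> {1..d}" for j using n[OF that] T0[OF that] by (simp add: gamma_law_def)
    have "?G = PiM {1..d} (\<lambda>j. density lborel (\<lambda>x. ennreal (gamma_density (real (n j)) (T j) x)))"
      using g by (intro PiM_cong refl) (simp add: VT')
    also have "\<dots> = density (PiM {1..d} (\<lambda>_. lborel)) (\<lambda>u. \<Prod>j\<in>{1..d}. ennreal (gamma_density (real (n j)) (T j) (u j)))"
    proof (rule PiM_density)
      show "sigma_finite_measure (density lborel (\<lambda>x. ennreal (gamma_density (real (n j)) (T j) x)))" if "j \<in> {1..d}" for j
        unfolding g[OF that, symmetric] by (intro prob_space_imp_sigma_finite prob_space_gamma_law)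
    qed (auto intro: lborel.sigma_finite_measure_axioms)
    finally show ?thesis .
  qed
  interpret K1: sigma_finite_measure "PiM {1..d} ?N"
    using sf_N by (intro sigma_finite_PiM) auto
  interpret G: prob_space ?G by (intro prob_space_PiM prob_space_gamma_law)
  interpret P: pair_sigma_finite "PiM {1..d} ?N" ?G ..
  have sets_K1: "sets (PiM {1..d} ?N) = sets (samples_space d n B)"
    using sets_N by (intro sets_PiM_cong) auto
  have sets_G: "sets ?G = sets (PiM {1..d} (\<lambda>_. borel))"
    by (intro sets_PiM_cong) auto
  have D': "D \<in> sets (PiM {1..d} ?N \<Otimes>\<^sub>M ?G)"
    using D sets_pair_measure_cong[OF sets_K1 sets_G] by simp
  have sets_L: "sets (PiM {1..d} (\<lambda>_. lborel :: real measure)) = sets (PiM {1..d} (\<lambda>_. borel))"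
    by (intro sets_PiM_cong) auto
  have rel: "relabel d n \<tau> c \<in> space (samples_space d n B)" if "c \<in> allocations d n m" for c
    using \<tau> that by (auto simp: relabel_def space_PiM allocations_def PiE_iff)
  have ind: "(\<lambda>u. indicator D (relabel d n \<tau> c, u) :: ennreal) \<in> borel_measurable (PiM {1..d} (\<lambda>_. lborel))"
    if "c \<in> allocations d n m" for c
    using measurable_compose[OF measurable_Pair1'[OF rel[OF that]] borel_measurable_indicator[OF D]]
    unfolding measurable_cong_sets[OF sets_L refl] .
  have jl: "(\<lambda>u. jump_likelihood d n m c u S) \<in> borel_measurable (PiM {1..d} (\<lambda>_. lborel))" for c
    by measurable
  have "emeasure (PiM {1..d} ?N \<Otimes>\<^sub>M ?G) D = (\<integral>\<^sup>+u. emeasure (PiM {1..d} ?N) ((\<lambda>t. (t, u)) -` D) \<partial>?G)"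
    by (rule P.emeasure_pair_measure_alt2[OF D'])
  also have "\<dots> = (\<integral>\<^sup>+u. (\<Sum>c\<in>allocations d n m. (\<Prod>j\<in>{1..d}. \<Prod>i\<in>{1..n j}. ennreal (S j (c j i) / T j)) * indicator D (relabel d n \<tau> c, u)) \<partial>?G)"
  proof (intro nn_integral_cong)
    fix u
    have "(\<lambda>t. (t, u)) -` D \<in> sets (samples_space d n B)" using sets_Pair2[OF D] .
    from K1[OF this] show "emeasure (PiM {1..d} ?N) ((\<lambda>t. (t, u)) -` D) =
        (\<Sum>c\<in>allocations d n m. (\<Prod>j\<in>{1..d}. \<Prod>i\<in>{1..n j}. ennreal (S j (c j i) / T j)) * indicator D (relabel d n \<tau> c, u))"
      by (simp add: indicator_def)
  qed
  also have "\<dots> = (\<integral>\<^sup>+u. (\<Prod>j\<in>{1..d}. ennreal (gamma_density (real (n j)) (T j) (u j))) *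
      (\<Sum>c\<in>allocations d n m. (\<Prod>j\<in>{1..d}. \<Prod>i\<in>{1..n j}. ennreal (S j (c j i) / T j)) * indicator D (relabel d n \<tau> c, u)) \<partial>PiM {1..d} (\<lambda>_. lborel))"
    unfolding G
  proof (rule nn_integral_density)
    show "(\<lambda>u. \<Sum>c\<in>allocations d n m. (\<Prod>j\<in>{1..d}. \<Prod>i\<in>{1..n j}. ennreal (S j (c j i) / T j)) *
        indicator D (relabel d n \<tau> c, u)) \<in> borel_measurable (PiM {1..d} (\<lambda>_. lborel))"
      using ind by (intro borel_measurable_sum borel_measurable_times_ennreal borel_measurable_const)
  qed measurable
  also have "\<dots> = (\<integral>\<^sup>+u. (\<Sum>c\<in>allocations d n m. aux_density d n u * indicator D (relabel d n \<tau> c, u) *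
      jump_likelihood d n m c u S) \<partial>PiM {1..d} (\<lambda>_. lborel))"
  proof (intro nn_integral_cong)
    fix u :: "nat \<Rightarrow> real"
    have "(\<Prod>j\<in>{1..d}. ennreal (gamma_density (real (n j)) (T j) (u j))) * (\<Prod>j\<in>{1..d}. \<Prod>i\<in>{1..n j}. ennreal (S j (c j i) / T j)) =
        aux_density d n u * jump_likelihood d n m c u S" if c: "c \<in> allocations d n m" for c
      unfolding aux_density_def jump_likelihood_def prod.distrib[symmetric]
      using c n S m by (intro prod.cong refl gamma_density_likelihood) (auto simp: T_def allocations_def PiE_iff)
    then show "(\<Prod>j\<in>{1..d}. ennreal (gamma_density (real (n j)) (T j) (u j))) *
      (\<Sum>c\<in>allocations d n m. (\<Prod>j\<in>{1..d}. \<Prod>i\<in>{1..n j}. ennreal (S j (c j i) / T j)) * indicator D (relabel d n \<tau> c, u)) =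
      (\<Sum>c\<in>allocations d n m. aux_density d n u * indicator D (relabel d n \<tau> c, u) * jump_likelihood d n m c u S)"
      unfolding sum_distrib_left by (intro sum.cong refl) (simp add: mult.assoc[symmetric], simp add: mult_ac)
  qed
  also have "\<dots> = (\<Sum>c\<in>allocations d n m. \<integral>\<^sup>+u. aux_density d n u * indicator D (relabel d n \<tau> c, u) *
      jump_likelihood d n m c u S \<partial>PiM {1..d} (\<lambda>_. lborel))"
    using ind jl by (intro nn_integral_sum borel_measurable_times_ennreal measurable_aux_density)
  finally show ?thesis .
qed

section \<open>Posterior law\<close>

text \<open>The Euclidean state space enters through two properties: a measurable diagonal makes
  coincidences of observations events, and diffuseness makes coincidences of distinct atoms
  null.\<close>

locale vec_fdp_model = prob_space P0
  for P0 :: "'a measure" +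
  fixes d :: nat and \<Lambda> :: real and \<gamma> :: "nat \<Rightarrow> real" and n :: "nat \<Rightarrow> nat"
  assumes d: "d \<ge> 1" and \<Lambda>: "\<Lambda> > 0" and \<gamma>: "\<And>j. j \<in> {1..d} \<Longrightarrow> \<gamma> j > 0"
    and n: "\<And>j. j \<in> {1..d} \<Longrightarrow> n j \<ge> 1"
    and diffuse: "\<And>x. x \<in> space P0 \<Longrightarrow> emeasure P0 {x} = 0"
    and diagonal: "{z \<in> space (P0 \<Otimes>\<^sub>M P0). fst z = snd z} \<in> sets (P0 \<Otimes>\<^sub>M P0)"
begin

abbreviation "MV \<equiv> measure_vectors d P0"
abbreviation "SS \<equiv> samples_space d n P0"
abbreviation "UU \<equiv> PiM {1..d} (\<lambda>_. lborel :: real measure)"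
abbreviation "P0s m \<equiv> PiM {1..m::nat} (\<lambda>_. P0)"

definition psis :: "(nat \<Rightarrow> real) \<Rightarrow> real" where
  "psis u = (\<Prod>j\<in>{1..d}. psi (\<gamma> j) (u j))"

text \<open>The atoms are labelled by the distinct values themselves, located by the identity, so no
  enumeration has to be chosen measurably in \<open>t\<close>.\<close>

definition posterior :: "(nat \<Rightarrow> nat \<Rightarrow> 'a) \<Rightarrow> (nat \<Rightarrow> real) \<Rightarrow> (nat \<Rightarrow> 'a measure) measure" where
  "posterior t u = add_law P0 d (allocated_law P0 d n \<gamma> t (\<lambda>x. x) u)
     (random_atoms_law (q_star (\<Lambda> * psis u) (card (distinct_values d n t))) d P0 \<gamma> (\<lambda>j. u j + 1))"

section \<open>The posterior as a measurable kernel\<close>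

lemma P0_axiom: "prob_space P0"
  by (rule prob_space_axioms)

lemma psis_nonneg: "psis u \<ge> 0"
  by (simp add: psis_def psi_def prod_nonneg)

lemma psis_pos:
  assumes "\<And>j. j \<in> {1..d} \<Longrightarrow> u j > 0"
  shows "psis u > 0"
  unfolding psis_def psi_def
proof (intro prod_pos)
  fix j assume "j \<in> {1..d}"
  then have "u j > 0" by (rule assms)
  then show "0 < (1 + u j) powr - \<gamma> j" by simp
qed

lemma measurable_psis:
  assumes u: "\<And>j. j \<in> {1..d} \<Longrightarrow> (\<lambda>w. u w j) \<in> borel_measurable L"
  shows "(\<lambda>w. psis (u w)) \<in> borel_measurable L"
proof -
  note u[measurable]
  show ?thesis unfolding psis_def psi_def by measurable
qed

text \<open>Trades the index set that varies with the sample for the fixed range of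
  \<open>c\<close>; measurability and the summation over atoms both rely on this form.\<close>

lemma posterior_relabel:
  assumes "inj_on \<tau> (distinct_values d n c)" "\<And>k. k \<in> distinct_values d n c \<Longrightarrow> \<tau> k \<in> space P0"
  shows "posterior (relabel d n \<tau> c) u = add_law P0 d (allocated_law P0 d n \<gamma> c \<tau> u)
     (random_atoms_law (q_star (\<Lambda> * psis u) (card (distinct_values d n c))) d P0 \<gamma> (\<lambda>j. u j + 1))"
  using assms allocated_law_relabel[OF assms(1), of "\<lambda>k. k" P0 \<gamma> u]
  by (simp add: posterior_def distinct_values_relabel card_image)

lemma measurable_random_part:
  assumes u: "\<And>j. j \<in> {1..d} \<Longrightarrow> (\<lambda>w. u w j) \<in> borel_measurable L"
  shows "(\<lambda>w. random_atoms_law (q_star (\<Lambda> * psis (u w)) k) d P0 \<gamma> (\<lambda>j. u w j + 1)) \<in> L \<rightarrow>\<^sub>M prob_algebra MV"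
proof -
  note u[measurable] measurable_psis[OF u, measurable]
  show ?thesis
    using \<Lambda> psis_nonneg by (intro measurable_random_atoms_law P0_axiom measurable_pmf_q_star) auto
qed

lemma measurable_posterior_pattern:
  assumes \<tau>: "\<And>k. k \<in> distinct_values d n c \<Longrightarrow> (\<lambda>w. \<tau> w k) \<in> L \<rightarrow>\<^sub>M P0"
    and u: "\<And>j. j \<in> {1..d} \<Longrightarrow> (\<lambda>w. u w j) \<in> borel_measurable L"
  shows "(\<lambda>w. add_law P0 d (allocated_law P0 d n \<gamma> c (\<tau> w) (u w))
     (random_atoms_law (q_star (\<Lambda> * psis (u w)) k) d P0 \<gamma> (\<lambda>j. u w j + 1))) \<in> L \<rightarrow>\<^sub>M prob_algebra MV"
  by (intro measurable_add_law measurable_allocated_law \<tau> u measurable_random_part)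

text \<open>The index set varies with \<open>t\<close>, so measurability is checked on each
  coincidence set: there the atoms are read at fixed sample positions and the index set is that of
  the pattern.\<close>

lemma measurable_posterior:
  "(\<lambda>(t, u). posterior t u) \<in> SS \<Otimes>\<^sub>M PiM {1..d} (\<lambda>_. borel) \<rightarrow>\<^sub>M prob_algebra MV" (is "_ \<in> ?Y \<rightarrow>\<^sub>M _")
proof (rule measurable_piecewise_restrict[of "(\<lambda>c. coincidence_set d n P0 c \<times> space (PiM {1..d} (\<lambda>_. borel :: real measure))) ` allocations d n (\<Sum>j\<in>{1..d}. n j)"])
  let ?U = "PiM {1..d} (\<lambda>_. borel :: real measure)"
  let ?C = "\<lambda>c. coincidence_set d n P0 c \<times> space ?U"
  show "countable (?C ` allocations d n (\<Sum>j\<in>{1..d}. n j))"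
    using finite_allocations by (intro countable_finite) simp
  show "space ?Y \<subseteq> \<Union> (?C ` allocations d n (\<Sum>j\<in>{1..d}. n j))"
    using ex_coincidence_set[of _ d n P0] by (fastforce simp: space_pair_measure)
  fix E assume "E \<in> ?C ` allocations d n (\<Sum>j\<in>{1..d}. n j)"
  then obtain c where E: "E = ?C c" by auto
  have "?C c \<in> sets ?Y"
    by (intro pair_measureI sets_coincidence_set diagonal sets.top)
  then show "E \<inter> space ?Y \<in> sets ?Y" unfolding E by (rule sets.Int) simp
  let ?g = "\<lambda>w. add_law P0 d (allocated_law P0 d n \<gamma> c (pattern_atom d n c (fst w)) (snd w))
     (random_atoms_law (q_star (\<Lambda> * psis (snd w)) (card (distinct_values d n c))) d P0 \<gamma> (\<lambda>j. snd w j + 1))"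
  have "?g \<in> ?Y \<rightarrow>\<^sub>M prob_algebra MV"
    by (intro measurable_posterior_pattern measurable_compose[OF measurable_fst measurable_pattern_atom]
        measurable_compose[OF measurable_snd measurable_component_singleton])
  then have "?g \<in> restrict_space ?Y E \<rightarrow>\<^sub>M prob_algebra MV"
    by (rule measurable_restrict_space1)
  also have "?this \<longleftrightarrow> (\<lambda>(t, u). posterior t u) \<in> restrict_space ?Y E \<rightarrow>\<^sub>M prob_algebra MV"
  proof (rule measurable_cong)
    fix w assume "w \<in> space (restrict_space ?Y E)"
    then have w: "fst w \<in> coincidence_set d n P0 c" by (auto simp: space_restrict_space E)
    have "posterior (relabel d n (pattern_atom d n c (fst w)) c) (snd w) = ?g w"
      by (intro posterior_relabel coincidence_setD[OF w])
    also have "relabel d n (pattern_atom d n c (fst w)) c = fst w"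
      by (rule coincidence_setD(2)[OF w, symmetric])
    finally show "?g w = (case w of (t, u) \<Rightarrow> posterior t u)" by (simp add: split_beta')
  qed
  finally show "(\<lambda>(t, u). posterior t u) \<in> restrict_space ?Y E \<rightarrow>\<^sub>M prob_algebra MV" .
qed

section \<open>Separating allocated from non-allocated atoms\<close>

definition block_law :: "nat \<Rightarrow> (nat \<Rightarrow> nat \<Rightarrow> nat) \<Rightarrow> (nat \<Rightarrow> 'a) \<Rightarrow> (nat \<Rightarrow> real) \<Rightarrow> (nat \<Rightarrow> 'a measure) measure" where
  "block_law l c \<tau> u = add_law P0 d (allocated_law P0 d n \<gamma> c \<tau> u) (iid_atoms_law P0 d {1..l} \<gamma> (\<lambda>j. u j + 1))"

lemma measurable_emeasure_kernel:
  assumes "K \<in> L \<rightarrow>\<^sub>M prob_algebra MV" "A \<in> sets MV"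
  shows "(\<lambda>w. emeasure (K w) A) \<in> borel_measurable L"
  by (rule measurable_compose[OF measurable_prob_algebraD[OF assms(1)] measurable_emeasure_subprob_algebra[OF assms(2)]])

lemma measurable_block_law:
  assumes \<tau>: "\<And>k. k \<in> distinct_values d n c \<Longrightarrow> (\<lambda>w. \<tau> w k) \<in> L \<rightarrow>\<^sub>M P0"
    and u: "\<And>j. j \<in> {1..d} \<Longrightarrow> (\<lambda>w. u w j) \<in> borel_measurable L"
  shows "(\<lambda>w. block_law l c (\<tau> w) (u w)) \<in> L \<rightarrow>\<^sub>M prob_algebra MV"
proof -
  note u[measurable]
  show ?thesis
    unfolding block_law_def
    by (intro measurable_add_law measurable_allocated_law \<tau> u measurable_iid_atoms_law P0_axiom) auto
qed

lemma P0s_component: "k \<in> {1..m} \<Longrightarrow> (\<lambda>\<tau>. \<tau> k) \<in> P0s m \<rightarrow>\<^sub>M P0"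
  by (rule measurable_component_singleton)

lemma prob_space_P0s: "prob_space (PiM R (\<lambda>_. P0))"
  by (intro prob_space_PiM P0_axiom)

lemma prob_space_allocated_law:
  assumes "\<And>k. k \<in> distinct_values d n c \<Longrightarrow> \<tau> k \<in> space P0"
  shows "prob_space (allocated_law P0 d n \<gamma> c \<tau> u)"
  unfolding allocated_law_def using assms by (intro prob_space_gamma_atoms_law) auto

text \<open>
  Given the allocation, the non-allocated atoms are independent of everything else, and the
  sample only depends on the allocated ones.
\<close>

lemma nn_integral_split_atoms:
  assumes c: "distinct_values d n c \<subseteq> {1..m}"
    and g: "g \<in> borel_measurable SS" and A: "A \<in> sets MV"
  shows "(\<integral>\<^sup>+\<tau>. g (relabel d n \<tau> c) * emeasure (gamma_atoms_law P0 d {1..m} \<tau>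
        (\<lambda>j k. real (multiplicity_of n c j k) + \<gamma> j) (\<lambda>j. u j + 1)) A \<partial>P0s m) =
    (\<integral>\<^sup>+\<tau>. g (relabel d n \<tau> c) * emeasure (block_law (m - card (distinct_values d n c)) c \<tau> u) A \<partial>P0s m)"
    (is "(\<integral>\<^sup>+\<tau>. ?l \<tau> \<partial>_) = (\<integral>\<^sup>+\<tau>. ?r \<tau> \<partial>_)")
proof -
  let ?R = "distinct_values d n c" and ?R' = "{1..m} - distinct_values d n c"
  let ?a = "\<lambda>j k. real (multiplicity_of n c j k) + \<gamma> j" and ?b = "\<lambda>j. u j + 1"
  let ?P = "\<lambda>R. PiM R (\<lambda>_. P0)"
  interpret product_sigma_finite "\<lambda>_. P0" ..
  have U: "?R \<union> ?R' = {1..m}" using c by auto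
  have grel: "(\<lambda>\<tau>. g (relabel d n \<tau> c)) \<in> borel_measurable (?P Q)" if "?R \<subseteq> Q" for Q
    using that by (intro measurable_compose[OF measurable_relabel g] measurable_component_singleton) auto
  have l: "?l \<in> borel_measurable (P0s m)"
    using A c by (intro borel_measurable_times_ennreal grel measurable_emeasure_kernel measurable_gamma_atoms_law
        P0s_component) auto
  have r: "?r \<in> borel_measurable (P0s m)"
    using A c by (intro borel_measurable_times_ennreal grel measurable_emeasure_kernel measurable_block_law
        P0s_component) auto
  have rel: "relabel d n (merge ?R ?R' (x, y)) c = relabel d n x c" for x y :: "nat \<Rightarrow> 'a"
    by (rule relabel_cong) (simp add: merge_def)
  have al: "gamma_atoms_law P0 d ?R (merge ?R ?R' (x, y)) ?a ?b = allocated_law P0 d n \<gamma> c x u" for x y :: "nat \<Rightarrow> 'a"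
    unfolding allocated_law_def by (rule gamma_atoms_law_cong) (auto simp: merge_def)
  \<comment> \<open>Missed labels have multiplicity 0, so their jumps keep the prior shapes.\<close>
  have nal: "gamma_atoms_law P0 d ?R' (merge ?R ?R' (x, y)) ?a ?b = gamma_atoms_law P0 d ?R' y (\<lambda>j k. \<gamma> j) ?b" for x y :: "nat \<Rightarrow> 'a"
    by (rule gamma_atoms_law_cong) (auto simp: merge_def multiplicity_of_eq_0)
  have iid: "iid_atoms_law P0 d ?R' \<gamma> ?b = iid_atoms_law P0 d {1..m - card ?R} \<gamma> ?b"
    using c by (intro iid_atoms_law_reindex P0_axiom) (auto simp: card_Diff_subset)
  have "(\<integral>\<^sup>+\<tau>. ?l \<tau> \<partial>P0s m) = (\<integral>\<^sup>+x. \<integral>\<^sup>+y. ?l (merge ?R ?R' (x, y)) \<partial>?P ?R' \<partial>?P ?R)"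
    by (rule product_nn_integral_fold[of ?R ?R' ?l, unfolded U]) (use l in auto)
  also have "\<dots> = (\<integral>\<^sup>+x. g (relabel d n x c) * emeasure (block_law (m - card ?R) c x u) A \<partial>?P ?R)"
  proof (intro nn_integral_cong)
    fix x assume x: "x \<in> space (?P ?R)"
    have X: "prob_space (allocated_law P0 d n \<gamma> c x u)"
      using x by (intro prob_space_allocated_law) (auto simp: space_PiM)
    have "(\<integral>\<^sup>+y. ?l (merge ?R ?R' (x, y)) \<partial>?P ?R') =
        (\<integral>\<^sup>+y. g (relabel d n x c) * emeasure (add_law P0 d (allocated_law P0 d n \<gamma> c x u) (gamma_atoms_law P0 d ?R' y (\<lambda>j k. \<gamma> j) ?b)) A \<partial>?P ?R')"
    proof (intro nn_integral_cong)
      fix y assume y: "y \<in> space (?P ?R')"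
      have "gamma_atoms_law P0 d (?R \<union> ?R') (merge ?R ?R' (x, y)) ?a ?b =
          add_law P0 d (gamma_atoms_law P0 d ?R (merge ?R ?R' (x, y)) ?a ?b) (gamma_atoms_law P0 d ?R' (merge ?R ?R' (x, y)) ?a ?b)"
        using x y by (intro gamma_atoms_law_Un) (auto simp: merge_def space_PiM PiE_iff)
      then show "?l (merge ?R ?R' (x, y)) = g (relabel d n x c) *
          emeasure (add_law P0 d (allocated_law P0 d n \<gamma> c x u) (gamma_atoms_law P0 d ?R' y (\<lambda>j k. \<gamma> j) ?b)) A"
        unfolding rel al nal U by simp
    qed
    also have "\<dots> = g (relabel d n x c) * (\<integral>\<^sup>+y. emeasure (add_law P0 d (allocated_law P0 d n \<gamma> c x u) (gamma_atoms_law P0 d ?R' y (\<lambda>j k. \<gamma> j) ?b)) A \<partial>?P ?R')"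
      using A X
      by (intro nn_integral_cmult measurable_emeasure_kernel measurable_add_law measurable_gamma_atoms_law
          measurable_component_singleton measurable_const) (auto simp: space_prob_algebra)
    also have "\<dots> = g (relabel d n x c) * emeasure (block_law (m - card ?R) c x u) A"
      unfolding block_law_def iid[symmetric]
      by (subst emeasure_add_law_iid_atoms_law[OF X sets_allocated_law P0_axiom A]) auto
    finally show "(\<integral>\<^sup>+y. ?l (merge ?R ?R' (x, y)) \<partial>?P ?R') = \<dots>" .
  qed
  \<comment> \<open>The integrand is free of \<open>y\<close>; a probability integral over
    \<open>y\<close> is reinserted in order to return to all \<open>m\<close> locations.\<close>
  also have "\<dots> = (\<integral>\<^sup>+x. \<integral>\<^sup>+y. ?r (merge ?R ?R' (x, y)) \<partial>?P ?R' \<partial>?P ?R)"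
  proof (intro nn_integral_cong)
    fix x :: "nat \<Rightarrow> 'a"
    have "block_law (m - card ?R) c (merge ?R ?R' (x, y)) u = block_law (m - card ?R) c x u" for y
      unfolding block_law_def al[symmetric, of x y] unfolding allocated_law_def ..
    then show "g (relabel d n x c) * emeasure (block_law (m - card ?R) c x u) A = (\<integral>\<^sup>+y. ?r (merge ?R ?R' (x, y)) \<partial>?P ?R')"
      using prob_space.emeasure_space_1[OF prob_space_P0s, of ?R'] by (simp add: rel)
  qed
  also have "\<dots> = (\<integral>\<^sup>+\<tau>. ?r \<tau> \<partial>P0s m)"
    by (rule product_nn_integral_fold[of ?R ?R' ?r, unfolded U, symmetric]) (use r in auto)
  finally show ?thesis .
qed

definition alloc_const :: "(nat \<Rightarrow> nat \<Rightarrow> nat) \<Rightarrow> (nat \<Rightarrow> real) \<Rightarrow> ennreal" where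
  "alloc_const c u = (\<Prod>j\<in>{1..d}. \<Prod>k\<in>distinct_values d n c. ennreal (tilt_const (\<gamma> j) (multiplicity_of n c j k) (u j)))"

text \<open>When \<open>l\<close> is the number of labels missed by \<open>c\<close>, this is the
  joint mass, given \<open>m\<close> prior atoms, of the allocation \<open>c\<close>, data in
  \<open>D\<close> and measures in \<open>A\<close>. Keeping \<open>l\<close> apart from
  \<open>m\<close> allows the surplus locations to be dropped in
  \<open>sum_allocations\<close>.\<close>

definition alloc_weight where
  "alloc_weight A D m c l = (\<integral>\<^sup>+u. aux_density d n u * ennreal (psis u) ^ l * alloc_const c u *
     (\<integral>\<^sup>+\<tau>. indicator D (relabel d n \<tau> c, u) * emeasure (block_law l c \<tau> u) A \<partial>P0s m) \<partial>UU)"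

lemma measurable_alloc_const[measurable]: "alloc_const c \<in> borel_measurable UU"
proof -
  have [measurable]: "(\<lambda>u. u j) \<in> borel_measurable UU" if "j \<in> {1..d}" for j
    using measurable_component_singleton[OF that, of "\<lambda>_. lborel :: real measure"] by simp
  show ?thesis unfolding alloc_const_def tilt_const_def by measurable
qed

lemma UU_component: "j \<in> {1..d} \<Longrightarrow> (\<lambda>u. u j) \<in> borel_measurable UU"
  using measurable_component_singleton[of j "{1..d}" "\<lambda>_. lborel :: real measure"] by simp

lemma sets_UU: "sets UU = sets (PiM {1..d} (\<lambda>_. borel))"
  by (intro sets_PiM_cong) auto

lemma sigma_finite_UU: "sigma_finite_measure UU"
  by (intro sigma_finite_PiM) (auto intro: lborel.sigma_finite_measure_axioms)

lemma measurable_relabel_pair: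
  assumes c: "\<And>k. k \<in> distinct_values d n c \<Longrightarrow> (\<lambda>w. \<tau> w k) \<in> L \<rightarrow>\<^sub>M P0" and u: "u \<in> L \<rightarrow>\<^sub>M UU"
  shows "(\<lambda>w. (relabel d n (\<tau> w) c, u w)) \<in> L \<rightarrow>\<^sub>M SS \<Otimes>\<^sub>M PiM {1..d} (\<lambda>_. borel)"
  using u measurable_relabel[OF c] unfolding measurable_cong_sets[OF refl sets_UU] by (intro measurable_Pair)

text \<open>Only the locations with labels \<open>\<sigma> 1, ..., \<sigma> k\<close> enter, and
  they are distributed like \<open>k\<close> fresh draws from \<open>P0\<close>. This is the
  invariance demanded by \<open>sum_allocations\<close>.\<close>

lemma alloc_weight_relabel:
  assumes \<sigma>: "inj_on \<sigma> {1..k}" "\<sigma> ` {1..k} \<subseteq> {1..m}" and c: "c \<in> onto_allocations d n k"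
    and D: "D \<in> sets (SS \<Otimes>\<^sub>M PiM {1..d} (\<lambda>_. borel))" and A: "A \<in> sets MV"
  shows "alloc_weight A D m (relabel d n \<sigma> c) l = alloc_weight A D k c l"
proof -
  have \<sigma>': "\<sigma> i \<in> {1..m}" if "i \<in> {1..k}" for i using \<sigma>(2) that by blast
  have dc: "distinct_values d n c = {1..k}" using c by (simp add: onto_allocations_def)
  have "alloc_const (relabel d n \<sigma> c) u = alloc_const c u" for u
    unfolding alloc_const_def distinct_values_relabel dc prod.reindex[OF \<sigma>(1)] comp_def
    using \<sigma>(1) by (intro prod.cong refl) (simp add: dc multiplicity_of_relabel)
  moreover have "(\<integral>\<^sup>+\<tau>. indicator D (relabel d n \<tau> (relabel d n \<sigma> c), u) * emeasure (block_law l (relabel d n \<sigma> c) \<tau> u) A \<partial>P0s m) =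
    (\<integral>\<^sup>+\<tau>. indicator D (relabel d n \<tau> c, u) * emeasure (block_law l c \<tau> u) A \<partial>P0s k)" if u: "u \<in> space UU" for u
  proof -
    let ?f = "\<lambda>\<tau>. indicator D (relabel d n \<tau> c, u) * emeasure (block_law l c \<tau> u) A :: ennreal"
    have f: "?f \<in> borel_measurable (P0s k)"
      using u D A
      by (intro borel_measurable_times_ennreal measurable_emeasure_kernel measurable_block_law P0s_component
          measurable_compose[OF measurable_relabel_pair borel_measurable_indicator]) (auto simp: dc)
    have "(\<integral>\<^sup>+\<tau>. ?f \<tau> \<partial>P0s k) = (\<integral>\<^sup>+\<tau>. ?f \<tau> \<partial>distr (P0s m) (P0s k) (\<lambda>w. \<lambda>i\<in>{1..k}. w (\<sigma> i)))"
      using \<sigma> P0_axiom by (subst distr_PiM_reindex[where M = "\<lambda>_. P0"]) auto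
    also have "\<dots> = (\<integral>\<^sup>+\<tau>. ?f (\<lambda>i\<in>{1..k}. \<tau> (\<sigma> i)) \<partial>P0s m)"
      using f by (intro nn_integral_distr measurable_restrict P0s_component \<sigma>') auto
    also have "\<dots> = (\<integral>\<^sup>+\<tau>. indicator D (relabel d n \<tau> (relabel d n \<sigma> c), u) * emeasure (block_law l (relabel d n \<sigma> c) \<tau> u) A \<partial>P0s m)"
    proof (intro nn_integral_cong)
      fix \<tau> assume \<tau>: "\<tau> \<in> space (P0s m)"
      have "relabel d n (\<lambda>i\<in>{1..k}. \<tau> (\<sigma> i)) c = relabel d n \<tau> (relabel d n \<sigma> c)"
        unfolding relabel_relabel by (rule relabel_cong) (simp add: dc)
      moreover have "allocated_law P0 d n \<gamma> c (\<lambda>i\<in>{1..k}. \<tau> (\<sigma> i)) u = allocated_law P0 d n \<gamma> (relabel d n \<sigma> c) \<tau> u"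
      proof -
        have "allocated_law P0 d n \<gamma> c (\<lambda>i\<in>{1..k}. \<tau> (\<sigma> i)) u = allocated_law P0 d n \<gamma> c (\<lambda>i. \<tau> (\<sigma> i)) u"
          unfolding allocated_law_def by (rule gamma_atoms_law_cong) (auto simp: dc)
        also have "\<dots> = allocated_law P0 d n \<gamma> (relabel d n \<sigma> c) \<tau> u"
          using \<sigma>(1) \<tau> \<sigma>' by (intro allocated_law_relabel[symmetric]) (simp_all add: dc space_PiM PiE_iff)
        finally show ?thesis .
      qed
      ultimately show "?f (\<lambda>i\<in>{1..k}. \<tau> (\<sigma> i)) =
          indicator D (relabel d n \<tau> (relabel d n \<sigma> c), u) * emeasure (block_law l (relabel d n \<sigma> c) \<tau> u) A"
        by (simp add: block_law_def)
    qed
    finally show ?thesis ..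
  qed
  ultimately show ?thesis unfolding alloc_weight_def by (intro nn_integral_cong) simp
qed

section \<open>Integrating the likelihood over a prior with a fixed number of atoms\<close>

abbreviation "YY \<equiv> SS \<Otimes>\<^sub>M PiM {1..d} (\<lambda>_. borel :: real measure)"

definition sample_kernel :: "(nat \<Rightarrow> 'a measure) \<Rightarrow> ((nat \<Rightarrow> nat \<Rightarrow> 'a) \<times> (nat \<Rightarrow> real)) measure" where
  "sample_kernel v = PiM {1..d} (\<lambda>j. PiM {1..n j} (\<lambda>_. normalize_measure (v j))) \<Otimes>\<^sub>M
     PiM {1..d} (\<lambda>j. gamma_law (real (n j)) (measure (v j) (space (v j))))"

lemma AE_gamma_PiM_pos:
  fixes m :: nat
  shows "AE S in PiM {1..d} (\<lambda>j. PiM {1..m} (\<lambda>k. gamma_law (\<gamma> j) 1)). \<forall>j\<in>{1..d}. \<forall>k\<in>{1..m}. S j k > 0"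
proof (intro AE_finite_allI finite_atLeastAtMost)
  fix j k assume j: "j \<in> {1..d}" and k: "k \<in> {1..m}"
  have "AE s in PiM {1..m} (\<lambda>k. gamma_law (\<gamma> j) 1). s k > 0"
    using AE_gamma_law_pos[OF \<gamma>[OF j], of 1] k
    by (intro AE_PiM_component[where P = "\<lambda>x. x > 0"] prob_space_gamma_law) auto
  then show "AE S in PiM {1..d} (\<lambda>j. PiM {1..m} (\<lambda>k. gamma_law (\<gamma> j) 1)). S j k > 0"
    using j by (intro AE_PiM_component[where P = "\<lambda>s. s k > 0"] prob_space_gamma_PiM) auto
qed

text \<open>The order of integration is the point. The jumps are moved innermost, so that tilting
  evaluates them for fixed locations and \<open>u\<close>; then the locations are moved inside
  \<open>u\<close>, where \<open>nn_integral_split_atoms\<close> produces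
  \<open>block_law\<close>.\<close>

lemma nn_integral_prior_term:
  assumes m: "m \<ge> 1" and K: "sample_kernel \<in> MV \<rightarrow>\<^sub>M subprob_algebra YY"
    and A: "A \<in> sets MV" and D: "D \<in> sets YY"
  shows "(\<integral>\<^sup>+v. emeasure (sample_kernel v) D * indicator A v \<partial>iid_atoms_law P0 d {1..m} \<gamma> (\<lambda>_. 1)) =
    (\<Sum>c\<in>allocations d n m. alloc_weight A D m c (m - card (distinct_values d n c)))"
proof -
  let ?G = "PiM {1..d} (\<lambda>j. PiM {1..m} (\<lambda>k. gamma_law (\<gamma> j) 1))"
  let ?GB = "PiM {1..d} (\<lambda>j. PiM {1..m} (\<lambda>k. borel)) :: (nat \<Rightarrow> nat \<Rightarrow> real) measure"
  let ?V = "\<lambda>\<tau> S. \<lambda>j\<in>{1..d}. atomic_measure P0 {1..m} (S j) \<tau>"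
  let ?f = "\<lambda>v. emeasure (sample_kernel v) D * indicator A v"
  let ?gal = "\<lambda>c \<tau> u. gamma_atoms_law P0 d {1..m} \<tau> (\<lambda>j k. real (multiplicity_of n c j k) + \<gamma> j) (\<lambda>j. u j + 1)"
  let ?T = "\<lambda>c u. ennreal (psis u) ^ (m - card (distinct_values d n c)) * alloc_const c u"
  interpret G: prob_space ?G by (intro prob_space_PiM prob_space_gamma_law)
  interpret U: sigma_finite_measure UU by (rule sigma_finite_UU)
  interpret GU: pair_sigma_finite ?G UU ..
  interpret PP: prob_space "P0s m" by (rule prob_space_P0s)
  interpret PU: pair_sigma_finite "P0s m" UU ..
  have sets_G: "sets ?G = sets ?GB" by (intro sets_PiM_cong) auto
  have f: "?f \<in> borel_measurable MV"
    using A by (intro borel_measurable_times_ennreal borel_measurable_indicator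
        measurable_compose[OF K measurable_emeasure_subprob_algebra[OF D]])
  have V: "?V \<tau> \<in> ?G \<rightarrow>\<^sub>M MV" if "\<tau> \<in> space (P0s m)" for \<tau>
    unfolding measurable_cong_sets[OF sets_G refl] using that
    by (intro measurable_atomic_vectors measurable_const) (auto simp: space_PiM)
  have VB: "?V \<tau> \<in> ?GB \<rightarrow>\<^sub>M MV" if "\<tau> \<in> space (P0s m)" for \<tau>
    using V[OF that] unfolding measurable_cong_sets[OF sets_G refl] .
  have dv: "distinct_values d n c \<subseteq> {1..m}" if "c \<in> allocations d n m" for c
    using that by (simp add: distinct_values_allocations)
  have rel_meas: "(\<lambda>w. (relabel d n (fst w) c, snd w)) \<in> P0s m \<Otimes>\<^sub>M UU \<rightarrow>\<^sub>M YY" if "c \<in> allocations d n m" for c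
    using dv[OF that] by (intro measurable_relabel_pair measurable_compose[OF measurable_fst P0s_component]) auto
  have ind: "(\<lambda>w. indicator D (relabel d n (fst w) c, snd w) :: ennreal) \<in> borel_measurable (P0s m \<Otimes>\<^sub>M UU)" if "c \<in> allocations d n m" for c
    using measurable_compose[OF rel_meas[OF that] borel_measurable_indicator[OF D]] .
  have ind': "(\<lambda>u. indicator D (relabel d n \<tau> c, u) :: ennreal) \<in> borel_measurable UU"
    if "c \<in> allocations d n m" "\<tau> \<in> space (P0s m)" for c \<tau>
    using measurable_compose[OF measurable_Pair1'[OF that(2)] ind[OF that(1)]] by simp
  have ind'': "(\<lambda>\<tau>. indicator D (relabel d n \<tau> c, u) :: ennreal) \<in> borel_measurable (P0s m)"
    if "c \<in> allocations d n m" "u \<in> space UU" for c u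
    using measurable_compose[OF measurable_Pair2'[OF that(2)] ind[OF that(1)]] by simp
  have gal: "(\<lambda>w. emeasure (?gal c (fst w) (snd w)) A) \<in> borel_measurable (P0s m \<Otimes>\<^sub>M UU)" for c
    by (intro measurable_emeasure_kernel[OF _ A] measurable_gamma_atoms_law
        measurable_compose[OF measurable_fst P0s_component] borel_measurable_add borel_measurable_const
        measurable_compose[OF measurable_snd UU_component]) auto
  have T: "?T c \<in> borel_measurable UU" for c
    using measurable_psis[OF UU_component] by measurable
  have jl: "(\<lambda>w. jump_likelihood d n m c (snd w) (fst w)) \<in> borel_measurable (?G \<Otimes>\<^sub>M UU)" for c
  proof (rule measurable_jump_likelihood)
    fix j k assume jk: "j \<in> {1..d}" "k \<in> {1..m}"
    have "(\<lambda>S. S j k) \<in> ?G \<rightarrow>\<^sub>M gamma_law (\<gamma> j) 1"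
      using measurable_nested_component[OF jk, of "\<lambda>j k. gamma_law (\<gamma> j) 1"] .
    then have "(\<lambda>S. S j k) \<in> borel_measurable ?G"
      by (simp only: measurable_cong_sets[OF refl sets_gamma_law])
    then show "(\<lambda>w. fst w j k) \<in> borel_measurable (?G \<Otimes>\<^sub>M UU)" by (rule measurable_compose[OF measurable_fst])
  next
    fix j assume "j \<in> {1..d}"
    then show "(\<lambda>w. snd w j) \<in> borel_measurable (?G \<Otimes>\<^sub>M UU)" by (intro measurable_compose[OF measurable_snd UU_component])
  qed
  \<comment> \<open>The tilting constant \<open>?T c u\<close> splits into a power of
    \<open>psis u\<close> from the missed labels and \<open>alloc_const\<close> from the allocated
    ones.\<close>
  have jumps: "(\<integral>\<^sup>+S. indicator A (?V \<tau> S) * jump_likelihood d n m c u S \<partial>?G) = ?T c u * emeasure (?gal c \<tau> u) A"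
    if c: "c \<in> allocations d n m" and \<tau>: "\<tau> \<in> space (P0s m)" and u: "\<And>j. j \<in> {1..d} \<Longrightarrow> u j > 0" for c \<tau> u
  proof -
    let ?G' = "PiM {1..d} (\<lambda>j. PiM {1..m} (\<lambda>k. gamma_law (real (multiplicity_of n c j k) + \<gamma> j) (u j + 1)))"
    have s': "sets ?G' = sets ?GB" by (intro sets_PiM_cong) auto
    have "(\<integral>\<^sup>+S. indicator A (?V \<tau> S) * jump_likelihood d n m c u S \<partial>?G) =
      (\<Prod>j\<in>{1..d}. \<Prod>k\<in>{1..m}. ennreal (tilt_const (\<gamma> j) (multiplicity_of n c j k) (u j))) * (\<integral>\<^sup>+S. indicator A (?V \<tau> S) \<partial>?G')"
      unfolding jump_likelihood_def
      by (intro nn_integral_gamma_PiM_tilt \<gamma> u measurable_compose[OF VB[OF \<tau>] borel_measurable_indicator[OF A]]) auto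
    also have "(\<integral>\<^sup>+S. indicator A (?V \<tau> S) \<partial>?G') = emeasure (?gal c \<tau> u) A"
    proof -
      have V': "?V \<tau> \<in> ?G' \<rightarrow>\<^sub>M MV" using VB[OF \<tau>] unfolding measurable_cong_sets[OF s' refl] .
      have "(\<integral>\<^sup>+S. indicator A (?V \<tau> S) \<partial>?G') = (\<integral>\<^sup>+v. indicator A v \<partial>distr ?G' MV (?V \<tau>))"
        by (rule nn_integral_distr[OF V', symmetric]) (use A in simp)
      then show ?thesis using A by (simp add: gamma_atoms_law_def)
    qed
    also have "(\<Prod>j\<in>{1..d}. \<Prod>k\<in>{1..m}. ennreal (tilt_const (\<gamma> j) (multiplicity_of n c j k) (u j))) = ?T c u"
      unfolding psis_def alloc_const_def using dv[OF c] \<gamma> u by (rule prod_tilt_const)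
    finally show ?thesis .
  qed
  have inner: "(\<integral>\<^sup>+v. ?f v \<partial>gamma_atoms_law P0 d {1..m} \<tau> (\<lambda>j k. \<gamma> j) (\<lambda>_. 1)) =
      (\<Sum>c\<in>allocations d n m. \<integral>\<^sup>+u. aux_density d n u * ?T c u * (indicator D (relabel d n \<tau> c, u) * emeasure (?gal c \<tau> u) A) \<partial>UU)"
    if \<tau>: "\<tau> \<in> space (P0s m)" for \<tau>
  proof -
    let ?h = "\<lambda>c S u. aux_density d n u * indicator D (relabel d n \<tau> c, u) * (indicator A (?V \<tau> S) * jump_likelihood d n m c u S)"
    have h: "(\<lambda>w. ?h c (fst w) (snd w)) \<in> borel_measurable (?G \<Otimes>\<^sub>M UU)" if c: "c \<in> allocations d n m" for c
      using measurable_compose[OF measurable_fst measurable_compose[OF V[OF \<tau>] borel_measurable_indicator[OF A]]]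
      by (intro borel_measurable_times_ennreal jl measurable_compose[OF measurable_snd measurable_aux_density]
          measurable_compose[OF measurable_snd ind'[OF c \<tau>]])
    have "(\<integral>\<^sup>+v. ?f v \<partial>gamma_atoms_law P0 d {1..m} \<tau> (\<lambda>j k. \<gamma> j) (\<lambda>_. 1)) = (\<integral>\<^sup>+S. ?f (?V \<tau> S) \<partial>?G)"
      unfolding gamma_atoms_law_def by (rule nn_integral_distr[OF V[OF \<tau>]]) (use f in simp)
    also have "\<dots> = (\<integral>\<^sup>+S. (\<Sum>c\<in>allocations d n m. \<integral>\<^sup>+u. ?h c S u \<partial>UU) \<partial>?G)"
    \<comment> \<open>The expansion over allocations is available for positive jumps, that is almost
      everywhere.\<close>
    proof (rule nn_integral_cong_AE, rule AE_mp[OF AE_gamma_PiM_pos], rule AE_I2, rule impI)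
      fix S assume S: "\<forall>j\<in>{1..d}. \<forall>k\<in>{1..m}. S j k > (0::real)" and S': "S \<in> space ?G"
      have e1: "emeasure (sample_kernel (?V \<tau> S)) D =
        (\<Sum>c\<in>allocations d n m. \<integral>\<^sup>+u. aux_density d n u * indicator D (relabel d n \<tau> c, u) *
          jump_likelihood d n m c u S \<partial>UU)"
        unfolding sample_kernel_def using S \<tau> m n D
        by (intro emeasure_sample_kernel) (auto simp: space_PiM)
      have e2: "(\<integral>\<^sup>+u. aux_density d n u * indicator D (relabel d n \<tau> c, u) * jump_likelihood d n m c u S \<partial>UU) * indicator A (?V \<tau> S) =
          (\<integral>\<^sup>+u. ?h c S u \<partial>UU)" if c: "c \<in> allocations d n m" for c
      proof -
        have "(\<lambda>u. jump_likelihood d n m c u S) \<in> borel_measurable UU"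
          using measurable_compose[OF measurable_Pair1'[OF S'] jl] by simp
        then have "(\<integral>\<^sup>+u. aux_density d n u * indicator D (relabel d n \<tau> c, u) * jump_likelihood d n m c u S \<partial>UU) * indicator A (?V \<tau> S) =
          (\<integral>\<^sup>+u. aux_density d n u * indicator D (relabel d n \<tau> c, u) * jump_likelihood d n m c u S * indicator A (?V \<tau> S) \<partial>UU)"
          using ind'[OF c \<tau>] by (intro nn_integral_multc[symmetric] borel_measurable_times_ennreal measurable_aux_density)
        then show ?thesis by (simp only: mult_ac)
      qed
      show "?f (?V \<tau> S) = (\<Sum>c\<in>allocations d n m. \<integral>\<^sup>+u. ?h c S u \<partial>UU)"
        unfolding e1 sum_distrib_right by (intro sum.cong refl e2)
    qed
    also have "\<dots> = (\<Sum>c\<in>allocations d n m. \<integral>\<^sup>+S. \<integral>\<^sup>+u. ?h c S u \<partial>UU \<partial>?G)"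
      using h by (intro nn_integral_sum U.borel_measurable_nn_integral) (simp add: split_beta')
    also have "\<dots> = (\<Sum>c\<in>allocations d n m. \<integral>\<^sup>+u. \<integral>\<^sup>+S. ?h c S u \<partial>?G \<partial>UU)"
      using h by (intro sum.cong refl GU.Fubini'[symmetric]) (simp add: split_beta')
    also have "\<dots> = (\<Sum>c\<in>allocations d n m. \<integral>\<^sup>+u. aux_density d n u * ?T c u * (indicator D (relabel d n \<tau> c, u) * emeasure (?gal c \<tau> u) A) \<partial>UU)"
    proof (intro sum.cong refl nn_integral_cong)
      fix c u assume c: "c \<in> allocations d n m" and u: "u \<in> space UU"
      have "(\<lambda>S. indicator A (?V \<tau> S) * jump_likelihood d n m c u S) \<in> borel_measurable ?G"
        using measurable_compose[OF V[OF \<tau>] borel_measurable_indicator[OF A]] measurable_compose[OF measurable_Pair2'[OF u] jl[of c]]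
        by (intro borel_measurable_times_ennreal) simp_all
      then have "(\<integral>\<^sup>+S. ?h c S u \<partial>?G) = aux_density d n u * indicator D (relabel d n \<tau> c, u) *
          (\<integral>\<^sup>+S. indicator A (?V \<tau> S) * jump_likelihood d n m c u S \<partial>?G)"
        by (rule nn_integral_cmult)
      also have "\<dots> = aux_density d n u * ?T c u * (indicator D (relabel d n \<tau> c, u) * emeasure (?gal c \<tau> u) A)"
      \<comment> \<open>Where \<open>aux_density\<close> vanishes both sides do; elsewhere
        \<open>u\<close> is positive and tilting applies.\<close>
      proof (cases "aux_density d n u = 0")
        case False
        then have pos: "u j > 0" if "j \<in> {1..d}" for j using aux_density_nonzeroD that by blast
        have "(\<integral>\<^sup>+S. indicator A (?V \<tau> S) * jump_likelihood d n m c u S \<partial>?G) = ?T c u * emeasure (?gal c \<tau> u) A"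
          using c \<tau> pos by (rule jumps)
        then show ?thesis by (simp only: mult_ac)
      qed simp
      finally show "(\<integral>\<^sup>+S. ?h c S u \<partial>?G) = \<dots>" .
    qed
    finally show ?thesis .
  qed
  have meas: "(\<lambda>w. aux_density d n (snd w) * ?T c (snd w) * (indicator D (relabel d n (fst w) c, snd w) * emeasure (?gal c (fst w) (snd w)) A))
      \<in> borel_measurable (P0s m \<Otimes>\<^sub>M UU)" if c: "c \<in> allocations d n m" for c
    by (intro borel_measurable_times_ennreal ind[OF c] gal measurable_compose[OF measurable_snd measurable_aux_density]
        measurable_compose[OF measurable_snd T])
  have "(\<integral>\<^sup>+v. ?f v \<partial>iid_atoms_law P0 d {1..m} \<gamma> (\<lambda>_. 1)) =
      (\<integral>\<^sup>+\<tau>. \<integral>\<^sup>+v. ?f v \<partial>gamma_atoms_law P0 d {1..m} \<tau> (\<lambda>j k. \<gamma> j) (\<lambda>_. 1) \<partial>P0s m)"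
    by (rule nn_integral_iid_atoms_law[OF _ f]) simp
  also have "\<dots> = (\<integral>\<^sup>+\<tau>. (\<Sum>c\<in>allocations d n m. \<integral>\<^sup>+u. aux_density d n u * ?T c u *
      (indicator D (relabel d n \<tau> c, u) * emeasure (?gal c \<tau> u) A) \<partial>UU) \<partial>P0s m)"
    by (intro nn_integral_cong inner)
  also have "\<dots> = (\<Sum>c\<in>allocations d n m. \<integral>\<^sup>+\<tau>. \<integral>\<^sup>+u. aux_density d n u * ?T c u *
      (indicator D (relabel d n \<tau> c, u) * emeasure (?gal c \<tau> u) A) \<partial>UU \<partial>P0s m)"
    using meas by (intro nn_integral_sum U.borel_measurable_nn_integral) (simp add: split_beta')
  also have "\<dots> = (\<Sum>c\<in>allocations d n m. \<integral>\<^sup>+u. \<integral>\<^sup>+\<tau>. aux_density d n u * ?T c u *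
      (indicator D (relabel d n \<tau> c, u) * emeasure (?gal c \<tau> u) A) \<partial>P0s m \<partial>UU)"
    using meas by (intro sum.cong refl PU.Fubini'[symmetric]) (simp add: split_beta')
  also have "\<dots> = (\<Sum>c\<in>allocations d n m. alloc_weight A D m c (m - card (distinct_values d n c)))"
    unfolding alloc_weight_def
  proof (intro sum.cong refl nn_integral_cong)
    fix c u assume c: "c \<in> allocations d n m" and u: "u \<in> space UU"
    have D': "(\<lambda>t. indicator D (t, u) :: ennreal) \<in> borel_measurable SS"
      using measurable_compose[OF measurable_Pair2' borel_measurable_indicator[OF D], of u] u by (simp add: space_PiM)
    have "(\<lambda>\<tau>. indicator D (relabel d n \<tau> c, u) * emeasure (?gal c \<tau> u) A) \<in> borel_measurable (P0s m)"
      using measurable_compose[OF measurable_Pair2'[OF u] gal[of c]] ind''[OF c u]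
      by (intro borel_measurable_times_ennreal) simp_all
    then have "(\<integral>\<^sup>+\<tau>. aux_density d n u * ?T c u * (indicator D (relabel d n \<tau> c, u) * emeasure (?gal c \<tau> u) A) \<partial>P0s m) =
        aux_density d n u * ?T c u * (\<integral>\<^sup>+\<tau>. indicator D (relabel d n \<tau> c, u) * emeasure (?gal c \<tau> u) A \<partial>P0s m)"
      by (rule nn_integral_cmult)
    also have "\<dots> = aux_density d n u * ?T c u *
        (\<integral>\<^sup>+\<tau>. indicator D (relabel d n \<tau> c, u) * emeasure (block_law (m - card (distinct_values d n c)) c \<tau> u) A \<partial>P0s m)"
      by (simp only: nn_integral_split_atoms[OF dv[OF c] D' A])
    finally show "(\<integral>\<^sup>+\<tau>. aux_density d n u * ?T c u * (indicator D (relabel d n \<tau> c, u) * emeasure (?gal c \<tau> u) A) \<partial>P0s m) =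
      aux_density d n u * ennreal (psis u) ^ (m - card (distinct_values d n c)) * alloc_const c u *
        (\<integral>\<^sup>+\<tau>. indicator D (relabel d n \<tau> c, u) * emeasure (block_law (m - card (distinct_values d n c)) c \<tau> u) A \<partial>P0s m)"
      by (simp only: mult.assoc)
  qed
  finally show ?thesis .
qed

section \<open>Summing over the number of atoms\<close>

definition count_const :: "nat \<Rightarrow> real \<Rightarrow> real" where
  "count_const k \<psi> = \<Lambda> ^ (k - 1) * exp (- \<Lambda>) / fact k * (\<Lambda> * \<psi> + real k) * exp (\<Lambda> * \<psi>)"

definition posterior_weight where
  "posterior_weight A D k c = (\<integral>\<^sup>+u. aux_density d n u * alloc_const c u * ennreal (count_const k (psis u)) *
     (\<integral>\<^sup>+\<tau>. indicator D (relabel d n \<tau> c, u) * emeasure (posterior (relabel d n \<tau> c) u) A \<partial>P0s k) \<partial>UU)"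

text \<open>At least one observation exists, hence at least one allocated atom. This supplies the
  hypothesis \<open>k \<ge> 1\<close> of \<open>pmf_pois1_choose\<close>, where \<Lambda> has the
  exponent \<open>k - 1\<close>.\<close>

lemma onto_allocations_pos:
  assumes "c \<in> onto_allocations d n k"
  shows "k \<ge> 1"
proof -
  have "c 1 1 \<in> distinct_values d n c"
    using d n[of 1] by (auto simp: distinct_values_def)
  then show ?thesis using assms by (auto simp: onto_allocations_def)
qed

lemma measurable_UU_P0s_relabel:
  assumes "distinct_values d n c \<subseteq> {1..k}"
  shows "(\<lambda>w. (relabel d n (snd w) c, fst w)) \<in> UU \<Otimes>\<^sub>M P0s k \<rightarrow>\<^sub>M YY"
  using assms
  by (intro measurable_relabel_pair measurable_compose[OF measurable_snd P0s_component] measurable_fst) auto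

text \<open>By \<open>pmf_pois1_choose\<close> the weights become \<open>count_const\<close>, which
  collects the factors free of \<open>l\<close>, times the point masses of \<open>q_star\<close>.
  The series in \<open>l\<close> then mixes the laws \<open>block_law l c\<close> into
  \<open>posterior\<close>.\<close>

lemma suminf_alloc_weight:
  assumes c: "c \<in> onto_allocations d n k" and A: "A \<in> sets MV" and D: "D \<in> sets YY"
  shows "(\<Sum>l. ennreal (pmf (pois1_pmf \<Lambda>) (l + k)) * (of_nat ((l + k) choose k) * alloc_weight A D k c l)) =
    posterior_weight A D k c"
proof -
  have dc: "distinct_values d n c = {1..k}" using c by (simp add: onto_allocations_def)
  let ?co = "\<lambda>l. ennreal (pmf (pois1_pmf \<Lambda>) (l + k)) * of_nat ((l + k) choose k)"
  let ?q = "\<lambda>u l. ennreal (pmf (q_star (\<Lambda> * psis u) k) l)"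
  let ?J = "\<lambda>l u \<tau>. indicator D (relabel d n \<tau> c, u) * emeasure (block_law l c \<tau> u) A :: ennreal"
  let ?I = "\<lambda>l u. \<integral>\<^sup>+\<tau>. ?J l u \<tau> \<partial>P0s k"
  interpret PP: prob_space "P0s k" by (rule prob_space_P0s)
  have J: "(\<lambda>w. ?J l (fst w) (snd w)) \<in> borel_measurable (UU \<Otimes>\<^sub>M P0s k)" for l
    using measurable_compose[OF measurable_UU_P0s_relabel borel_measurable_indicator[OF D], of c k]
    by (intro borel_measurable_times_ennreal measurable_emeasure_kernel[OF _ A] measurable_block_law
        measurable_compose[OF measurable_snd P0s_component] measurable_compose[OF measurable_fst UU_component])
       (auto simp: dc)
  have I: "?I l \<in> borel_measurable UU" for l
    using J[of l] by (intro PP.borel_measurable_nn_integral) (simp add: split_beta')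
  have J': "?J l u \<in> borel_measurable (P0s k)" if "u \<in> space UU" for l u
    using measurable_compose[OF measurable_Pair1'[OF that] J[of l]] by simp
  \<comment> \<open>\<open>posterior\<close> counts distinct values of the sample, whereas
    \<open>c\<close> counts labels; the two counts agree for distinct locations.\<close>
  have AE_inj: "AE \<tau> in P0s k. inj_on \<tau> {1..k}"
    by (rule AE_PiM_inj_on[OF P0_axiom _ diagonal]) (auto intro: diffuse)
  have inner: "(\<Sum>l. ?q u l * ?I l u) =
      (\<integral>\<^sup>+\<tau>. indicator D (relabel d n \<tau> c, u) * emeasure (posterior (relabel d n \<tau> c) u) A \<partial>P0s k)"
    if u: "u \<in> space UU" for u
  proof -
    have "(\<Sum>l. ?q u l * ?I l u) = (\<Sum>l. \<integral>\<^sup>+\<tau>. ?q u l * ?J l u \<tau> \<partial>P0s k)"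
      using J'[OF u] by (intro suminf_cong nn_integral_cmult[symmetric])
    also have "\<dots> = (\<integral>\<^sup>+\<tau>. (\<Sum>l. ?q u l * ?J l u \<tau>) \<partial>P0s k)"
      by (intro nn_integral_suminf[symmetric] borel_measurable_times_ennreal[OF borel_measurable_const J'[OF u]])
    also have "\<dots> = (\<integral>\<^sup>+\<tau>. indicator D (relabel d n \<tau> c, u) * emeasure (posterior (relabel d n \<tau> c) u) A \<partial>P0s k)"
    proof (rule nn_integral_cong_AE, rule AE_mp[OF AE_inj], rule AE_I2, rule impI)
      fix \<tau> assume \<tau>: "\<tau> \<in> space (P0s k)" and inj: "inj_on \<tau> {1..k}"
      have \<tau>': "\<tau> i \<in> space P0" if "i \<in> distinct_values d n c" for i using \<tau> that by (auto simp: dc space_PiM)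
      have "posterior (relabel d n \<tau> c) u = add_law P0 d (allocated_law P0 d n \<gamma> c \<tau> u)
          (random_atoms_law (q_star (\<Lambda> * psis u) k) d P0 \<gamma> (\<lambda>j. u j + 1))"
        using posterior_relabel[of \<tau> c u] inj \<tau>' by (simp add: dc)
      then have "emeasure (posterior (relabel d n \<tau> c) u) A = (\<Sum>l. ?q u l * emeasure (block_law l c \<tau> u) A)"
        unfolding block_law_def using A \<tau>'
        by (simp only:) (intro emeasure_add_law_random_atoms_law prob_space_allocated_law sets_allocated_law P0_axiom)
      moreover have "(\<Sum>l. ?q u l * ?J l u \<tau>) = indicator D (relabel d n \<tau> c, u) * (\<Sum>l. ?q u l * emeasure (block_law l c \<tau> u) A)"
        unfolding ennreal_suminf_cmult[symmetric] by (simp only: mult_ac)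
      ultimately show "(\<Sum>l. ?q u l * ?J l u \<tau>) = indicator D (relabel d n \<tau> c, u) * emeasure (posterior (relabel d n \<tau> c) u) A"
        by simp
    qed
    finally show ?thesis .
  qed
  have psis': "(\<lambda>u. ennreal (psis u)) \<in> borel_measurable UU"
    using measurable_psis[OF UU_component] by simp
  have meas: "(\<lambda>u. aux_density d n u * ennreal (psis u) ^ l * alloc_const c u * ?I l u) \<in> borel_measurable UU" for l
    by (intro borel_measurable_times_ennreal borel_measurable_power_ennreal psis' measurable_aux_density
        measurable_alloc_const I)
  have "(\<Sum>l. ennreal (pmf (pois1_pmf \<Lambda>) (l + k)) * (of_nat ((l + k) choose k) * alloc_weight A D k c l)) =
      (\<Sum>l. \<integral>\<^sup>+u. ?co l * (aux_density d n u * ennreal (psis u) ^ l * alloc_const c u * ?I l u) \<partial>UU)"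
    unfolding alloc_weight_def mult.assoc[of "ennreal (pmf _ _)", symmetric]
    by (intro suminf_cong nn_integral_cmult[OF meas, symmetric])
  also have "\<dots> = (\<integral>\<^sup>+u. (\<Sum>l. ?co l * (aux_density d n u * ennreal (psis u) ^ l * alloc_const c u * ?I l u)) \<partial>UU)"
    by (intro nn_integral_suminf[symmetric] borel_measurable_times_ennreal[OF borel_measurable_const meas])
  also have "\<dots> = posterior_weight A D k c"
    unfolding posterior_weight_def
  proof (intro nn_integral_cong)
    fix u assume u: "u \<in> space UU"
    show "(\<Sum>l. ?co l * (aux_density d n u * ennreal (psis u) ^ l * alloc_const c u * ?I l u)) =
      aux_density d n u * alloc_const c u * ennreal (count_const k (psis u)) *
      (\<integral>\<^sup>+\<tau>. indicator D (relabel d n \<tau> c, u) * emeasure (posterior (relabel d n \<tau> c) u) A \<partial>P0s k)"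
    \<comment> \<open>\<open>pmf_pois1_choose\<close> wants \<open>psis u > 0\<close>, which is
      available where \<open>aux_density\<close> is nonzero.\<close>
    proof (cases "aux_density d n u = 0")
      case False
      have pos: "psis u > 0" using aux_density_nonzeroD[OF False] by (intro psis_pos)
      have co: "?co l * ennreal (psis u) ^ l = ennreal (count_const k (psis u)) * ?q u l" for l
      proof -
        have "?co l * ennreal (psis u) ^ l =
            ennreal (pmf (pois1_pmf \<Lambda>) (l + k) * real ((l + k) choose k) * psis u ^ l)"
          using pos by (simp add: ennreal_of_nat_eq_real_of_nat ennreal_mult ennreal_power)
        also have "\<dots> = ennreal (count_const k (psis u) * pmf (q_star (\<Lambda> * psis u) k) l)"
          unfolding count_const_def pmf_pois1_choose[OF \<Lambda> pos onto_allocations_pos[OF c]] ..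
        also have "\<dots> = ennreal (count_const k (psis u)) * ?q u l"
          by (rule ennreal_mult'') simp
        finally show ?thesis .
      qed
      have "(\<Sum>l. ?co l * (aux_density d n u * ennreal (psis u) ^ l * alloc_const c u * ?I l u)) =
          (\<Sum>l. aux_density d n u * alloc_const c u * ennreal (count_const k (psis u)) * (?q u l * ?I l u))"
      proof (rule suminf_cong)
        fix l
        have "?co l * (aux_density d n u * ennreal (psis u) ^ l * alloc_const c u * ?I l u) =
            aux_density d n u * alloc_const c u * (?co l * ennreal (psis u) ^ l) * ?I l u"
          by (simp only: mult_ac)
        then show "?co l * (aux_density d n u * ennreal (psis u) ^ l * alloc_const c u * ?I l u) =
            aux_density d n u * alloc_const c u * ennreal (count_const k (psis u)) * (?q u l * ?I l u)"
          unfolding co by (simp only: mult.assoc)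
      qed
      also have "\<dots> = aux_density d n u * alloc_const c u * ennreal (count_const k (psis u)) * (\<Sum>l. ?q u l * ?I l u)"
        by (rule ennreal_suminf_cmult)
      finally show ?thesis unfolding inner[OF u] .
    qed simp
  qed
  finally show ?thesis .
qed

lemma nn_integral_prior:
  assumes K: "sample_kernel \<in> MV \<rightarrow>\<^sub>M subprob_algebra YY" and A: "A \<in> sets MV" and D: "D \<in> sets YY"
  shows "(\<integral>\<^sup>+v. emeasure (sample_kernel v) D * indicator A v \<partial>vec_fdp_unnormalized d \<Lambda> \<gamma> P0) =
    (\<Sum>z\<in>(SIGMA k:{..(\<Sum>j\<in>{1..d}. n j)}. onto_allocations d n k). posterior_weight A D (fst z) (snd z))"
proof -
  let ?N = "\<Sum>j\<in>{1..d}. n j"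
  let ?f = "\<lambda>v. emeasure (sample_kernel v) D * indicator A v"
  let ?p = "\<lambda>m. ennreal (pmf (pois1_pmf \<Lambda>) m)"
  let ?a = "\<lambda>k c m. ?p m * (of_nat (m choose k) * alloc_weight A D k c (m - k))"
  have f: "?f \<in> borel_measurable MV"
    using A by (intro borel_measurable_times_ennreal borel_measurable_indicator
        measurable_compose[OF K measurable_emeasure_subprob_algebra[OF D]])
  have "(\<integral>\<^sup>+v. ?f v \<partial>vec_fdp_unnormalized d \<Lambda> \<gamma> P0) =
      (\<Sum>m. ?p m * (\<integral>\<^sup>+v. ?f v \<partial>iid_atoms_law P0 d {1..m} \<gamma> (\<lambda>_. 1)))"
    unfolding vec_fdp_unnormalized_def by (rule nn_integral_random_atoms_law[OF P0_axiom f])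
  also have "\<dots> = (\<Sum>m. \<Sum>k\<in>{..?N}. \<Sum>c\<in>onto_allocations d n k. ?a k c m)"
  proof (rule suminf_cong)
    fix m
    show "?p m * (\<integral>\<^sup>+v. ?f v \<partial>iid_atoms_law P0 d {1..m} \<gamma> (\<lambda>_. 1)) =
        (\<Sum>k\<in>{..?N}. \<Sum>c\<in>onto_allocations d n k. ?a k c m)"
    \<comment> \<open>Without atoms there is nothing to draw from; the shifted Poisson law gives
      this case mass 0.\<close>
    proof (cases "m = 0")
      case False
      then have "(\<integral>\<^sup>+v. ?f v \<partial>iid_atoms_law P0 d {1..m} \<gamma> (\<lambda>_. 1)) =
          (\<Sum>c\<in>allocations d n m. alloc_weight A D m c (m - card (distinct_values d n c)))"
        by (intro nn_integral_prior_term K A D) simp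
      also have "\<dots> = (\<Sum>k\<in>{..?N}. of_nat (m choose k) * (\<Sum>c\<in>onto_allocations d n k. alloc_weight A D k c (m - k)))"
        by (intro sum_allocations[where \<Psi> = "alloc_weight A D"] alloc_weight_relabel D A)
      finally show ?thesis by (simp only: sum_distrib_left)
    qed (simp add: pmf_pois1_0)
  qed
  also have "\<dots> = (\<Sum>k\<in>{..?N}. \<Sum>c\<in>onto_allocations d n k. \<Sum>m. ?a k c m)"
    by (simp add: suminf_sum)
  also have "\<dots> = (\<Sum>k\<in>{..?N}. \<Sum>c\<in>onto_allocations d n k. posterior_weight A D k c)"
  proof (intro sum.cong refl)
    fix k c assume c: "c \<in> onto_allocations d n k"
    \<comment> \<open>The index becomes the number \<open>l = m - k\<close> of non-allocated atoms;
      terms with \<open>m < k\<close> carry a vanishing binomial.\<close>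
    have "(\<Sum>m. ?a k c m) = (\<Sum>l. ?a k c (l + k)) + (\<Sum>m<k. ?a k c m)"
      by (rule suminf_offset) simp
    also have "(\<Sum>m<k. ?a k c m) = 0" by (intro sum.neutral) simp
    finally show "(\<Sum>m. ?a k c m) = posterior_weight A D k c"
      using suminf_alloc_weight[OF c A D] by simp
  qed
  also have "\<dots> = (\<Sum>z\<in>(SIGMA k:{..?N}. onto_allocations d n k). posterior_weight A D (fst z) (snd z))"
    by (subst sum.Sigma) (simp_all add: finite_onto_allocations split_beta')
  finally show ?thesis .
qed

section \<open>Disintegration with respect to the data\<close>

definition weight_measure :: "nat \<Rightarrow> (nat \<Rightarrow> nat \<Rightarrow> nat) \<Rightarrow> ((nat \<Rightarrow> nat \<Rightarrow> 'a) \<times> (nat \<Rightarrow> real)) measure" where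
  "weight_measure k c = distr (density (UU \<Otimes>\<^sub>M P0s k)
     (\<lambda>w. aux_density d n (fst w) * alloc_const c (fst w) * ennreal (count_const k (psis (fst w)))))
     YY (\<lambda>w. (relabel d n (snd w) c, fst w))"

text \<open>\<open>weight_measure k c\<close> will turn out to be the share of the pattern
  \<open>c\<close> in the law of the data. It is built so that \<open>posterior_weight\<close>
  becomes an integral of \<open>posterior\<close> over data in \<open>D\<close>.\<close>

lemma nn_integral_weight_measure:
  assumes c: "c \<in> onto_allocations d n k" and f: "f \<in> borel_measurable YY"
  shows "(\<integral>\<^sup>+y. f y \<partial>weight_measure k c) = (\<integral>\<^sup>+u. aux_density d n u * alloc_const c u * ennreal (count_const k (psis u)) *
     (\<integral>\<^sup>+\<tau>. f (relabel d n \<tau> c, u) \<partial>P0s k) \<partial>UU)"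
proof -
  interpret PP: prob_space "P0s k" by (rule prob_space_P0s)
  let ?h = "\<lambda>u. aux_density d n u * alloc_const c u * ennreal (count_const k (psis u))"
  have r: "(\<lambda>w. (relabel d n (snd w) c, fst w)) \<in> UU \<Otimes>\<^sub>M P0s k \<rightarrow>\<^sub>M YY"
    using c by (intro measurable_UU_P0s_relabel) (simp add: onto_allocations_def)
  have "(\<lambda>u. ennreal (count_const k (psis u))) \<in> borel_measurable UU"
    using measurable_psis[OF UU_component] unfolding count_const_def by measurable
  then have h: "?h \<in> borel_measurable UU"
    by (intro borel_measurable_times_ennreal measurable_aux_density measurable_alloc_const)
  note h' = measurable_compose[OF measurable_fst h]
  note fr = measurable_compose[OF r f]
  have "(\<integral>\<^sup>+y. f y \<partial>weight_measure k c) =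
      (\<integral>\<^sup>+w. f (relabel d n (snd w) c, fst w) \<partial>density (UU \<Otimes>\<^sub>M P0s k) (\<lambda>w. ?h (fst w)))"
    unfolding weight_measure_def using r f by (intro nn_integral_distr) simp_all
  also have "\<dots> = (\<integral>\<^sup>+w. ?h (fst w) * f (relabel d n (snd w) c, fst w) \<partial>(UU \<Otimes>\<^sub>M P0s k))"
    by (rule nn_integral_density[OF h' fr])
  also have "\<dots> = (\<integral>\<^sup>+u. \<integral>\<^sup>+\<tau>. ?h u * f (relabel d n \<tau> c, u) \<partial>P0s k \<partial>UU)"
    using PP.nn_integral_fst[OF borel_measurable_times_ennreal[OF h' fr]] by simp
  also have "\<dots> = (\<integral>\<^sup>+u. ?h u * (\<integral>\<^sup>+\<tau>. f (relabel d n \<tau> c, u) \<partial>P0s k) \<partial>UU)"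
  proof (rule nn_integral_cong)
    fix u assume u: "u \<in> space UU"
    have "(\<lambda>\<tau>. f (relabel d n \<tau> c, u)) \<in> borel_measurable (P0s k)"
      using measurable_compose[OF measurable_Pair1'[OF u] fr] by simp
    then show "(\<integral>\<^sup>+\<tau>. ?h u * f (relabel d n \<tau> c, u) \<partial>P0s k) = ?h u * (\<integral>\<^sup>+\<tau>. f (relabel d n \<tau> c, u) \<partial>P0s k)"
      by (rule nn_integral_cmult)
  qed
  finally show ?thesis .
qed

text \<open>
  The joint law of the random measures and the data splits over the coincidence patterns of the
  sample, with \<^const>\<open>posterior\<close> factored out.  Since it is a probability kernel, integrating it
  out shows that the remaining factor is the law of the data, whose normalization is never
  needed.
\<close>

lemma has_cond_law_posterior:
  assumes \<mu>: "distr \<Omega> MV \<mu> = vec_fdp_unnormalized d \<Lambda> \<gamma> P0"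
    and law: "has_cond_law \<Omega> YY y MV \<mu> sample_kernel"
  shows "has_cond_law \<Omega> MV \<mu> YY y (\<lambda>(t, u). posterior t u)"
proof -
  let ?Z = "SIGMA k:{..(\<Sum>j\<in>{1..d}. n j)}. onto_allocations d n k"
  let ?\<kappa> = "\<lambda>(t, u). posterior t u"
  have \<mu>_meas: "\<mu> \<in> \<Omega> \<rightarrow>\<^sub>M MV" and y_meas: "y \<in> \<Omega> \<rightarrow>\<^sub>M YY" and K: "sample_kernel \<in> MV \<rightarrow>\<^sub>M subprob_algebra YY"
    and joint: "\<And>D A. D \<in> sets YY \<Longrightarrow> A \<in> sets MV \<Longrightarrow>
      emeasure \<Omega> {\<omega> \<in> space \<Omega>. y \<omega> \<in> D \<and> \<mu> \<omega> \<in> A} = (\<integral>\<^sup>+v\<in>A. emeasure (sample_kernel v) D \<partial>distr \<Omega> MV \<mu>)"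
    using law by (auto simp: has_cond_law_def)
  note \<kappa> = measurable_posterior
  have \<kappa>A: "(\<lambda>w. emeasure (?\<kappa> w) A) \<in> borel_measurable YY" if "A \<in> sets MV" for A
    by (rule measurable_emeasure_kernel[OF \<kappa> that])
  have main: "emeasure \<Omega> {\<omega> \<in> space \<Omega>. y \<omega> \<in> D \<and> \<mu> \<omega> \<in> A} =
      (\<Sum>z\<in>?Z. \<integral>\<^sup>+w. emeasure (?\<kappa> w) A * indicator D w \<partial>weight_measure (fst z) (snd z))"
    if D: "D \<in> sets YY" and A: "A \<in> sets MV" for A D
  proof -
    have "emeasure \<Omega> {\<omega> \<in> space \<Omega>. y \<omega> \<in> D \<and> \<mu> \<omega> \<in> A} = (\<Sum>z\<in>?Z. posterior_weight A D (fst z) (snd z))"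
      unfolding joint[OF D A] \<mu> by (rule nn_integral_prior[OF K A D])
    also have "\<dots> = (\<Sum>z\<in>?Z. \<integral>\<^sup>+w. emeasure (?\<kappa> w) A * indicator D w \<partial>weight_measure (fst z) (snd z))"
    proof (rule sum.cong[OF refl])
      fix z assume "z \<in> ?Z"
      then have "snd z \<in> onto_allocations d n (fst z)" by auto
      then have "(\<integral>\<^sup>+w. emeasure (?\<kappa> w) A * indicator D w \<partial>weight_measure (fst z) (snd z)) =
         (\<integral>\<^sup>+u. aux_density d n u * alloc_const (snd z) u * ennreal (count_const (fst z) (psis u)) *
           (\<integral>\<^sup>+\<tau>. emeasure (?\<kappa> (relabel d n \<tau> (snd z), u)) A * indicator D (relabel d n \<tau> (snd z), u) \<partial>P0s (fst z)) \<partial>UU)"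
        using \<kappa>A[OF A] D by (intro nn_integral_weight_measure borel_measurable_times_ennreal borel_measurable_indicator)
      then show "posterior_weight A D (fst z) (snd z) = (\<integral>\<^sup>+w. emeasure (?\<kappa> w) A * indicator D w \<partial>weight_measure (fst z) (snd z))"
        by (simp add: posterior_weight_def mult.commute[of "indicator _ _"])
    qed
    finally show ?thesis .
  qed
  let ?L = "distr \<Omega> YY y"
  have sets_w: "sets (weight_measure k c) = sets YY" for k c by (simp add: weight_measure_def)
  have L: "emeasure ?L D = (\<Sum>z\<in>?Z. emeasure (weight_measure (fst z) (snd z)) D)" if D: "D \<in> sets YY" for D
  proof -
    have "emeasure ?L D = emeasure \<Omega> {\<omega> \<in> space \<Omega>. y \<omega> \<in> D \<and> \<mu> \<omega> \<in> space MV}"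
      using D measurable_space[OF \<mu>_meas]
      by (subst emeasure_distr[OF y_meas]) (auto intro!: arg_cong[where f = "emeasure \<Omega>"])
    also have "\<dots> = (\<Sum>z\<in>?Z. \<integral>\<^sup>+w. emeasure (?\<kappa> w) (space MV) * indicator D w \<partial>weight_measure (fst z) (snd z))"
      by (rule main[OF D sets.top])
    also have "\<dots> = (\<Sum>z\<in>?Z. emeasure (weight_measure (fst z) (snd z)) D)"
    proof (rule sum.cong[OF refl])
      fix z
      have "(\<integral>\<^sup>+w. emeasure (?\<kappa> w) (space MV) * indicator D w \<partial>weight_measure (fst z) (snd z)) =
          (\<integral>\<^sup>+w. indicator D w \<partial>weight_measure (fst z) (snd z))"
      proof (rule nn_integral_cong)
        fix w assume "w \<in> space (weight_measure (fst z) (snd z))"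
        then have "w \<in> space YY" using sets_eq_imp_space_eq[OF sets_w] by metis
        from measurable_space[OF \<kappa> this] have "emeasure (?\<kappa> w) (space MV) = 1"
          by (rule in_space_prob_algebra)
        then show "emeasure (?\<kappa> w) (space MV) * indicator D w = indicator D w" by simp
      qed
      then show "(\<integral>\<^sup>+w. emeasure (?\<kappa> w) (space MV) * indicator D w \<partial>weight_measure (fst z) (snd z)) =
          emeasure (weight_measure (fst z) (snd z)) D"
        using D by (simp add: sets_w)
    qed
    finally show ?thesis .
  qed
  have "emeasure \<Omega> {\<omega> \<in> space \<Omega>. \<mu> \<omega> \<in> A \<and> y \<omega> \<in> D} = (\<integral>\<^sup>+w\<in>D. emeasure (?\<kappa> w) A \<partial>?L)"
    if A: "A \<in> sets MV" and D: "D \<in> sets YY" for A D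
  proof -
    have "(\<integral>\<^sup>+w. emeasure (?\<kappa> w) A * indicator D w \<partial>?L) =
        (\<Sum>z\<in>?Z. \<integral>\<^sup>+w. emeasure (?\<kappa> w) A * indicator D w \<partial>weight_measure (fst z) (snd z))"
    proof (rule nn_integral_sum_measures)
      show "finite ?Z" by (intro finite_SigmaI finite_onto_allocations) simp
      show "(\<lambda>w. emeasure (?\<kappa> w) A * indicator D w) \<in> borel_measurable ?L"
        using \<kappa>A[OF A] D unfolding measurable_distr_eq1
        by (intro borel_measurable_times_ennreal borel_measurable_indicator) simp_all
    qed (use L in \<open>auto simp: sets_w\<close>)
    then show ?thesis using main[OF D A] by (simp add: conj_commute)
  qed
  then show ?thesis
    unfolding has_cond_law_def using \<mu>_meas y_meas measurable_prob_algebraD[OF \<kappa>] by blast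
qed

end

section \<open>Return to the Euclidean state space\<close>

lemma sets_diagonal_restrict_space:
  fixes \<Theta> :: "'a :: {second_countable_topology, metric_space} set"
  defines "B \<equiv> restrict_space borel \<Theta>"
  shows "{z \<in> space (B \<Otimes>\<^sub>M B). fst z = snd z} \<in> sets (B \<Otimes>\<^sub>M B)"
proof -
  have id: "(\<lambda>x. x) \<in> B \<rightarrow>\<^sub>M borel" unfolding B_def by (rule measurable_restrict_space1) simp
  have [measurable]: "fst \<in> B \<Otimes>\<^sub>M B \<rightarrow>\<^sub>M borel" "snd \<in> B \<Otimes>\<^sub>M B \<rightarrow>\<^sub>M borel"
    using measurable_compose[OF measurable_fst id] measurable_compose[OF measurable_snd id] by auto
  \<comment> \<open>The diagonal is the zero set of \<open>dist\<close>, which second countability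
    makes measurable for the product sigma-algebra.\<close>
  have "{z \<in> space (B \<Otimes>\<^sub>M B). dist (fst z) (snd z) = 0} \<in> sets (B \<Otimes>\<^sub>M B)" by measurable
  then show ?thesis by simp
qed

theorem corollary1:
  fixes d :: nat and \<Lambda> :: real and \<gamma> :: "nat \<Rightarrow> real" and n :: "nat \<Rightarrow> nat"
    and \<Theta> :: "(real ^ 's) set" and P0 :: "(real ^ 's) measure"
    and \<Omega> :: "'w measure"
    and \<mu> P :: "'w \<Rightarrow> nat \<Rightarrow> (real ^ 's) measure"
    and \<theta> :: "'w \<Rightarrow> nat \<Rightarrow> nat \<Rightarrow> real ^ 's"
    and U :: "'w \<Rightarrow> nat \<Rightarrow> real"
    and K :: "(nat \<Rightarrow> nat \<Rightarrow> real ^ 's) \<Rightarrow> nat"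
    and \<theta>s :: "(nat \<Rightarrow> nat \<Rightarrow> real ^ 's) \<Rightarrow> nat \<Rightarrow> real ^ 's"
  defines "B \<equiv> restrict_space borel \<Theta>"
  assumes "d \<ge> 1" and "\<Lambda> > 0" and "\<And>j. j \<in> {1..d} \<Longrightarrow> \<gamma> j > 0"
    and "\<And>j. j \<in> {1..d} \<Longrightarrow> n j \<ge> 1"
    and "prob_space P0" and "sets P0 = sets B"
    and "\<And>x. x \<in> \<Theta> \<Longrightarrow> emeasure P0 {x} = 0"
    and "prob_space \<Omega>"
    and "\<mu> \<in> \<Omega> \<rightarrow>\<^sub>M measure_vectors d B"
    and "distr \<Omega> (measure_vectors d B) \<mu> = vec_fdp_unnormalized d \<Lambda> \<gamma> P0"
    and "\<And>\<omega>. \<omega> \<in> space \<Omega> \<Longrightarrow> P \<omega> = (\<lambda>j\<in>{1..d}. normalize_measure (\<mu> \<omega> j))"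
    and "distr \<Omega> (PiM {1..d} (\<lambda>_. subprob_algebra B)) P = vec_fdp d \<Lambda> \<gamma> P0"
    and "has_cond_law \<Omega>
           (samples_space d n B \<Otimes>\<^sub>M PiM {1..d} (\<lambda>_. borel)) (\<lambda>\<omega>. (\<theta> \<omega>, U \<omega>))
           (measure_vectors d B) \<mu>
           (\<lambda>m. PiM {1..d} (\<lambda>j. PiM {1..n j} (\<lambda>_. normalize_measure (m j))) \<Otimes>\<^sub>M
                PiM {1..d} (\<lambda>j. gamma_law (real (n j)) (measure (m j) (space (m j)))))"
    and "\<And>t. t \<in> space (samples_space d n B) \<Longrightarrow>
           bij_betw (\<theta>s t) {1..K t} (distinct_values d n t)"
  shows "has_cond_law \<Omega>
           (measure_vectors d B) \<mu>
           (samples_space d n B \<Otimes>\<^sub>M PiM {1..d} (\<lambda>_. borel)) (\<lambda>\<omega>. (\<theta> \<omega>, U \<omega>))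
           (\<lambda>(t, u).
              distr
                (fixed_atoms_law B d (K t) (\<theta>s t)
                   (\<lambda>j k. real (multiplicity_of n t j (\<theta>s t k)) + \<gamma> j) (\<lambda>j. u j + 1) \<Otimes>\<^sub>M
                 random_atoms_law (q_star (\<Lambda> * (\<Prod>j\<in>{1..d}. psi (\<gamma> j) (u j))) (K t))
                   d P0 \<gamma> (\<lambda>j. u j + 1))
                (measure_vectors d B)
                (\<lambda>(a, na). \<lambda>j\<in>{1..d}. add_measure (a j) (na j)))"
proof -
  note sets_P0 = \<open>sets P0 = sets B\<close>
  note space_P0 = sets_eq_imp_space_eq[OF sets_P0]
  have "space B = \<Theta>" by (simp add: B_def space_restrict_space)
  then interpret vec_fdp_model P0 d \<Lambda> \<gamma> n
    using assms(2-6,8) sets_diagonal_restrict_space[of \<Theta>, folded B_def]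
      sets_pair_measure_cong[OF sets_P0 sets_P0] sets_eq_imp_space_eq[OF sets_pair_measure_cong[OF sets_P0 sets_P0]]
    by (simp add: vec_fdp_model_def vec_fdp_model_axioms_def space_P0)
  \<comment> \<open>\<open>P0\<close> and \<open>B\<close> may differ as measures but share their
    sigma-algebra, and the spaces involved depend on the latter only.\<close>
  have MV: "measure_vectors d B = MV"
    by (simp add: finite_measure_algebra_cong[OF sets_P0])
  have sets_SS: "sets (samples_space d n B) = sets SS"
    using sets_P0 by (intro sets_PiM_cong) auto
  have sets_YY: "sets (samples_space d n B \<Otimes>\<^sub>M PiM {1..d} (\<lambda>_. borel)) = sets YY"
    by (intro sets_pair_measure_cong sets_SS refl)
  note space_SS = sets_eq_imp_space_eq[OF sets_SS]
  have "has_cond_law \<Omega> YY (\<lambda>\<omega>. (\<theta> \<omega>, U \<omega>)) MV \<mu> sample_kernel"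
    using \<open>has_cond_law \<Omega> (samples_space d n B \<Otimes>\<^sub>M _) _ _ _ _\<close>
    unfolding MV has_cond_law_cong_sets[OF sets_YY refl] sample_kernel_def .
  then have "has_cond_law \<Omega> MV \<mu> YY (\<lambda>\<omega>. (\<theta> \<omega>, U \<omega>)) (\<lambda>(t, u). posterior t u)"
    using assms(11) unfolding MV by (intro has_cond_law_posterior)
  \<comment> \<open>The two kernels agree at every sample, not merely almost everywhere:
    \<open>\<theta>s t\<close> enumerates the distinct values for each single \<open>t\<close>, and
    reindexing absorbs that choice.\<close>
  also have "?this \<longleftrightarrow> ?thesis"
    unfolding MV has_cond_law_cong_sets[OF refl sets_YY]
  proof (rule has_cond_law_cong_kernel, clarify)
    fix t u assume "(t, u) \<in> space YY"
    then have t: "t \<in> space SS" by (simp add: space_pair_measure)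
    have bij: "bij_betw (\<theta>s t) {1..K t} (distinct_values d n t)"
      using t unfolding space_SS[symmetric] by (rule assms)
    have KT: "K t = card (distinct_values d n t)"
      using bij_betw_same_card[OF bij] by simp
    have "relabel d n (\<lambda>x. x) t = t"
      using t unfolding space_samples_space by (rule relabel_ident)
    moreover have "x \<in> space P0" if "x \<in> distinct_values d n t" for x
      using t that by (auto simp: space_samples_space distinct_values_def PiE_iff)
    ultimately have "fixed_atoms_law P0 d (K t) (\<theta>s t)
         (\<lambda>j k. real (multiplicity_of n t j (\<theta>s t k)) + \<gamma> j) (\<lambda>j. u j + 1) = allocated_law P0 d n \<gamma> t (\<lambda>x. x) u"
      by (intro fixed_atoms_law_eq_allocated_law bij) auto
    moreover have "fixed_atoms_law P0 = fixed_atoms_law B"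
      by (intro ext) (simp add: fixed_atoms_law_eq gamma_atoms_law_cong_sets[OF sets_P0])
    ultimately show "posterior t u = distr
         (fixed_atoms_law B d (K t) (\<theta>s t)
            (\<lambda>j k. real (multiplicity_of n t j (\<theta>s t k)) + \<gamma> j) (\<lambda>j. u j + 1) \<Otimes>\<^sub>M
          random_atoms_law (q_star (\<Lambda> * (\<Prod>j\<in>{1..d}. psi (\<gamma> j) (u j))) (K t)) d P0 \<gamma> (\<lambda>j. u j + 1))
         MV (\<lambda>(a, na). \<lambda>j\<in>{1..d}. add_measure (a j) (na j))"
      by (simp add: posterior_def add_law_def psis_def KT)
  qed
  finally show ?thesis .
qed

end
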